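(* There exists an absolute constant $C>0$ such that the following holds. Consider, for $n\to\infty$, the linear models $Y=X\beta+\sigma\xi$ and the objects defined in the context, with $\epsilon\in(0,1]$. Suppose that there is a constant $K$ (independent of $n$ and $\alpha$) such that $$\sum_{i=1}^nG_\alpha(\lambda_i)\le K\sum_{i=1}^nG_\alpha^2(\lambda_i)\quad\text{for all }\alpha>0,$$ and that $\alpha_{\min}=\alpha_{\min}(n)$ and $\alpha_{\max}$ satisfy $$\lim_{n\to\infty}\frac{D(\alpha_{\min})}{n}=0,\qquad D(\alpha_{\max})\ge5 .$$ Then for every $\gamma\in\bigl(0,\epsilon/(1+\epsilon)\bigr)$ there is $n_\gamma$ such that for all $n\ge n_\gamma$ (for which $\rho_{\mathcal{A},\epsilon}(\beta)<1$, so that the right-hand side is defined) $$\mathbf{E}\,\Delta\bigl(\widehat\sigma^2_{\widehat\alpha}\bigr)\le\frac{r_{\mathcal{A},\epsilon}(\beta)}{\gamma}\biggl\{1+\frac{1}{\sqrt[4]{D(\alpha_{\max})}}\,\log^{-1/8}\biggl[\frac{1}{\rho_{\mathcal{A},\epsilon}(\beta)}\biggr]+\biggl[\frac{C\,\rho_{\mathcal{A},\epsilon}(\beta)}{\epsilon-\gamma-\gamma\epsilon}\biggr]^{1/2}\biggr\}^2 .$$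
   Context: Model. For each $n$ one observes $Y=X\beta+\sigma\xi\in\mathbb{R}^n$, where $X$ is a known $n\times p$ matrix, $n\ge p$, with $X^\top X$ invertible, $\beta\in\mathbb{R}^p$ is an unknown nuisance vector, $\sigma>0$ is unknown, and $\xi\in\mathbb{R}^n$ has independent $\mathcal{N}(0,1)$ components. The quantities $X,p,\beta,\sigma$ may depend on $n$. Let $\lambda_1\ge\dots\ge\lambda_p>0$ be the eigenvalues and $\mathbf{e}_1,\dots,\mathbf{e}_p$ the corresponding orthonormal eigenvectors of $X^\top X$; put $\bar\beta_k=\langle\beta,\mathbf{e}_k\rangle$ for $k\le p$, and $\lambda_k=0$, $\bar\beta_k=0$ for $p<k\le n$. Regularization. $\{H_\alpha(\cdot),\ \alpha>0\}$ is an ordered family of functions $\mathbb{R}^+\to[0,1]$, that is, for any $\alpha,\alpha'>0$ either $H_\alpha\le H_{\alpha'}$ everywhere or $H_{\alpha'}\le H_\alpha$ everywhere; by convention $H_\alpha(0)=0$. Put $H_\alpha(X^\top X)=\sum_{k=1}^pH_\alpha(\lambda_k)\mathbf{e}_k\mathbf{e}_k^\top$ and $$\widehat\beta_\alpha(Y)=H_\alpha(X^\top X)\bigl[(X^\top X)^{-1}X^\top Y\bigr],\qquad G_\alpha(\lambda)=2H_\alpha(\lambda)-[H_\alpha(\lambda)]^2,$$ $$q_\alpha(n)=\biggl[1-\frac1n\sum_{i=1}^pG_\alpha(\lambda_i)\biggr]^{-1}-1,\qquad D(\alpha)=\sum_{k=1}^nG_\alpha^2(\lambda_k),$$ $$\widehat\sigma^2_\alpha(Y)=\frac{1+q_\alpha(n)}{n}\bigl\|Y-X\widehat\beta_\alpha(Y)\bigr\|^2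 .$$ Parameter range. $\mathcal{A}=[\alpha_{\min},\alpha_{\max}]$, where $\alpha_{\min}=\alpha_{\min}(n)>0$ tends to $0$ as $n\to\infty$. Standing assumption: $\frac1n\sum_{i=1}^pG_\alpha(\lambda_i)\ll1$, understood as $\sup_{\alpha\in\mathcal{A}}\frac1n\sum_{i=1}^pG_\alpha(\lambda_i)\to0$ as $n\to\infty$. Penalty. With $Q=4/(\sqrt2-1)^2$, $$V_\epsilon(\alpha)=(1+\epsilon)\sqrt{2D(\alpha)}\,\biggl\{\log\frac{D(\alpha)}{D(\alpha_{\max})}+2(1+\epsilon)\log\biggl[\frac{Q}{\epsilon^2}\log\frac{D(\alpha)}{D(\alpha_{\max})}\biggr]\biggr\}^{1/2},$$ with the convention that $V_\epsilon(\alpha)=0$ if $D(\alpha)\le D(\alpha_{\max})$ or if the expression in braces is negative. Data-driven choice. $\widehat\alpha=\widehat\alpha(Y)$ is a (measurable) minimizer $$\widehat\alpha(Y)=\arg\min_{\alpha\in\mathcal{A}}\biggl\{\widehat\sigma^2_\alpha(Y)\biggl[1+\frac{V_\epsilon(\alpha)}{n}\biggr]\biggr\},$$ and the minima over $\mathcal{A}$ here and below are assumed to be attained. Loss. For an estimator $\widetilde\sigma^2(Y)$, $\Delta(\widetilde\sigma^2)=n\bigl|\widetilde\sigma^2(Y)-\|\sigma\xi\|^2/n\bigr|$; thus $\Delta(\widehat\sigma^2_{\widehat\alpha})=n\bigl|\widehat\sigma^2_{\widehat\alpha(Y)}(Y)-\|\sigma\xi\|^2/n\bigr|$. Risk quantities.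 $$R_\epsilon(\alpha,\beta)=\biggl[1+\frac{V_\epsilon(\alpha)}{n}\biggr]\biggl\{[1+q_\alpha(n)]\sum_{i=1}^n\bigl[1-H_\alpha(\lambda_i)\bigr]^2\lambda_i\bar\beta_i^2+\sigma^2V_\epsilon(\alpha)\biggr\},$$ $$r_{\mathcal{A},\epsilon}(\beta)=\min_{\alpha\in\mathcal{A}}R_\epsilon(\alpha,\beta),\qquad \rho_{\mathcal{A},\epsilon}(\beta)=\frac{\sigma^2\sqrt{D(\alpha_{\max})}}{r_{\mathcal{A},\epsilon}(\beta)}$$ (with $\rho_{\mathcal{A},\epsilon}(\beta)=+\infty$ if $r_{\mathcal{A},\epsilon}(\beta)=0$). *)

theory Defs
  imports "HOL-Probability.Probability" "Jordan_Normal_Form.Gauss_Jordan_Elimination"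
    "Jordan_Normal_Form.Char_Poly"
begin

text \<open>Since the dimensions vary with the sample size, vectors and matrices are those of
  Jordan_Normal_Form, indexed from 0: the paper's k-th eigenvalue, k = 1, ..., p, is
  \<open>lam (k - 1)\<close> here.  The constants \<open>vec\<close>, \<open>mat\<close> are qualified because HOL-Analysis has
  constants of the same name.\<close>

definition sqnorm :: "real vec \<Rightarrow> real" where
  "sqnorm v = scalar_prod v v"

definition gram :: "real mat \<Rightarrow> real mat" where
  "gram X = transpose_mat X * X"

text \<open>The eigenvalue sequence is padded with zeros beyond the dimension of the matrix.\<close>

definition pos_eigensystem :: "real mat \<Rightarrow> (nat \<Rightarrow> real) \<Rightarrow> (nat \<Rightarrow> real vec) \<Rightarrow> bool" where
  "pos_eigensystem A lam e \<longleftrightarrow>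
     (\<forall>k<dim_row A. eigenvector A (e k) (lam k) \<and> lam k > 0) \<and>
     (\<forall>j<dim_row A. \<forall>k<dim_row A. scalar_prod (e j) (e k) = (if j = k then 1 else 0)) \<and>
     (\<forall>j k. j \<le> k \<longrightarrow> k < dim_row A \<longrightarrow> lam k \<le> lam j) \<and>
     (\<forall>k\<ge>dim_row A. lam k = 0)"

definition beta_bar :: "real vec \<Rightarrow> (nat \<Rightarrow> real vec) \<Rightarrow> nat \<Rightarrow> real" where
  "beta_bar \<beta> e k = (if k < dim_vec \<beta> then scalar_prod \<beta> (e k) else 0)"

text \<open>\<open>H \<alpha> x\<close> is only meaningful for \<open>\<alpha> > 0\<close> and \<open>x \<ge> 0\<close>.\<close>

definition ordered_family :: "(real \<Rightarrow> real \<Rightarrow> real) \<Rightarrow> bool" where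
  "ordered_family H \<longleftrightarrow>
     (\<forall>\<alpha>>0. \<forall>x\<ge>0. 0 \<le> H \<alpha> x \<and> H \<alpha> x \<le> 1) \<and>
     (\<forall>\<alpha>>0. H \<alpha> 0 = 0) \<and>
     (\<forall>\<alpha>>0. \<forall>\<alpha>'>0. (\<forall>x\<ge>0. H \<alpha> x \<le> H \<alpha>' x) \<or> (\<forall>x\<ge>0. H \<alpha>' x \<le> H \<alpha> x))"

text \<open>The entries of the sum of \<open>H \<alpha> (lam k)\<close> times the outer product of \<open>e k\<close> with itself.\<close>

definition H_mat ::
  "(real \<Rightarrow> real \<Rightarrow> real) \<Rightarrow> nat \<Rightarrow> (nat \<Rightarrow> real) \<Rightarrow> (nat \<Rightarrow> real vec) \<Rightarrow> real \<Rightarrow> real mat" where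
  "H_mat H p lam e \<alpha> =
     Matrix.mat p p (\<lambda>(i, j). \<Sum>k<p. H \<alpha> (lam k) * vec_index (e k) i * vec_index (e k) j)"

definition beta_hat ::
  "(real \<Rightarrow> real \<Rightarrow> real) \<Rightarrow> real mat \<Rightarrow> (nat \<Rightarrow> real) \<Rightarrow> (nat \<Rightarrow> real vec) \<Rightarrow> real \<Rightarrow> real vec \<Rightarrow> real vec"
  where
  "beta_hat H X lam e \<alpha> Y =
     H_mat H (dim_col X) lam e \<alpha> *\<^sub>v
       (the (mat_inverse (gram X)) *\<^sub>v (transpose_mat X *\<^sub>v Y))"

definition G :: "(real \<Rightarrow> real \<Rightarrow> real) \<Rightarrow> real \<Rightarrow> real \<Rightarrow> real" where
  "G H \<alpha> x = 2 * H \<alpha> x - (H \<alpha> x)\<^sup>2"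

definition mean_G ::
  "(real \<Rightarrow> real \<Rightarrow> real) \<Rightarrow> nat \<Rightarrow> nat \<Rightarrow> (nat \<Rightarrow> real) \<Rightarrow> real \<Rightarrow> real" where
  "mean_G H n p lam \<alpha> = (1 / real n) * (\<Sum>i<p. G H \<alpha> (lam i))"

definition q_corr ::
  "(real \<Rightarrow> real \<Rightarrow> real) \<Rightarrow> nat \<Rightarrow> nat \<Rightarrow> (nat \<Rightarrow> real) \<Rightarrow> real \<Rightarrow> real" where
  "q_corr H n p lam \<alpha> = inverse (1 - mean_G H n p lam \<alpha>) - 1"

definition D :: "(real \<Rightarrow> real \<Rightarrow> real) \<Rightarrow> nat \<Rightarrow> (nat \<Rightarrow> real) \<Rightarrow> real \<Rightarrow> real" where
  "D H n lam \<alpha> = (\<Sum>k<n. (G H \<alpha> (lam k))\<^sup>2)"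

definition sigma2_hat ::
  "(real \<Rightarrow> real \<Rightarrow> real) \<Rightarrow> real mat \<Rightarrow> (nat \<Rightarrow> real) \<Rightarrow> (nat \<Rightarrow> real vec) \<Rightarrow> real \<Rightarrow> real vec \<Rightarrow> real"
  where
  "sigma2_hat H X lam e \<alpha> Y =
     (1 + q_corr H (dim_row X) (dim_col X) lam \<alpha>) / real (dim_row X)
       * sqnorm (Y - X *\<^sub>v beta_hat H X lam e \<alpha> Y)"

definition Q_const :: real where
  "Q_const = 4 / (sqrt 2 - 1)\<^sup>2"

definition penalty_braces :: "real \<Rightarrow> real \<Rightarrow> real" where
  "penalty_braces \<epsilon> t = ln t + 2 * (1 + \<epsilon>) * ln (Q_const / \<epsilon>\<^sup>2 * ln t)"

definition penalty ::
  "(real \<Rightarrow> real \<Rightarrow> real) \<Rightarrow> real \<Rightarrow> nat \<Rightarrow> (nat \<Rightarrow> real) \<Rightarrow> real \<Rightarrow> real \<Rightarrow> real" where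
  "penalty H \<epsilon> n lam \<alpha>max \<alpha> =
     (let d = D H n lam \<alpha>; d0 = D H n lam \<alpha>max; b = penalty_braces \<epsilon> (d / d0) in
      if d \<le> d0 \<or> b < 0 then 0 else (1 + \<epsilon>) * sqrt (2 * d) * sqrt b)"

definition criterion ::
  "(real \<Rightarrow> real \<Rightarrow> real) \<Rightarrow> real \<Rightarrow> real mat \<Rightarrow> (nat \<Rightarrow> real) \<Rightarrow> (nat \<Rightarrow> real vec) \<Rightarrow> real
    \<Rightarrow> real vec \<Rightarrow> real \<Rightarrow> real" where
  "criterion H \<epsilon> X lam e \<alpha>max Y \<alpha> =
     sigma2_hat H X lam e \<alpha> Y * (1 + penalty H \<epsilon> (dim_row X) lam \<alpha>max \<alpha> / real (dim_row X))"

definition risk ::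
  "(real \<Rightarrow> real \<Rightarrow> real) \<Rightarrow> real \<Rightarrow> nat \<Rightarrow> nat \<Rightarrow> (nat \<Rightarrow> real) \<Rightarrow> (nat \<Rightarrow> real vec) \<Rightarrow> real
    \<Rightarrow> real \<Rightarrow> real vec \<Rightarrow> real \<Rightarrow> real" where
  "risk H \<epsilon> n p lam e \<alpha>max \<sigma> \<beta> \<alpha> =
     (1 + penalty H \<epsilon> n lam \<alpha>max \<alpha> / real n)
       * ((1 + q_corr H n p lam \<alpha>) * (\<Sum>i<n. (1 - H \<alpha> (lam i))\<^sup>2 * lam i * (beta_bar \<beta> e i)\<^sup>2)
          + \<sigma>\<^sup>2 * penalty H \<epsilon> n lam \<alpha>max \<alpha>)"

text \<open>The infimum is assumed to be a minimum wherever this is used.\<close>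

definition oracle_risk ::
  "(real \<Rightarrow> real \<Rightarrow> real) \<Rightarrow> real \<Rightarrow> nat \<Rightarrow> nat \<Rightarrow> (nat \<Rightarrow> real) \<Rightarrow> (nat \<Rightarrow> real vec) \<Rightarrow> real
    \<Rightarrow> real \<Rightarrow> real \<Rightarrow> real vec \<Rightarrow> real" where
  "oracle_risk H \<epsilon> n p lam e \<alpha>min \<alpha>max \<sigma> \<beta> =
     (INF \<alpha>\<in>{\<alpha>min..\<alpha>max}. risk H \<epsilon> n p lam e \<alpha>max \<sigma> \<beta> \<alpha>)"

text \<open>Extended-real valued, because division by zero in \<^typ>\<open>real\<close> would give 0 rather than
  infinity.\<close>

definition rho ::
  "(real \<Rightarrow> real \<Rightarrow> real) \<Rightarrow> real \<Rightarrow> nat \<Rightarrow> nat \<Rightarrow> (nat \<Rightarrow> real) \<Rightarrow> (nat \<Rightarrow> real vec) \<Rightarrow> real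
    \<Rightarrow> real \<Rightarrow> real \<Rightarrow> real vec \<Rightarrow> ereal" where
  "rho H \<epsilon> n p lam e \<alpha>min \<alpha>max \<sigma> \<beta> =
     (let r = oracle_risk H \<epsilon> n p lam e \<alpha>min \<alpha>max \<sigma> \<beta> in
      if r = 0 then \<infinity> else ereal (\<sigma>\<^sup>2 * sqrt (D H n lam \<alpha>max) / r))"

text \<open>The law of the noise vector: independent standard normal coordinates 0, ..., n - 1.  All random
  quantities are functions of the noise, so they are taken on this canonical probability space; thus
  no choice of a sample space can influence an absolute constant.\<close>

definition noise_law :: "nat \<Rightarrow> (nat \<Rightarrow> real) measure" where
  "noise_law n = Pi\<^sub>M {..<n} (\<lambda>_. density lborel std_normal_density)"

definition observation :: "real mat \<Rightarrow> real vec \<Rightarrow> real \<Rightarrow> real vec \<Rightarrow> real vec" where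
  "observation X \<beta> \<sigma> \<xi> = X *\<^sub>v \<beta> + \<sigma> \<cdot>\<^sub>v \<xi>"

definition loss ::
  "real mat \<Rightarrow> real vec \<Rightarrow> real \<Rightarrow> (real vec \<Rightarrow> real) \<Rightarrow> real vec \<Rightarrow> real" where
  "loss X \<beta> \<sigma> est \<xi> =
     real (dim_row X) * \<bar>est (observation X \<beta> \<sigma> \<xi>) - sqnorm (\<sigma> \<cdot>\<^sub>v \<xi>) / real (dim_row X)\<bar>"

text \<open>The expectation of the (nonnegative) loss, as an integral with values in [0, infinity]: a finite
  upper bound for it includes integrability.\<close>

definition expected_loss :: "real mat \<Rightarrow> real vec \<Rightarrow> real \<Rightarrow> (real vec \<Rightarrow> real) \<Rightarrow> ennreal" where
  "expected_loss X \<beta> \<sigma> est =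
     (\<integral>\<^sup>+ x. ennreal (loss X \<beta> \<sigma> est (Matrix.vec (dim_row X) x)) \<partial>noise_law (dim_row X))"

text \<open>Measurability of a real function on n-dimensional space, the Borel sets being those of the
  product of n real lines.\<close>

definition borel_on_vec :: "nat \<Rightarrow> (real vec \<Rightarrow> real) \<Rightarrow> bool" where
  "borel_on_vec n f \<longleftrightarrow> (\<lambda>x. f (Matrix.vec n x)) \<in> borel_measurable (Pi\<^sub>M {..<n} (\<lambda>_. borel))"

definition measurable_minimizer ::
  "(real \<Rightarrow> real \<Rightarrow> real) \<Rightarrow> real \<Rightarrow> real mat \<Rightarrow> (nat \<Rightarrow> real) \<Rightarrow> (nat \<Rightarrow> real vec) \<Rightarrow> real \<Rightarrow> real
    \<Rightarrow> (real vec \<Rightarrow> real) \<Rightarrow> bool" where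
  "measurable_minimizer H \<epsilon> X lam e \<alpha>min \<alpha>max ahat \<longleftrightarrow>
     borel_on_vec (dim_row X) ahat \<and>
     (\<forall>Y\<in>carrier_vec (dim_row X).
        is_arg_min (criterion H \<epsilon> X lam e \<alpha>max Y) (\<lambda>\<alpha>. \<alpha> \<in> {\<alpha>min..\<alpha>max}) (ahat Y))"

end

theory Submission
  imports Defs
begin

text \<open>Why the theorem holds.  Let \<open>u k = X e k / sqrt (lam k)\<close> be the left singular vectors,
  \<open>z k\<close> the coordinate of the noise along \<open>u k\<close>, \<open>b k\<close> that of \<open>X \<beta>\<close>, and \<open>w \<alpha> k\<close> the
  value of \<open>G\<close> at \<open>lam k\<close>.  In these coordinates the error of the variance estimator is
  \<open>n \<sigma>2hat \<alpha> - ||\<sigma> \<xi>||^2 = (1 + q \<alpha>) (lin \<alpha> - \<sigma>^2 Z \<alpha>)\<close>, with a linear part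
  \<open>lin \<alpha> = \<Sum> (1 - w \<alpha> k) (b k ^ 2 + 2 \<sigma> b k z k)\<close> and a centred quadratic form
  \<open>Z \<alpha> = \<Sum> (w \<alpha> k - mean) z k ^ 2\<close>, the sum here running over all n directions.

  Write \<open>T \<alpha>\<close> for this error and \<open>V\<close> for the penalty.  Minimality of the criterion, compared with
  the oracle parameter, bounds \<open>T (1 + V / n) + \<sigma>^2 V ||\<xi>||^2 / n\<close> at the selected parameter by a random
  variable \<open>W\<close> that depends on the oracle parameter alone, and the expectation of \<open>W\<close> is at most the oracle risk
  \<open>r\<close>.  This controls positive errors.  For negative errors one needs a lower bound that is uniform in
  \<open>\<alpha>\<close>: \<open>- T \<alpha> \<le> c \<sigma>^2 V \<alpha> + St\<close> with a factor \<open>c < 1\<close> and a remainder \<open>St\<close> of small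
  expectation.  Inserting it into the first bound gives \<open>|T| \<le> c / (1 - c) (W + ...) + St / (1 - c)\<close>;
  taking \<open>c\<close> slightly below \<open>1 / (1 + \<gamma>)\<close> makes the first factor at most \<open>1 / \<gamma>\<close>, and
  whatever tends to zero with n is paid for by the small difference.

  The heart is therefore the expectation of the supremum over \<open>\<alpha>\<close> of \<open>Z \<alpha> - c V \<alpha>\<close>.  Since
  \<open>V\<close> carries a factor \<open>1 + \<epsilon>\<close> and \<open>c > (1 + \<epsilon>) / (1 + 2 \<epsilon>)\<close>, what is subtracted is
  \<open>(1 + gain)\<close> times the level \<open>sqrt (2 D)\<close> times the root of the braces, where \<open>gain\<close> is of the order of
  \<open>\<epsilon>^2 + \<delta>\<close> and \<open>\<delta> = \<epsilon> - \<gamma> - \<gamma> \<epsilon>\<close>.  The weights form a chain, so \<open>Z\<close> has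
  increments of variance at most \<open>2 |D \<alpha> - D \<alpha>'|\<close>, like a Brownian motion run with the clock
  \<open>D\<close>, and lemma \<open>chaining_bound\<close> bounds its exponential moment over a block of values of \<open>D\<close>
  with the constant of a single Gaussian variable.  Values of \<open>D\<close> up to the order of
  \<open>D \<alpha>max / \<epsilon>^2\<close> need no penalty at all, because their standard deviation is already within the
  tolerated remainder.  Beyond, the level \<open>D = D \<alpha>max exp j\<close> is cut into the order of \<open>j^2\<close>
  blocks, each of which contributes at most the order of \<open>\<epsilon>^2 / j exp (- gain j)\<close> times
  \<open>sqrt (D \<alpha>max)\<close>; the sum over j is at most the order of \<open>\<epsilon>^2 / gain^2\<close>, that is of
  \<open>1 / \<delta>\<close> (lemma \<open>quadratic_process_sup_bound\<close>).  The linear part drifts downwards at the speed of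
  its own variance, so its supremum has an expectation of the order of \<open>\<sigma>^2\<close> (lemma
  \<open>linear_process_sup_bound\<close>).  All together the expected loss is at most
  \<open>r / \<gamma> (1 + C \<rho> / \<delta>)\<close>, which is below the asserted bound.\<close>

section \<open>Exponential moments of Gaussian quadratic forms\<close>

lemma std_normal_nn_integral_exp_quadratic:
  fixes v s :: real
  assumes s: "s > - (1/2)"
  shows "(\<integral>\<^sup>+x. ennreal (exp (v * x - s * x\<^sup>2)) \<partial>std_normal_distribution)
    = ennreal (exp (v\<^sup>2 / (2 * (1 + 2 * s))) / sqrt (1 + 2 * s))"
proof -
  define t where "t = 1 + 2 * s"
  have t: "t > 0" using s by (simp add: t_def)
  have eq: "std_normal_density x * exp (v * x - s * x\<^sup>2)
      = exp (v\<^sup>2 / (2 * t)) / sqrt t * normal_density (v / t) (1 / sqrt t) x" for x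
  proof -
    have e: "- x\<^sup>2 / 2 + (v * x - s * x\<^sup>2) = v\<^sup>2 / (2 * t) + - (x - v / t)\<^sup>2 / (2 * (1 / sqrt t)\<^sup>2)"
    proof -
      have s': "s = (t - 1) / 2" by (simp add: t_def)
      have "(sqrt t)\<^sup>2 = t" using t by simp
      then have "2 * (1 / sqrt t)\<^sup>2 = 2 / t" by (simp add: power_divide)
      then show ?thesis unfolding s' using t by (simp add: field_simps power2_eq_square)
    qed
    have q: "sqrt (2 * pi * (1 / sqrt t)\<^sup>2) = sqrt (2 * pi) / sqrt t"
      using t by (simp add: real_sqrt_mult power_divide real_sqrt_divide)
    have "std_normal_density x * exp (v * x - s * x\<^sup>2)
        = 1 / sqrt (2 * pi) * exp (- x\<^sup>2 / 2 + (v * x - s * x\<^sup>2))"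
      by (simp add: std_normal_density_def flip: exp_add)
    also have "\<dots> = 1 / sqrt (2 * pi) * (exp (v\<^sup>2 / (2 * t)) * exp (- (x - v / t)\<^sup>2 / (2 * (1 / sqrt t)\<^sup>2)))"
      unfolding e by (simp only: exp_add)
    also have "\<dots> = exp (v\<^sup>2 / (2 * t)) / sqrt t * normal_density (v / t) (1 / sqrt t) x"
      unfolding normal_density_def q using t by simp
    finally show ?thesis .
  qed
  interpret N: prob_space "density lborel (normal_density (v / t) (1 / sqrt t))"
    using t by (intro prob_space_normal_density) simp
  have one: "(\<integral>\<^sup>+x. ennreal (normal_density (v / t) (1 / sqrt t) x) \<partial>lborel) = 1"
    using N.emeasure_space_1 by (simp add: emeasure_density)
  have "(\<integral>\<^sup>+x. ennreal (exp (v * x - s * x\<^sup>2)) \<partial>std_normal_distribution)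
      = (\<integral>\<^sup>+x. ennreal (std_normal_density x) * ennreal (exp (v * x - s * x\<^sup>2)) \<partial>lborel)"
    by (subst nn_integral_density) auto
  also have "\<dots> = (\<integral>\<^sup>+x. ennreal (exp (v\<^sup>2 / (2 * t)) / sqrt t) * ennreal (normal_density (v / t) (1 / sqrt t) x) \<partial>lborel)"
    by (intro nn_integral_cong) (use t in \<open>simp add: eq flip: ennreal_mult\<close>)
  also have "\<dots> = ennreal (exp (v\<^sup>2 / (2 * t)) / sqrt t)"
    by (subst nn_integral_cmult) (auto simp: one)
  finally show ?thesis by (simp add: t_def)
qed

lemma prob_space_noise_law: "prob_space (noise_law n)"
  unfolding noise_law_def by (intro prob_space_PiM prob_space_normal_density) simp

lemma sets_noise_law [measurable_cong]: "sets (noise_law n) = sets (Pi\<^sub>M {..<n} (\<lambda>_. borel))"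
  unfolding noise_law_def by (intro sets_PiM_cong) auto

lemma noise_law_nn_integral_prod:
  assumes "\<And>i. i < n \<Longrightarrow> f i \<in> borel_measurable borel"
  shows "(\<integral>\<^sup>+x. (\<Prod>i<n. f i (x i)) \<partial>noise_law n)
    = (\<Prod>i<n. \<integral>\<^sup>+y. f i y \<partial>std_normal_distribution)"
proof -
  interpret N: prob_space std_normal_distribution
    by (intro prob_space_normal_density) simp
  interpret product_sigma_finite "\<lambda>_::nat. std_normal_distribution"
    by standard
  show ?thesis unfolding noise_law_def
    by (intro product_nn_integral_prod) (use assms in auto)
qed

lemma noise_law_nn_integral_exp_quadratic:
  assumes s: "s > - (1/2)"
  shows "(\<integral>\<^sup>+x. ennreal (exp ((\<Sum>i<n. v i * x i) - s * (\<Sum>i<n. (x i)\<^sup>2))) \<partial>noise_law n)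
    = ennreal (exp ((\<Sum>i<n. (v i)\<^sup>2) / (2 * (1 + 2 * s))) / sqrt (1 + 2 * s) ^ n)"
proof -
  have "(\<integral>\<^sup>+x. ennreal (exp ((\<Sum>i<n. v i * x i) - s * (\<Sum>i<n. (x i)\<^sup>2))) \<partial>noise_law n)
     = (\<integral>\<^sup>+x. (\<Prod>i<n. ennreal (exp (v i * x i - s * (x i)\<^sup>2))) \<partial>noise_law n)"
    by (simp add: prod_ennreal flip: exp_sum) (simp add: sum_subtractf sum_distrib_left)
  also have "\<dots> = (\<Prod>i<n. ennreal (exp ((v i)\<^sup>2 / (2 * (1 + 2 * s))) / sqrt (1 + 2 * s)))"
    by (subst noise_law_nn_integral_prod) (auto simp: std_normal_nn_integral_exp_quadratic[OF s])
  also have "\<dots> = ennreal (\<Prod>i<n. exp ((v i)\<^sup>2 / (2 * (1 + 2 * s))) / sqrt (1 + 2 * s))"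
    using s by (intro prod_ennreal) auto
  also have "(\<Prod>i<n. exp ((v i)\<^sup>2 / (2 * (1 + 2 * s))) / sqrt (1 + 2 * s))
     = exp ((\<Sum>i<n. (v i)\<^sup>2) / (2 * (1 + 2 * s))) / sqrt (1 + 2 * s) ^ n"
    by (simp add: prod_dividef exp_sum sum_divide_distrib)
  finally show ?thesis .
qed

definition coord :: "nat \<Rightarrow> (nat \<Rightarrow> nat \<Rightarrow> real) \<Rightarrow> nat \<Rightarrow> (nat \<Rightarrow> real) \<Rightarrow> real" where
  "coord n u k x = (\<Sum>i<n. u k i * x i)"

text \<open>The vectors \<open>u 0, ..., u (p - 1)\<close> need not span n-dimensional space.  What lies in the orthogonal
  complement enters only through the squared norm, so no completion to a basis is needed.\<close>

definition orthonormal :: "nat \<Rightarrow> nat \<Rightarrow> (nat \<Rightarrow> nat \<Rightarrow> real) \<Rightarrow> bool" where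
  "orthonormal n p u \<longleftrightarrow> (\<forall>j<p. \<forall>k<p. (\<Sum>i<n. u j i * u k i) = (if j = k then 1 else 0))"

lemma measurable_coord [measurable]: "coord n u k \<in> borel_measurable (noise_law n)"
  unfolding coord_def by measurable

lemma orthonormal_sum_squares:
  assumes "orthonormal n p u"
  shows "(\<Sum>i<n. (\<Sum>k<p. w k * u k i)\<^sup>2) = (\<Sum>k<p. (w k)\<^sup>2)"
proof -
  have "(\<Sum>i<n. (\<Sum>k<p. w k * u k i)\<^sup>2) = (\<Sum>i<n. \<Sum>j<p. \<Sum>k<p. w j * w k * (u j i * u k i))"
    by (simp add: power2_eq_square sum_product mult_ac)
  also have "\<dots> = (\<Sum>j<p. \<Sum>i<n. \<Sum>k<p. w j * w k * (u j i * u k i))"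
    by (rule sum.swap)
  also have "\<dots> = (\<Sum>j<p. \<Sum>k<p. \<Sum>i<n. w j * w k * (u j i * u k i))"
    by (rule sum.cong[OF refl], rule sum.swap)
  also have "\<dots> = (\<Sum>j<p. \<Sum>k<p. w j * w k * (\<Sum>i<n. u j i * u k i))"
    by (simp add: sum_distrib_left)
  also have "\<dots> = (\<Sum>j<p. \<Sum>k<p. w j * w k * (if j = k then 1 else 0))"
    using assms by (intro sum.cong refl) (auto simp: orthonormal_def)
  also have "\<dots> = (\<Sum>k<p. (w k)\<^sup>2)"
    by (simp add: if_distrib power2_eq_square cong: if_cong)
  finally show ?thesis .
qed

lemma sum_coord_swap:
  "(\<Sum>k<p. w k * coord n u k x) = (\<Sum>i<n. (\<Sum>k<p. w k * u k i) * x i)"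
  unfolding coord_def sum_distrib_left sum_distrib_right
  by (subst sum.swap) (simp add: mult_ac)

lemma nn_integral_exp_linear:
  assumes "orthonormal n p u"
  shows "(\<integral>\<^sup>+x. ennreal (exp (\<Sum>k<p. w k * coord n u k x)) \<partial>noise_law n)
    = ennreal (exp ((\<Sum>k<p. (w k)\<^sup>2) / 2))"
  using noise_law_nn_integral_exp_quadratic[of 0 n "\<lambda>i. \<Sum>k<p. w k * u k i"]
  by (simp add: sum_coord_swap orthonormal_sum_squares[OF assms])

text \<open>The law of the coordinates \<open>coord n u k\<close> is never determined, so no rotation invariance is used.
  Instead each factor \<open>exp (a z^2)\<close> is written as the average of \<open>exp (sqrt (2 a) h z)\<close> over an
  auxiliary standard normal \<open>h\<close>.  For fixed \<open>h\<close> the exponent is linear in the noise, its Gaussian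
  average involves only \<open>\<Sum> a k (h k)^2\<close> by orthonormality, and that is again a product.  The trick
  requires \<open>a k \<ge> 0\<close>; negative multiples of the identity are absorbed by \<open>s\<close>.\<close>

lemma nn_integral_exp_quadratic_form:
  assumes u: "orthonormal n p u" and s: "s \<ge> 0"
    and a: "\<And>k. k < p \<Longrightarrow> 0 \<le> a k \<and> 2 * a k < 1 + 2 * s"
  shows "(\<integral>\<^sup>+x. ennreal (exp ((\<Sum>k<p. a k * (coord n u k x)\<^sup>2) - s * (\<Sum>i<n. (x i)\<^sup>2))) \<partial>noise_law n)
    = ennreal ((\<Prod>k<p. 1 / sqrt (1 - 2 * a k / (1 + 2 * s))) / sqrt (1 + 2 * s) ^ n)"
proof -
  interpret P: prob_space "noise_law p" by (rule prob_space_noise_law)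
  interpret N: prob_space "noise_law n" by (rule prob_space_noise_law)
  interpret PN: pair_sigma_finite "noise_law p" "noise_law n" ..
  let ?E = "\<lambda>h x. exp ((\<Sum>k<p. sqrt (2 * a k) * h k * coord n u k x) - s * (\<Sum>i<n. (x i)\<^sup>2))"
  have a0: "(sqrt (2 * a k))\<^sup>2 = 2 * a k" if "k < p" for k using a[OF that] by simp
  have 1: "ennreal (exp ((\<Sum>k<p. a k * (coord n u k x)\<^sup>2) - s * (\<Sum>i<n. (x i)\<^sup>2)))
     = (\<integral>\<^sup>+h. ennreal (?E h x) \<partial>noise_law p)" for x
  proof -
    have "(\<integral>\<^sup>+h. ennreal (?E h x) \<partial>noise_law p)
      = (\<integral>\<^sup>+h. ennreal (exp (- s * (\<Sum>i<n. (x i)\<^sup>2))) *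
            ennreal (exp ((\<Sum>k<p. (sqrt (2 * a k) * coord n u k x) * h k) - 0 * (\<Sum>k<p. (h k)\<^sup>2))) \<partial>noise_law p)"
      by (intro nn_integral_cong) (simp add: mult_ac flip: ennreal_mult exp_add)
    also have "\<dots> = ennreal (exp (- s * (\<Sum>i<n. (x i)\<^sup>2))) *
        ennreal (exp ((\<Sum>k<p. (sqrt (2 * a k) * coord n u k x)\<^sup>2) / (2 * (1 + 2 * 0))) / sqrt (1 + 2 * 0) ^ p)"
      by (subst nn_integral_cmult, measurable, subst noise_law_nn_integral_exp_quadratic) auto
    also have "(\<Sum>k<p. (sqrt (2 * a k) * coord n u k x)\<^sup>2) = 2 * (\<Sum>k<p. a k * (coord n u k x)\<^sup>2)"
      unfolding sum_distrib_left
      by (intro sum.cong refl) (simp add: power_mult_distrib a0)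
    finally show ?thesis by (simp flip: ennreal_mult exp_add)
  qed
  have 2: "(\<integral>\<^sup>+x. ennreal (?E h x) \<partial>noise_law n)
     = ennreal (1 / sqrt (1 + 2 * s) ^ n) *
       ennreal (\<Prod>k<p. exp (a k / (1 + 2 * s) * (h k)\<^sup>2))" for h
  proof -
    have "(\<integral>\<^sup>+x. ennreal (?E h x) \<partial>noise_law n)
      = ennreal (exp ((\<Sum>k<p. (sqrt (2 * a k) * h k)\<^sup>2) / (2 * (1 + 2 * s))) / sqrt (1 + 2 * s) ^ n)"
      by (subst sum_coord_swap, subst noise_law_nn_integral_exp_quadratic)
         (use s in \<open>auto simp: orthonormal_sum_squares[OF u]\<close>)
    also have "(\<Sum>k<p. (sqrt (2 * a k) * h k)\<^sup>2) / (2 * (1 + 2 * s)) = (\<Sum>k<p. a k / (1 + 2 * s) * (h k)\<^sup>2)"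
      unfolding sum_divide_distrib
    proof (rule sum.cong[OF refl])
      fix k assume "k \<in> {..<p}"
      then have "(sqrt (2 * a k) * h k)\<^sup>2 = 2 * a k * (h k)\<^sup>2"
        using a0[of k] by (simp only: power_mult_distrib lessThan_iff)
      then show "(sqrt (2 * a k) * h k)\<^sup>2 / (2 * (1 + 2 * s)) = a k / (1 + 2 * s) * (h k)\<^sup>2"
        using s by (simp only: mult.assoc mult_divide_mult_cancel_left_if) simp
    qed
    finally show ?thesis using s by (simp add: exp_sum prod_nonneg flip: ennreal_mult)
  qed
  have 3: "(\<integral>\<^sup>+y. ennreal (exp (a k / (1 + 2 * s) * y\<^sup>2)) \<partial>std_normal_distribution)
     = ennreal (1 / sqrt (1 - 2 * a k / (1 + 2 * s)))" if "k < p" for k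
  proof -
    have "a k / (1 + 2 * s) < 1/2" using a[OF that] s by (simp add: field_simps)
    then show ?thesis
      using std_normal_nn_integral_exp_quadratic[of "- a k / (1 + 2 * s)" 0] by simp
  qed
  have "(\<integral>\<^sup>+x. ennreal (exp ((\<Sum>k<p. a k * (coord n u k x)\<^sup>2) - s * (\<Sum>i<n. (x i)\<^sup>2))) \<partial>noise_law n)
     = (\<integral>\<^sup>+x. \<integral>\<^sup>+h. ennreal (?E h x) \<partial>noise_law p \<partial>noise_law n)"
    by (simp add: 1)
  also have "\<dots> = (\<integral>\<^sup>+h. \<integral>\<^sup>+x. ennreal (?E h x) \<partial>noise_law n \<partial>noise_law p)"
    by (rule PN.Fubini') (unfold coord_def, measurable)
  also have "\<dots> = ennreal (1 / sqrt (1 + 2 * s) ^ n) *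
       (\<integral>\<^sup>+h. (\<Prod>k<p. ennreal (exp (a k / (1 + 2 * s) * (h k)\<^sup>2))) \<partial>noise_law p)"
    unfolding 2 by (subst nn_integral_cmult) (measurable, simp add: prod_ennreal)
  also have "(\<integral>\<^sup>+h. (\<Prod>k<p. ennreal (exp (a k / (1 + 2 * s) * (h k)\<^sup>2))) \<partial>noise_law p)
     = (\<Prod>k<p. ennreal (1 / sqrt (1 - 2 * a k / (1 + 2 * s))))"
    using 3 by (subst noise_law_nn_integral_prod) (auto intro!: prod.cong simp del: times_divide_eq_left)
  also have "\<dots> = ennreal (\<Prod>k<p. 1 / sqrt (1 - 2 * a k / (1 + 2 * s)))"
    using a s by (intro prod_ennreal) (auto simp: field_simps less_imp_le)
  also have "ennreal (1 / sqrt (1 + 2 * s) ^ n) * \<dots>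
     = ennreal ((\<Prod>k<p. 1 / sqrt (1 - 2 * a k / (1 + 2 * s))) / sqrt (1 + 2 * s) ^ n)"
  proof -
    have "(\<Prod>k<p. 1 / sqrt (1 - 2 * a k / (1 + 2 * s))) \<ge> 0"
      using a s by (intro prod_nonneg) (auto simp: field_simps less_imp_le)
    then show ?thesis using s by (simp flip: ennreal_mult)
  qed
  finally show ?thesis .
qed

text \<open>The leading coefficient 1 of \<open>y^2\<close> is what produces the variance \<open>2 D\<close> of the quadratic form with its
  exact constant; the cubic correction is harmless because it is used for small \<open>y\<close> only.\<close>

lemma inverse_sqrt_le_exp:
  fixes y m :: real
  assumes "\<bar>y\<bar> \<le> m" "m \<le> 1/4"
  shows "1 / sqrt (1 - 2 * y) \<le> exp (y + (1 + 4 * m) * y\<^sup>2)"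
proof -
  define f where "f = (\<lambda>y::real. ln (1 - 2 * y) + 2 * y + 2 * y\<^sup>2)"
  have D: "((\<lambda>y. f y) has_real_derivative (- 8 * y\<^sup>2 / (1 - 2 * y))) (at y)" if "y < 1/2" for y
  proof -
    have "(f has_real_derivative (- 2 / (1 - 2 * y) + 2 + 4 * y)) (at y)"
      unfolding f_def using that
      by (auto intro!: derivative_eq_intros)
    moreover have "- 2 / (1 - 2 * y) + 2 + 4 * y = - 8 * y\<^sup>2 / (1 - 2 * y)"
      using that by (simp add: divide_simps) (simp add: algebra_simps power2_eq_square)
    ultimately show ?thesis by simp
  qed
  have key: "ln (1 - 2 * y) + 2 * y + 2 * (1 + 4 * m) * y\<^sup>2 \<ge> 0"
  proof (cases "y \<le> 0")
    case True
    have "f y \<ge> f 0"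
    proof (rule DERIV_nonpos_imp_nonincreasing[OF True])
      fix x :: real assume "y \<le> x" "x \<le> 0"
      then show "\<exists>d. (f has_real_derivative d) (at x) \<and> d \<le> 0"
        by (intro exI[of _ "- 8 * x\<^sup>2 / (1 - 2 * x)"] conjI D) (auto simp: divide_nonpos_pos)
    qed
    then have "0 \<le> ln (1 - 2 * y) + 2 * y + 2 * y\<^sup>2" by (simp add: f_def)
    also have "\<dots> \<le> ln (1 - 2 * y) + 2 * y + 2 * (1 + 4 * m) * y\<^sup>2"
      using assms by (simp add: algebra_simps)
    finally show ?thesis .
  next
    case False
    define g where "g = (\<lambda>y. f y + 8 * y^3)"
    have "g 0 \<le> g y"
    proof (rule DERIV_nonneg_imp_nondecreasing[where f=g and a=0 and b=y])
      show "0 \<le> y" using False by simp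
      fix x :: real assume x: "0 \<le> x" "x \<le> y"
      then have x4: "x \<le> 1/4" using assms by auto
      have "(g has_real_derivative (- 8 * x\<^sup>2 / (1 - 2 * x) + 24 * x\<^sup>2)) (at x)"
        unfolding g_def using x4 by (auto intro!: derivative_eq_intros D)
      moreover have "8 * x\<^sup>2 / (1 - 2 * x) \<le> 8 * x\<^sup>2 / (1/2)"
        using x4 by (intro divide_left_mono) auto
      then have "8 * x\<^sup>2 / (1 - 2 * x) \<le> 16 * x\<^sup>2" by simp
      then have "- (8 * x\<^sup>2 / (1 - 2 * x)) + 24 * x\<^sup>2 \<ge> 0"
        using zero_le_power2[of x] by linarith
      then have "- 8 * x\<^sup>2 / (1 - 2 * x) + 24 * x\<^sup>2 \<ge> 0" by simp
      ultimately show "\<exists>d. (g has_real_derivative d) (at x) \<and> 0 \<le> d" by blast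
    qed
    then have "0 \<le> ln (1 - 2 * y) + 2 * y + 2 * y\<^sup>2 + 8 * y * y\<^sup>2"
      by (simp add: g_def f_def power3_eq_cube power2_eq_square)
    also have "8 * y * y\<^sup>2 \<le> 8 * m * y\<^sup>2" using assms by (intro mult_right_mono) auto
    finally show ?thesis by (simp add: algebra_simps)
  qed
  have pos: "1 - 2 * y > 0" using assms by auto
  have "1 / sqrt (1 - 2 * y) = exp (- ln (1 - 2 * y) / 2)"
    using pos by (simp add: exp_minus ln_sqrt[symmetric] inverse_eq_divide)
  also have "\<dots> \<le> exp (y + (1 + 4 * m) * y\<^sup>2)" using key by (simp add: algebra_simps)
  finally show ?thesis .
qed

text \<open>The quadratic form with coefficients \<open>c k - mean\<close>, where the n - p directions orthogonal to the
  \<open>u k\<close> have \<open>c = 0\<close>.  The coefficients sum to zero, so it is centred.\<close>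

definition centred_form :: "nat \<Rightarrow> nat \<Rightarrow> (nat \<Rightarrow> nat \<Rightarrow> real) \<Rightarrow> (nat \<Rightarrow> real) \<Rightarrow> (nat \<Rightarrow> real) \<Rightarrow> real" where
  "centred_form n p u c x
    = (\<Sum>k<p. c k * (coord n u k x)\<^sup>2) - (\<Sum>k<p. c k) / real n * (\<Sum>i<n. (x i)\<^sup>2)"

lemma measurable_centred_form [measurable]: "centred_form n p u c \<in> borel_measurable (noise_law n)"
  unfolding centred_form_def by measurable

text \<open>Centring the coefficients can only decrease their sum of squares, and the linear terms of the
  logarithm cancel.  The restriction to nonnegative \<open>c\<close> is the reason why chaining below only ever uses
  increments in the upward direction.\<close>

lemma nn_integral_exp_centred_form:
  assumes u: "orthonormal n p u" and pn: "p \<le> n"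
    and c: "\<And>k. k < p \<Longrightarrow> 0 \<le> c k \<and> c k \<le> m" and lm: "0 \<le> l" "l * m \<le> 1/4" and m: "0 \<le> m"
  shows "(\<integral>\<^sup>+x. ennreal (exp (l * centred_form n p u c x)) \<partial>noise_law n)
    \<le> ennreal (exp (l\<^sup>2 * (1 + 4 * (l * m)) * (\<Sum>k<p. (c k)\<^sup>2)))"
proof (cases "n = 0")
  case True
  then show ?thesis using pn prob_space.emeasure_space_1[OF prob_space_noise_law, of 0]
    by (simp add: centred_form_def)
next
  case False
  define s where "s = l * (\<Sum>k<p. c k) / real n"
  define a where "a k = l * c k" for k
  define y where "y k = (if k < p then a k else 0) - s" for k
  have "(\<Sum>k<p. c k) \<ge> 0" using c by (intro sum_nonneg) auto
  then have s: "s \<ge> 0" using lm by (simp add: s_def)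
  have "(\<Sum>k<p. c k) \<le> (\<Sum>k<p. m)" by (intro sum_mono) (use c in auto)
  also have "\<dots> \<le> real n * m" using pn m by (simp add: mult_right_mono)
  finally have "(\<Sum>k<p. c k) / real n \<le> m" using False by (simp add: field_simps)
  then have sm: "s \<le> l * m" unfolding s_def using lm by (simp add: mult_left_mono flip: times_divide_eq_right)
  have a: "0 \<le> a k" "a k \<le> l * m" if "k < p" for k
    using c[OF that] lm by (auto simp: a_def mult_left_mono)
  have lm0: "0 \<le> l * m" using lm m by simp
  have y: "\<bar>y k\<bar> \<le> l * m" for k
    using a[of k] s sm lm0 by (auto simp: y_def)
  have "(\<integral>\<^sup>+x. ennreal (exp (l * centred_form n p u c x)) \<partial>noise_law n)
    = (\<integral>\<^sup>+x. ennreal (exp ((\<Sum>k<p. a k * (coord n u k x)\<^sup>2) - s * (\<Sum>i<n. (x i)\<^sup>2))) \<partial>noise_law n)"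
    by (simp add: centred_form_def a_def s_def right_diff_distrib mult.assoc flip: sum_distrib_left)
  also have "\<dots> = ennreal ((\<Prod>k<p. 1 / sqrt (1 - 2 * a k / (1 + 2 * s))) / sqrt (1 + 2 * s) ^ n)"
  proof (rule nn_integral_exp_quadratic_form[OF u s])
    fix k assume "k < p" from a[OF this] show "0 \<le> a k \<and> 2 * a k < 1 + 2 * s"
      using lm s by auto
  qed
  also have "(\<Prod>k<p. 1 / sqrt (1 - 2 * a k / (1 + 2 * s))) / sqrt (1 + 2 * s) ^ n
      = (\<Prod>k<n. 1 / sqrt (1 - 2 * y k))"
  proof -
    have "(\<Prod>k<n. 1 / sqrt (1 - 2 * y k)) = (\<Prod>k<p. 1 / sqrt (1 - 2 * y k)) * (\<Prod>k\<in>{p..<n}. 1 / sqrt (1 - 2 * y k))"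
      using pn prod.union_disjoint[of "{..<p}" "{p..<n}" "\<lambda>k. 1 / sqrt (1 - 2 * y k)"]
      by (simp add: ivl_disj_un(8) ivl_disj_int)
    also have "(\<Prod>k\<in>{p..<n}. 1 / sqrt (1 - 2 * y k)) = (1 / sqrt (1 + 2 * s)) ^ (n - p)"
      by (simp add: y_def)
    also have "(\<Prod>k<p. 1 / sqrt (1 - 2 * y k)) = (\<Prod>k<p. 1 / sqrt (1 - 2 * a k / (1 + 2 * s)) * (1 / sqrt (1 + 2 * s)))"
    proof (rule prod.cong[OF refl])
      fix k assume "k \<in> {..<p}"
      moreover have "1 - 2 * (a k - s) = (1 - 2 * a k / (1 + 2 * s)) * (1 + 2 * s)"
        using s by (simp add: field_simps)
      ultimately show "1 / sqrt (1 - 2 * y k) = 1 / sqrt (1 - 2 * a k / (1 + 2 * s)) * (1 / sqrt (1 + 2 * s))"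
        by (simp add: y_def real_sqrt_mult)
    qed
    also have "\<dots> = (\<Prod>k<p. 1 / sqrt (1 - 2 * a k / (1 + 2 * s))) * (1 / sqrt (1 + 2 * s)) ^ p"
      by (subst prod.distrib) simp
    finally have "(\<Prod>k<n. 1 / sqrt (1 - 2 * y k)) =
        (\<Prod>k<p. 1 / sqrt (1 - 2 * a k / (1 + 2 * s))) * ((1 / sqrt (1 + 2 * s)) ^ p * (1 / sqrt (1 + 2 * s)) ^ (n - p))"
      by simp
    then show ?thesis using pn by (simp add: power_one_over flip: power_add)
  qed
  also have "\<dots> \<le> (\<Prod>k<n. exp (y k + (1 + 4 * (l * m)) * (y k)\<^sup>2))"
  proof (intro prod_mono conjI)
    fix k
    show "1 / sqrt (1 - 2 * y k) \<le> exp (y k + (1 + 4 * (l * m)) * (y k)\<^sup>2)"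
      by (rule inverse_sqrt_le_exp) (use y lm in auto)
    show "0 \<le> 1 / sqrt (1 - 2 * y k)" using y[of k] lm by (auto intro!: divide_nonneg_nonneg)
  qed
  also have "\<dots> = exp ((\<Sum>k<n. y k) + (1 + 4 * (l * m)) * (\<Sum>k<n. (y k)\<^sup>2))"
    by (simp add: exp_sum[symmetric] sum.distrib sum_distrib_left)
  also have "\<dots> \<le> exp (l\<^sup>2 * (1 + 4 * (l * m)) * (\<Sum>k<p. (c k)\<^sup>2))"
  proof -
    have split: "(\<Sum>k<n. if k < p then f k else 0) = sum f {..<p}" for f :: "nat \<Rightarrow> real"
      using pn by (subst sum.mono_neutral_cong_right[of "{..<n}" "{..<p}" _ f]) auto
    have sa: "(\<Sum>k<p. a k) = real n * s" using False by (simp add: s_def a_def flip: sum_distrib_left)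
    have 1: "(\<Sum>k<n. y k) = 0"
      by (simp add: y_def sum_subtractf split sa)
    have "(\<Sum>k<n. (y k)\<^sup>2) = (\<Sum>k<n. (if k < p then (a k)\<^sup>2 - 2 * s * a k else 0) + s\<^sup>2)"
      by (intro sum.cong refl) (auto simp: y_def power2_diff)
    also have "\<dots> = (\<Sum>k<p. (a k)\<^sup>2) - real n * s\<^sup>2"
      by (simp add: sum.distrib split sum_subtractf sa flip: sum_distrib_left) (simp add: power2_eq_square)
    also have "\<dots> \<le> (\<Sum>k<p. (a k)\<^sup>2)" by simp
    finally have "(\<Sum>k<n. (y k)\<^sup>2) \<le> l\<^sup>2 * (\<Sum>k<p. (c k)\<^sup>2)"
      by (simp add: a_def power_mult_distrib sum_distrib_left)
    then have "(1 + 4 * (l * m)) * (\<Sum>k<n. (y k)\<^sup>2) \<le> (1 + 4 * (l * m)) * (l\<^sup>2 * (\<Sum>k<p. (c k)\<^sup>2))"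
      using lm0 by (intro mult_left_mono) auto
    then show ?thesis unfolding 1 by (simp add: mult_ac)
  qed
  finally show ?thesis by (simp add: ennreal_leI)
qed

section \<open>A chaining inequality with sharp leading constant\<close>

text \<open>Convexity replaces the generalised Hoelder inequality: it suffices to bound each exponential moment
  separately, and they may all be as large as the largest of them.\<close>

lemma exp_convex_combination_le:
  fixes w X :: "nat \<Rightarrow> real"
  assumes w: "\<And>l. l \<in> S \<Longrightarrow> 0 \<le> w l" and S: "finite S" and s: "sum w S \<le> 1"
  shows "exp (\<Sum>l\<in>S. w l * X l) \<le> (\<Sum>l\<in>S. w l * exp (X l)) + 1"
proof -
  define I where "I = insert None (Some ` S)"
  define a where "a = (\<lambda>i. case i of None \<Rightarrow> 1 - sum w S | Some l \<Rightarrow> w l)"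
  define y where "y = (\<lambda>i. case i of None \<Rightarrow> 0 | Some l \<Rightarrow> X l)"
  have sumI: "(\<Sum>i\<in>I. f i) = f None + (\<Sum>l\<in>S. f (Some l))" for f :: "nat option \<Rightarrow> real"
    unfolding I_def using S by (subst sum.insert) (auto simp: sum.reindex)
  have "exp (\<Sum>i\<in>I. a i *\<^sub>R y i) \<le> (\<Sum>i\<in>I. a i * exp (y i))"
  proof (rule convex_on_sum)
    show "finite I" "I \<noteq> {}" using S by (auto simp: I_def)
    show "convex_on UNIV (exp :: real \<Rightarrow> real)" by (rule exp_convex)
    show "sum a I = 1" by (simp add: sumI a_def)
    show "0 \<le> a i" if "i \<in> I" for i using that w s by (auto simp: I_def a_def)
  qed auto
  also have "\<dots> = (1 - sum w S) + (\<Sum>l\<in>S. w l * exp (X l))" by (simp add: sumI a_def y_def)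
  also have "\<dots> \<le> 1 + (\<Sum>l\<in>S. w l * exp (X l))" using w by (simp add: sum_nonneg)
  finally show ?thesis by (simp add: sumI a_def y_def)
qed

lemma exp_4_ge_16: "exp 4 \<ge> (16::real)"
proof -
  have "(2::real) ^ 4 \<le> exp 1 ^ 4"
    using exp_ge_add_one_self[of 1] by (intro power_mono) auto
  also have "\<dots> = exp 4" by (simp flip: exp_of_nat_mult)
  finally show ?thesis by simp
qed

lemma integrable_and_integral_le:
  fixes f :: "'a \<Rightarrow> real"
  assumes "f \<in> borel_measurable M" "\<And>x. 0 \<le> f x" "(\<integral>\<^sup>+x. ennreal (f x) \<partial>M) \<le> ennreal A" "0 \<le> A"
  shows "integrable M f" "(\<integral>x. f x \<partial>M) \<le> A"
proof -
  show i: "integrable M f"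
    using assms by (intro integrableI_nonneg) (auto intro: le_less_trans simp: AE_I2)
  have "ennreal (\<integral>x. f x \<partial>M) \<le> ennreal A"
    using assms by (subst nn_integral_eq_integral[OF i, symmetric]) auto
  then show "(\<integral>x. f x \<partial>M) \<le> A" using assms(4) by simp
qed

text \<open>The supremum of the family \<open>F\<close> over \<open>I\<close> has positive part of expectation at most \<open>K\<close>.  An integrable
  majorant is asked for, rather than the supremum itself, because \<open>I\<close> may be uncountable.\<close>

definition majorised :: "'x measure \<Rightarrow> 'i set \<Rightarrow> ('i \<Rightarrow> 'x \<Rightarrow> real) \<Rightarrow> real \<Rightarrow> bool" where
  "majorised M I F K \<longleftrightarrow> (\<exists>\<Psi>. integrable M \<Psi> \<and> (\<forall>x\<in>space M. 0 \<le> \<Psi> x) \<and>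
     (\<integral>x. \<Psi> x \<partial>M) \<le> K \<and> (\<forall>a\<in>I. \<forall>x\<in>space M. F a x \<le> \<Psi> x))"

lemma majorised_mono:
  assumes "majorised M I F K" "J \<subseteq> I" "\<And>a x. a \<in> J \<Longrightarrow> x \<in> space M \<Longrightarrow> F' a x \<le> F a x" "K \<le> K'"
  shows "majorised M J F' K'"
  using assms unfolding majorised_def by (meson order_trans subsetD)

lemma majorised_UN:
  assumes S: "finite S" and m: "\<And>q. q \<in> S \<Longrightarrow> majorised M (I q) F (K q)"
  shows "majorised M (\<Union>q\<in>S. I q) F (\<Sum>q\<in>S. K q)"
proof -
  obtain \<Psi> where \<Psi>: "\<And>q. q \<in> S \<Longrightarrow> integrable M (\<Psi> q)" "\<And>q x. q \<in> S \<Longrightarrow> x \<in> space M \<Longrightarrow> 0 \<le> \<Psi> q x"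
      "\<And>q. q \<in> S \<Longrightarrow> (\<integral>x. \<Psi> q x \<partial>M) \<le> K q"
      "\<And>q a x. q \<in> S \<Longrightarrow> a \<in> I q \<Longrightarrow> x \<in> space M \<Longrightarrow> F a x \<le> \<Psi> q x"
    using m unfolding majorised_def by metis
  show ?thesis
    unfolding majorised_def
  proof (intro exI[of _ "\<lambda>x. \<Sum>q\<in>S. \<Psi> q x"] conjI ballI)
    show "integrable M (\<lambda>x. \<Sum>q\<in>S. \<Psi> q x)" using \<Psi>(1) by auto
    show "0 \<le> (\<Sum>q\<in>S. \<Psi> q x)" if "x \<in> space M" for x using \<Psi>(2) that by (intro sum_nonneg)
    show "(\<integral>x. (\<Sum>q\<in>S. \<Psi> q x) \<partial>M) \<le> (\<Sum>q\<in>S. K q)"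
      using \<Psi>(1,3) by (subst Bochner_Integration.integral_sum) (auto intro: sum_mono)
    fix a x assume "a \<in> (\<Union>q\<in>S. I q)" and x: "x \<in> space M"
    then obtain q where q: "q \<in> S" "a \<in> I q" by auto
    have "F a x \<le> \<Psi> q x" by (rule \<Psi>(4)[OF q x])
    also have "\<dots> \<le> (\<Sum>q\<in>S. \<Psi> q x)"
      using S q \<Psi>(2)[OF _ x] by (intro member_le_sum[of q S "\<lambda>q. \<Psi> q x"]) auto
    finally show "F a x \<le> (\<Sum>q\<in>S. \<Psi> q x)" .
  qed
qed

text \<open>Chaining for a process whose increments are controlled by a scalar clock \<open>d\<close>.  At level \<open>l\<close> the
  block is cut into \<open>16^l\<close> cells, and the link at that level gets the share \<open>\<tau> / 2^(l+1)\<close> of the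
  exponent, the starting point the share \<open>1 - \<tau>\<close>.  The union over the cells costs \<open>16^(l+1)\<close>, which is
  prepaid by subtracting \<open>4 (l + 1)\<close> inside the exponent; as the shares decay geometrically this
  changes the total by at most 8.  Hence the supremum has the exponential moment \<open>A\<close> of a single
  point, up to an absolute factor.  The majorant is a finite sum, which settles measurability over an
  uncountable index set; the remainder \<open>\<eta>\<close> accounts for stopping at a finite level.

  In a cell the point of smallest \<open>d\<close> is the representative, so that every link goes upwards.\<close>

lemma chaining_bound:
  fixes Z :: "'i \<Rightarrow> 'x \<Rightarrow> real" and d :: "'i \<Rightarrow> real" and R :: "'x \<Rightarrow> real"
  assumes M: "prob_space M"
    and meas: "\<And>a. a \<in> I \<Longrightarrow> Z a \<in> borel_measurable M"
    and h: "0 < h" and d: "\<And>a. a \<in> I \<Longrightarrow> lo \<le> d a \<and> d a < lo + h"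
    and tau: "0 < \<tau>" "\<tau> < 1" and mu: "0 < \<mu>" and A: "1 \<le> A"
    and top: "\<And>a. a \<in> I \<Longrightarrow> (\<integral>\<^sup>+x. ennreal (exp (\<mu> / (1 - \<tau>) * Z a x)) \<partial>M) \<le> ennreal A"
    and inc: "\<And>a b l. a \<in> I \<Longrightarrow> b \<in> I \<Longrightarrow> d b \<le> d a \<Longrightarrow> d a - d b \<le> h / 16 ^ l \<Longrightarrow>
        (\<integral>\<^sup>+x. ennreal (exp (\<mu> * 2 ^ Suc l / \<tau> * (Z a x - Z b x))) \<partial>M) \<le> ennreal A"
    and R: "integrable M R" "\<And>x. x \<in> space M \<Longrightarrow> 0 \<le> R x"
    and rem: "\<And>a b x. a \<in> I \<Longrightarrow> b \<in> I \<Longrightarrow> x \<in> space M \<Longrightarrow> \<bar>Z a x - Z b x\<bar> \<le> sqrt \<bar>d a - d b\<bar> * R x"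
    and eta: "0 < \<eta>"
  shows "majorised M I
      (\<lambda>a x. Z a x - c)
      (2 * exp 8 * A / \<mu> * exp (- \<mu> * c) + \<eta>)"
proof (cases "I = {}")
  case True
  then show ?thesis using eta A mu unfolding majorised_def
    by (intro exI[of _ "\<lambda>_. 0"]) (auto intro!: add_nonneg_nonneg mult_nonneg_nonneg divide_nonneg_pos)
next
  case False
  interpret prob_space M by fact
  have ER: "0 \<le> (\<integral>x. R x \<partial>M)" by (intro integral_nonneg_AE AE_I2) (use R in auto)
  obtain L where L: "(1/4)^L < \<eta> / (sqrt h * ((\<integral>x. R x \<partial>M) + 1))"
    using real_arch_pow_inv[of "\<eta> / (sqrt h * ((\<integral>x. R x \<partial>M) + 1))" "1/4"] eta h ER by auto
  have etaL: "sqrt (h / 16 ^ L) * (\<integral>x. R x \<partial>M) \<le> \<eta>"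
  proof -
    have "(16::real) ^ L = (4 ^ L)\<^sup>2" by (simp add: power2_eq_square flip: power_mult_distrib)
    then have "sqrt (16 ^ L) = 4 ^ L" by simp
    then have "sqrt (h / 16 ^ L) = sqrt h * (1/4)^L"
      by (simp add: real_sqrt_divide power_one_over)
    then have "sqrt (h / 16 ^ L) * (\<integral>x. R x \<partial>M) \<le> sqrt h * (1/4)^L * ((\<integral>x. R x \<partial>M) + 1)"
      using h by (simp add: mult_left_mono)
    also have "\<dots> \<le> \<eta>"
    proof -
      have "0 < sqrt h * ((\<integral>x. R x \<partial>M) + 1)" using h ER by simp
      from L[unfolded pos_less_divide_eq[OF this]] show ?thesis by (simp only: mult_ac less_imp_le)
    qed
    finally show ?thesis .
  qed
  define cell where "cell l a = nat \<lfloor>(d a - lo) / h * 16 ^ l\<rfloor>" for l :: nat and a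
  have cell_bounds: "real (cell l a) \<le> (d a - lo) / h * 16 ^ l" "(d a - lo) / h * 16 ^ l < real (cell l a) + 1"
    if "a \<in> I" for l a
  proof -
    have "0 \<le> (d a - lo) / h * 16 ^ l" using d[OF that] h by simp
    then have "real (cell l a) = of_int \<lfloor>(d a - lo) / h * 16 ^ l\<rfloor>" by (simp add: cell_def)
    then show "real (cell l a) \<le> (d a - lo) / h * 16 ^ l" "(d a - lo) / h * 16 ^ l < real (cell l a) + 1"
      by linarith+
  qed
  have cell_lt: "cell l a < 16 ^ l" if "a \<in> I" for l a
  proof -
    have "(d a - lo) / h < 1" using d[OF that] h by (simp add: field_simps)
    then have "(d a - lo) / h * 16 ^ l < 1 * 16 ^ l" by (intro mult_strict_right_mono) auto
    then have "real (cell l a) < 16 ^ l" using cell_bounds(1)[OF that, of l] by linarith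
    then show ?thesis by (metis of_nat_less_iff of_nat_numeral of_nat_power)
  qed
  have cell_Suc: "cell l a = cell (Suc l) a div 16" if "a \<in> I" for l a
  proof -
    have "\<lfloor>(d a - lo) / h * 16 ^ l\<rfloor> = \<lfloor>((d a - lo) / h * 16 ^ Suc l) / 16\<rfloor>" by simp
    also have "\<dots> = \<lfloor>(d a - lo) / h * 16 ^ Suc l\<rfloor> div 16"
      using floor_divide_real_eq_div[of 16 "(d a - lo) / h * 16 ^ Suc l"] by simp
    finally show ?thesis unfolding cell_def by (simp only: nat_div_distrib' nat_numeral)
  qed
  have cell_close: "\<bar>d a - d b\<bar> \<le> h / 16 ^ l" if "a \<in> I" "b \<in> I" "cell l a = cell l b" for l a b
  proof -
    have "\<bar>(d a - lo) / h * 16 ^ l - (d b - lo) / h * 16 ^ l\<bar> \<le> 1"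
      using cell_bounds[OF that(1), of l] cell_bounds[OF that(2), of l] that(3) by linarith
    moreover have "(d a - lo) / h * 16 ^ l - (d b - lo) / h * 16 ^ l = (d a - d b) * (16 ^ l / h)"
      using h by (simp add: field_simps)
    ultimately have "\<bar>d a - d b\<bar> * (16 ^ l / h) \<le> 1" using h by (simp add: abs_mult)
    then show ?thesis using h by (simp add: field_simps)
  qed
  \<comment> \<open>Points in one cell of level \<open>L\<close> differ by a negligible amount, so one point per cell suffices.\<close>
  define pick where "pick i = (SOME a. a \<in> I \<and> cell L a = i)" for i
  have pick: "pick (cell L a) \<in> I" "cell L (pick (cell L a)) = cell L a" if "a \<in> I" for a
    using someI[of "\<lambda>b. b \<in> I \<and> cell L b = cell L a" a] that by (auto simp: pick_def)
  define F where "F = (\<lambda>a. pick (cell L a)) ` I"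
  have FI: "F \<subseteq> I" using pick by (auto simp: F_def)
  have "finite (cell L ` I)" by (rule finite_subset[of _ "{..<16^L}"]) (use cell_lt in auto)
  moreover have "F = pick ` (cell L ` I)" by (auto simp: F_def)
  ultimately have finF: "finite F" by simp
  have F0: "F \<noteq> {}" using False by (simp add: F_def)
  define G where "G l i = {a \<in> F. cell l a = i}" for l i
  define rep where "rep l i = (ARG_MIN d a. a \<in> G l i)" for l i
  have finG: "finite (G l i)" for l i using finF by (simp add: G_def)
  have rep: "rep l (cell l a) \<in> G l (cell l a)" "\<And>b. b \<in> G l (cell l a) \<Longrightarrow> d (rep l (cell l a)) \<le> d b"
    if "a \<in> F" for l a
  proof -
    have "G l (cell l a) \<noteq> {}" using that by (auto simp: G_def)
    from arg_min_if_finite[OF finG this, of d] arg_min_least[OF finG this, of _ d]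
    show "rep l (cell l a) \<in> G l (cell l a)" "\<And>b. b \<in> G l (cell l a) \<Longrightarrow> d (rep l (cell l a)) \<le> d b"
      unfolding rep_def arg_min_on_def by auto
  qed
  define r where "r l a = rep l (cell l a)" for l a
  have rF: "r l a \<in> F" "cell l (r l a) = cell l a" if "a \<in> F" for l a
    using rep(1)[OF that] by (auto simp: G_def r_def)
  have rI: "r l a \<in> I" if "a \<in> F" for l a using rF(1)[OF that] FI by auto
  have cells_up: "cell l a = cell l b" if "cell (Suc l) a = cell (Suc l) b" "a \<in> I" "b \<in> I" for l a b
    using that cell_Suc[of a l] cell_Suc[of b l] by simp
  have r_mono: "d (r l a) \<le> d (r (Suc l) a)" if "a \<in> F" for l a
  proof -
    have "cell l (r (Suc l) a) = cell l a"
      using rF[OF that, of "Suc l"] that FI cells_up[of l "r (Suc l) a" a] by blast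
    then have "r (Suc l) a \<in> G l (cell l a)" using rF(1)[OF that, of "Suc l"] by (simp add: G_def)
    then show ?thesis using rep(2)[OF that] by (simp add: r_def)
  qed
  have r_close: "d (r (Suc l) a) - d (r l a) \<le> h / 16 ^ l" if "a \<in> F" for l a
  proof -
    have "cell l (r (Suc l) a) = cell l (r l a)"
      using rF[OF that, of "Suc l"] rF[OF that, of l] that FI
        cells_up[of l "r (Suc l) a" a] by (metis subsetD)
    from cell_close[OF rI[OF that] rI[OF that] this] show ?thesis by linarith
  qed
  \<comment> \<open>The possible links from level \<open>l\<close> to \<open>l + 1\<close>: one for each occupied cell of the finer level.\<close>
  define C where "C l = (\<lambda>i. (rep (Suc l) i, rep l (i div 16))) ` cell (Suc l) ` F" for l
  have C_card: "finite (C l)" "real (card (C l)) \<le> 16 ^ Suc l" for l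
  proof -
    have sub: "cell (Suc l) ` F \<subseteq> {..<16 ^ Suc l}" using cell_lt[of _ "Suc l"] FI by (auto simp del: power_Suc)
    then have fin: "finite (cell (Suc l) ` F)" by (rule finite_subset) simp
    then show "finite (C l)" by (simp add: C_def)
    have "card (C l) \<le> card (cell (Suc l) ` F)" unfolding C_def by (rule card_image_le[OF fin])
    also have "\<dots> \<le> card {..<16 ^ Suc l :: nat}" by (rule card_mono[OF _ sub]) simp
    finally have "card (C l) \<le> 16 ^ Suc l" by simp
    then have "real (card (C l)) \<le> real (16 ^ Suc l)" by (simp only: of_nat_le_iff)
    then show "real (card (C l)) \<le> 16 ^ Suc l" by simp
  qed
  have C_mem: "(r (Suc l) a, r l a) \<in> C l" if "a \<in> F" for l a
    using that FI cell_Suc[of a l] by (auto simp: C_def r_def intro!: image_eqI[of _ _ "cell (Suc l) a"])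
  have C_inc: "a \<in> I \<and> b \<in> I \<and> d b \<le> d a \<and> d a - d b \<le> h / 16 ^ l" if ab: "(a, b) \<in> C l" for a b l
  proof -
    obtain f where f: "f \<in> F" "a = r (Suc l) f" "b = rep l (cell (Suc l) f div 16)"
      using ab by (auto simp: C_def r_def)
    then have "b = r l f" using FI cell_Suc[of f l] by (auto simp: r_def)
    then show ?thesis using f rI r_mono r_close by auto
  qed
  define w where "w l = \<tau> * (1/2) ^ Suc l" for l :: nat
  define Y where "Y l q x = \<mu> * 2 ^ Suc l / \<tau> * (Z (fst q) x - Z (snd q) x)" for l :: nat and q x
  define a0 where "a0 = (SOME a. a \<in> F)"
  have a0: "a0 \<in> F" using F0 by (auto simp: a0_def intro: someI)
  define top0 where "top0 = r 0 a0"
  have r0: "r 0 a = top0" if "a \<in> F" for a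
  proof -
    have "cell 0 a = 0" "cell 0 a0 = 0" using cell_lt[of a 0] cell_lt[of a0 0] that a0 FI by auto
    then show ?thesis by (simp add: r_def top0_def)
  qed
  have top0I: "top0 \<in> I" using rI[OF a0] by (simp add: top0_def)
  define \<Phi> where "\<Phi> x = exp 8 * ((1 - \<tau>) * exp (\<mu> / (1 - \<tau>) * Z top0 x)
      + (\<Sum>l<L. w l * (\<Sum>q\<in>C l. exp (Y l q x - 4 * real (Suc l)))) + 1)" for x
  have w0: "0 \<le> w l" for l using tau by (simp add: w_def)
  have geo: "(\<Sum>l<L. w l) \<le> \<tau>"
  proof -
    have "(\<Sum>l<L. w l) = \<tau> * (1 - (1/2)^L)" unfolding w_def
      by (induction L) (auto simp: field_simps)
    moreover have "\<tau> * (1 - (1/2)^L) \<le> \<tau> * 1" using tau by (intro mult_left_mono) auto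
    ultimately show ?thesis by simp
  qed
  have \<Phi>_ge: "exp (\<mu> * Z a x) \<le> \<Phi> x" if a: "a \<in> F" and x: "x \<in> space M" for a x
  proof -
    have rL: "r L a = a"
    proof -
      have fix_pick: "b = pick (cell L b)" if "b \<in> F" for b using that pick by (auto simp: F_def)
      show ?thesis using fix_pick[OF a] fix_pick[OF rF(1)[OF a]] rF(2)[OF a] by metis
    qed
    define q where "q l = (r (Suc l) a, r l a)" for l
    define X where "X l = (if l = 0 then \<mu> / (1 - \<tau>) * Z top0 x else Y (l - 1) (q (l - 1)) x - 4 * real l)" for l
    define W where "W l = (if l = 0 then 1 - \<tau> else w (l - 1))" for l
    have ageo: "(\<Sum>l<L. w l * (4 * real (Suc l))) \<le> 8"
    proof -
      have "(\<Sum>l<L. w l * (4 * real (Suc l))) = \<tau> * (8 - 4 * (real L + 2) * (1/2)^L)" unfolding w_def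
        by (induction L) (auto simp: field_simps)
      also have "\<dots> \<le> \<tau> * 8" using tau by (intro mult_left_mono) auto
      finally show ?thesis using tau by simp
    qed
    have wY: "w l * Y l (q l) x = \<mu> * (Z (r (Suc l) a) x - Z (r l a) x)" for l
      using tau by (simp add: w_def Y_def q_def power_one_over)
    have "(\<Sum>l<L. Z (r (Suc l) a) x - Z (r l a) x) = Z a x - Z top0 x"
      using sum_lessThan_telescope[of "\<lambda>l. Z (r l a) x" L] by (simp add: rL r0[OF a])
    then have tel: "\<mu> * Z a x = \<mu> * Z top0 x + (\<Sum>l<L. w l * Y l (q l) x)"
      by (simp only: wY sum_distrib_left[symmetric]) (simp add: right_diff_distrib)
    have "(\<Sum>l<Suc L. W l * X l) = \<mu> * Z top0 x + (\<Sum>l<L. w l * (Y l (q l) x - 4 * real (Suc l)))"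
      using tau by (subst sum.lessThan_Suc_shift) (simp add: W_def X_def)
    also have "\<dots> = \<mu> * Z a x - (\<Sum>l<L. w l * (4 * real (Suc l)))"
      unfolding tel by (simp only: right_diff_distrib sum_subtractf)
    finally have "\<mu> * Z a x \<le> (\<Sum>l<Suc L. W l * X l) + 8" using ageo by linarith
    then have "exp (\<mu> * Z a x) \<le> exp 8 * exp (\<Sum>l<Suc L. W l * X l)"
      by (simp flip: exp_add)
    also have "exp (\<Sum>l<Suc L. W l * X l) \<le> (\<Sum>l<Suc L. W l * exp (X l)) + 1"
    proof (rule exp_convex_combination_le)
      have "sum W {..<Suc L} = 1 - \<tau> + (\<Sum>l<L. w l)"
        by (subst sum.lessThan_Suc_shift) (simp add: W_def)
      then show "sum W {..<Suc L} \<le> 1" using geo by linarith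
    qed (use tau w0 in \<open>auto simp: W_def\<close>)
    also have "(\<Sum>l<Suc L. W l * exp (X l)) = (1 - \<tau>) * exp (\<mu> / (1 - \<tau>) * Z top0 x)
      + (\<Sum>l<L. w l * exp (Y l (q l) x - 4 * real (Suc l)))"
      by (subst sum.lessThan_Suc_shift) (simp add: W_def X_def)
    also have "(\<Sum>l<L. w l * exp (Y l (q l) x - 4 * real (Suc l)))
      \<le> (\<Sum>l<L. w l * (\<Sum>q\<in>C l. exp (Y l q x - 4 * real (Suc l))))"
    proof (intro sum_mono mult_left_mono w0)
      fix l
      show "exp (Y l (q l) x - 4 * real (Suc l)) \<le> (\<Sum>q\<in>C l. exp (Y l q x - 4 * real (Suc l)))"
        using C_mem[OF a, of l] C_card(1)[of l]
        by (intro member_le_sum[of "q l" "C l" "\<lambda>q. exp (Y l q x - 4 * real (Suc l))"]) (auto simp: q_def)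
    qed
    finally show ?thesis unfolding \<Phi>_def by simp
  qed
  have \<Phi>_int: "integrable M \<Phi> \<and> (\<integral>x. \<Phi> x \<partial>M) \<le> 2 * exp 8 * A"
  proof -
    have top_int: "integrable M (\<lambda>x. exp (\<mu> / (1 - \<tau>) * Z top0 x))"
      "(\<integral>x. exp (\<mu> / (1 - \<tau>) * Z top0 x) \<partial>M) \<le> A"
      using top[OF top0I] meas[OF top0I] A by (auto intro!: integrable_and_integral_le)
    have Y_int: "integrable M (\<lambda>x. exp (Y l q x - 4 * real (Suc l)))"
      "(\<integral>x. exp (Y l q x - 4 * real (Suc l)) \<partial>M) \<le> A * exp (- 4 * real (Suc l))"
      if q: "q \<in> C l" for l q
    proof -
      have q': "fst q \<in> I \<and> snd q \<in> I \<and> d (snd q) \<le> d (fst q) \<and> d (fst q) - d (snd q) \<le> h / 16 ^ l"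
        using C_inc[of "fst q" "snd q" l] q by simp
      have m: "(\<lambda>x. exp (Y l q x)) \<in> borel_measurable M"
      proof -
        have [measurable]: "Z (fst q) \<in> borel_measurable M" "Z (snd q) \<in> borel_measurable M"
          using meas q' by auto
        show ?thesis unfolding Y_def by measurable
      qed
      have n: "(\<integral>\<^sup>+x. ennreal (exp (Y l q x)) \<partial>M) \<le> ennreal A"
        unfolding Y_def using inc q' by auto
      have i: "integrable M (\<lambda>x. exp (Y l q x))" "(\<integral>x. exp (Y l q x) \<partial>M) \<le> A"
        using m n A by (auto intro!: integrable_and_integral_le)
      have e: "(\<lambda>x. exp (Y l q x - 4 * real (Suc l))) = (\<lambda>x. exp (Y l q x) * exp (- 4 * real (Suc l)))"
        by (simp add: algebra_simps flip: exp_add)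
      show "integrable M (\<lambda>x. exp (Y l q x - 4 * real (Suc l)))" unfolding e using i(1) by simp
      show "(\<integral>x. exp (Y l q x - 4 * real (Suc l)) \<partial>M) \<le> A * exp (- 4 * real (Suc l))"
        unfolding e using i by simp
    qed
    have i: "integrable M \<Phi>" unfolding \<Phi>_def using top_int Y_int
      by (intro integrable_mult_right Bochner_Integration.integrable_add Bochner_Integration.integrable_sum) auto
    have iS: "integrable M (\<lambda>x. \<Sum>l<L. w l * (\<Sum>q\<in>C l. exp (Y l q x - 4 * real (Suc l))))"
      using Y_int by (intro Bochner_Integration.integrable_sum integrable_mult_right) auto
    have S_eq: "(\<integral>x. (\<Sum>l<L. w l * (\<Sum>q\<in>C l. exp (Y l q x - 4 * real (Suc l)))) \<partial>M)
       = (\<Sum>l<L. w l * (\<Sum>q\<in>C l. (\<integral>x. exp (Y l q x - 4 * real (Suc l)) \<partial>M)))"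
      using Y_int by (subst Bochner_Integration.integral_sum)
        (auto intro!: sum.cong Bochner_Integration.integral_sum integrable_mult_right Bochner_Integration.integrable_sum)
    have S_le: "(\<Sum>q\<in>C l. (\<integral>x. exp (Y l q x - 4 * real (Suc l)) \<partial>M)) \<le> A" for l
    proof -
      have "(\<Sum>q\<in>C l. (\<integral>x. exp (Y l q x - 4 * real (Suc l)) \<partial>M)) \<le> (\<Sum>q\<in>C l. A * exp (- 4 * real (Suc l)))"
        by (intro sum_mono Y_int)
      also have "\<dots> = real (card (C l)) * (A * exp (- 4 * real (Suc l)))" by simp
      also have "\<dots> \<le> 16 ^ Suc l * (A * exp (- 4 * real (Suc l)))"
        using C_card(2)[of l] A by (intro mult_right_mono) auto
      also have "exp (- 4 * real (Suc l)) = (1 / exp 4) ^ Suc l"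
        using exp_of_nat_mult[of "Suc l" "- 4 :: real"] by (simp add: mult.commute exp_minus inverse_eq_divide)
      also have "16 ^ Suc l * (A * (1 / exp 4) ^ Suc l) = A * (16 / exp 4) ^ Suc l"
        by (simp only: power_divide power_one) simp
      also have "\<dots> \<le> A * 1" using exp_4_ge_16 A by (intro mult_left_mono power_le_one) auto
      finally show ?thesis by simp
    qed
    have "(\<integral>x. \<Phi> x \<partial>M) = exp 8 * ((1 - \<tau>) * (\<integral>x. exp (\<mu> / (1 - \<tau>) * Z top0 x) \<partial>M)
       + (\<Sum>l<L. w l * (\<Sum>q\<in>C l. (\<integral>x. exp (Y l q x - 4 * real (Suc l)) \<partial>M))) + 1)"
      unfolding \<Phi>_def S_eq[symmetric] using top_int iS by (simp add: prob_space)
    also have "\<dots> \<le> exp 8 * ((1 - \<tau>) * A + (\<Sum>l<L. w l * A) + 1)"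
      using top_int(2) S_le tau w0 by (intro mult_left_mono add_mono sum_mono) auto
    also have "(\<Sum>l<L. w l * A) \<le> \<tau> * A"
      using geo A by (simp add: mult_right_mono flip: sum_distrib_right)
    finally have "(\<integral>x. \<Phi> x \<partial>M) \<le> exp 8 * (A + 1)" by (simp add: algebra_simps)
    also have "\<dots> \<le> exp 8 * (2 * A)" using A by (intro mult_left_mono) auto
    finally show ?thesis using i by simp
  qed
  define \<Psi> where "\<Psi> x = \<Phi> x * exp (- \<mu> * c) / \<mu> + sqrt (h / 16 ^ L) * R x" for x
  have \<Phi>0: "0 \<le> \<Phi> x" for x unfolding \<Phi>_def w_def using tau
    by (intro mult_nonneg_nonneg add_nonneg_nonneg sum_nonneg) auto
  show ?thesis unfolding majorised_def
  proof (intro exI[of _ \<Psi>] conjI ballI)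
    show "integrable M \<Psi>" unfolding \<Psi>_def using \<Phi>_int R by auto
    show "0 \<le> \<Psi> x" if "x \<in> space M" for x
      unfolding \<Psi>_def using \<Phi>0 mu R(2)[OF that] h by (intro add_nonneg_nonneg) auto
    have "(\<integral>x. \<Psi> x \<partial>M) = (\<integral>x. \<Phi> x \<partial>M) * exp (- \<mu> * c) / \<mu> + sqrt (h / 16 ^ L) * (\<integral>x. R x \<partial>M)"
      unfolding \<Psi>_def using \<Phi>_int R by (subst Bochner_Integration.integral_add) auto
    also have "\<dots> \<le> (2 * exp 8 * A) * exp (- \<mu> * c) / \<mu> + \<eta>"
      using \<Phi>_int etaL mu by (intro add_mono divide_right_mono mult_right_mono) auto
    finally show "(\<integral>x. \<Psi> x \<partial>M) \<le> 2 * exp 8 * A / \<mu> * exp (- \<mu> * c) + \<eta>" by simp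
  next
    fix a x assume a: "a \<in> I" and x: "x \<in> space M"
    define b where "b = pick (cell L a)"
    have b: "b \<in> F" "b \<in> I" "cell L b = cell L a" using a pick by (auto simp: b_def F_def)
    have "Z a x - Z b x \<le> sqrt \<bar>d a - d b\<bar> * R x" using rem[OF a b(2) x] by linarith
    also have "\<dots> \<le> sqrt (h / 16 ^ L) * R x"
      using cell_close[OF a b(2)] b(3) R(2)[OF x] by (intro mult_right_mono real_sqrt_le_mono) auto
    finally have 1: "Z a x \<le> Z b x + sqrt (h / 16 ^ L) * R x" by simp
    have "\<mu> * (Z b x - c) \<le> exp (\<mu> * (Z b x - c))"
      using exp_ge_add_one_self[of "\<mu> * (Z b x - c)"] by linarith
    also have "\<dots> = exp (\<mu> * Z b x) * exp (- \<mu> * c)" by (simp add: algebra_simps flip: exp_add)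
    also have "\<dots> \<le> \<Phi> x * exp (- \<mu> * c)" using \<Phi>_ge[OF b(1) x] by simp
    finally have "Z b x - c \<le> \<Phi> x * exp (- \<mu> * c) / \<mu>" using mu by (simp add: field_simps)
    then show "Z a x - c \<le> \<Psi> x" using 1 by (simp add: \<Psi>_def)
  qed
qed

section \<open>Moments of the noise and the linear process\<close>

lemma noise_law_integral_prod:
  fixes f :: "nat \<Rightarrow> real \<Rightarrow> real"
  assumes A: "A \<subseteq> {..<n}" and f: "\<And>i. i \<in> A \<Longrightarrow> integrable std_normal_distribution (f i)"
  shows "integrable (noise_law n) (\<lambda>x. \<Prod>i\<in>A. f i (x i))"
    "(\<integral>x. (\<Prod>i\<in>A. f i (x i)) \<partial>noise_law n) = (\<Prod>i\<in>A. \<integral>y. f i y \<partial>std_normal_distribution)"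
proof -
  interpret N: prob_space std_normal_distribution by (intro prob_space_normal_density) simp
  interpret product_sigma_finite "\<lambda>_::nat. std_normal_distribution" by standard
  define f' where "f' i = (if i \<in> A then f i else (\<lambda>_. 1))" for i
  have f': "integrable std_normal_distribution (f' i)" for i using f by (auto simp: f'_def)
  have P: "(\<Prod>i<n. F (f' i) i) = (\<Prod>i\<in>A. F (f i) i)" if "\<And>i. F (\<lambda>_. 1) i = 1" for F :: "(real \<Rightarrow> real) \<Rightarrow> nat \<Rightarrow> real"
    using A that by (intro prod.mono_neutral_cong_right) (auto simp: f'_def)
  have P1: "(\<Prod>i<n. f' i (x i)) = (\<Prod>i\<in>A. f i (x i))" for x by (rule P[of "\<lambda>g i. g (x i)"]) simp
  have P2: "(\<Prod>i<n. \<integral>y. f' i y \<partial>std_normal_distribution) = (\<Prod>i\<in>A. \<integral>y. f i y \<partial>std_normal_distribution)"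
    by (rule P[of "\<lambda>g i. \<integral>y. g y \<partial>std_normal_distribution"]) (use N.prob_space in simp)
  show "integrable (noise_law n) (\<lambda>x. \<Prod>i\<in>A. f i (x i))" unfolding noise_law_def P1[symmetric]
    by (rule product_integrable_prod) (use f' in auto)
  show "(\<integral>x. (\<Prod>i\<in>A. f i (x i)) \<partial>noise_law n) = (\<Prod>i\<in>A. \<integral>y. f i y \<partial>std_normal_distribution)"
    unfolding noise_law_def P1[symmetric] P2[symmetric] by (rule product_integral_prod) (use f' in auto)
qed

lemma std_normal_moments:
  "integrable std_normal_distribution (\<lambda>y::real. y)"
  "(\<integral>y. y \<partial>std_normal_distribution) = (0::real)"
  "integrable std_normal_distribution (\<lambda>y::real. y * y)"
  "(\<integral>y. y * y \<partial>std_normal_distribution) = (1::real)"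
proof -
  have 1: "has_bochner_integral lborel (\<lambda>x::real. std_normal_density x * x) 0"
    using std_normal_moment_odd[of 0] by simp
  have 2: "has_bochner_integral lborel (\<lambda>x::real. std_normal_density x * (x * x)) 1"
    using std_normal_moment_even[of 1] by (simp add: power2_eq_square fact_numeral)
  show "integrable std_normal_distribution (\<lambda>y::real. y)"
    "(\<integral>y. y \<partial>std_normal_distribution) = (0::real)"
    using 1 by (auto simp: integrable_density integral_density has_bochner_integral_iff)
  show "integrable std_normal_distribution (\<lambda>y::real. y * y)"
    "(\<integral>y. y * y \<partial>std_normal_distribution) = (1::real)"
    using 2 by (auto simp: integrable_density integral_density has_bochner_integral_iff)
qed

lemma noise_law_moments:
  assumes i: "i < n"
  shows "integrable (noise_law n) (\<lambda>x. x i)" "(\<integral>x. x i \<partial>noise_law n) = 0"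
    and "j < n \<Longrightarrow> integrable (noise_law n) (\<lambda>x. x i * x j)"
    and "j < n \<Longrightarrow> (\<integral>x. x i * x j \<partial>noise_law n) = (if i = j then 1 else 0)"
  using i noise_law_integral_prod[of "{i}" n "\<lambda>_ y. y"] noise_law_integral_prod[of "{i}" n "\<lambda>_ y. y * y"]
    noise_law_integral_prod[of "{i, j}" n "\<lambda>_ y. y"] std_normal_moments
  by (cases "i = j"; simp)+

lemma coord_moments:
  assumes u: "orthonormal n p u" and k: "k < p"
  shows "integrable (noise_law n) (coord n u k)" "(\<integral>x. coord n u k x \<partial>noise_law n) = 0"
    "integrable (noise_law n) (\<lambda>x. (coord n u k x)\<^sup>2)" "(\<integral>x. (coord n u k x)\<^sup>2 \<partial>noise_law n) = 1"
proof -
  show "integrable (noise_law n) (coord n u k)" unfolding coord_def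
    by (intro Bochner_Integration.integrable_sum integrable_mult_right noise_law_moments) auto
  show "(\<integral>x. coord n u k x \<partial>noise_law n) = 0" unfolding coord_def
    by (subst Bochner_Integration.integral_sum) (auto simp: noise_law_moments)
  have eq: "(coord n u k x)\<^sup>2 = (\<Sum>i<n. \<Sum>j<n. u k i * u k j * (x i * x j))" for x
    by (simp add: coord_def power2_eq_square sum_product mult_ac)
  show "integrable (noise_law n) (\<lambda>x. (coord n u k x)\<^sup>2)" unfolding eq
    by (intro Bochner_Integration.integrable_sum integrable_mult_right noise_law_moments) auto
  have "(\<integral>x. (coord n u k x)\<^sup>2 \<partial>noise_law n) = (\<Sum>i<n. \<Sum>j<n. u k i * u k j * (if i = j then 1 else 0))"
    unfolding eq
    by (subst Bochner_Integration.integral_sum) (auto simp: noise_law_moments intro!: sum.cong)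
  also have "\<dots> = (\<Sum>i<n. u k i * u k i)" by (simp add: if_distrib cong: if_cong)
  also have "\<dots> = 1" using u k by (simp add: orthonormal_def)
  finally show "(\<integral>x. (coord n u k x)\<^sup>2 \<partial>noise_law n) = 1" .
qed

lemma noise_law_sum_squares:
  "integrable (noise_law n) (\<lambda>x. \<Sum>i<n. (x i)\<^sup>2)" "(\<integral>x. (\<Sum>i<n. (x i)\<^sup>2) \<partial>noise_law n) = real n"
proof -
  show "integrable (noise_law n) (\<lambda>x. \<Sum>i<n. (x i)\<^sup>2)" unfolding power2_eq_square
    by (intro Bochner_Integration.integrable_sum noise_law_moments) auto
  show "(\<integral>x. (\<Sum>i<n. (x i)\<^sup>2) \<partial>noise_law n) = real n" unfolding power2_eq_square
    by (subst Bochner_Integration.integral_sum) (auto simp: noise_law_moments)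
qed

text \<open>Only the order n matters, so the variance is read off from the exponential moments at
  \<open>\<plusminus> 1 / (4 sqrt n)\<close>.\<close>

lemma noise_law_chi_square_deviation:
  assumes n: "n \<ge> 1"
  shows "integrable (noise_law n) (\<lambda>x. ((\<Sum>i<n. (x i)\<^sup>2) - real n)\<^sup>2)"
    "(\<integral>x. ((\<Sum>i<n. (x i)\<^sup>2) - real n)\<^sup>2 \<partial>noise_law n) \<le> 64 * exp 1 * real n"
proof -
  define l where "l = 1 / (4 * sqrt (real n))"
  have l: "0 < l" "l \<le> 1/4" "l\<^sup>2 = 1 / (16 * real n)"
    using n by (auto simp: l_def power_divide power_mult_distrib divide_simps)
  have E: "(\<integral>\<^sup>+x. ennreal (exp (t * ((\<Sum>i<n. (x i)\<^sup>2) - real n))) \<partial>noise_law n) \<le> ennreal (exp 1)"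
    if t: "\<bar>t\<bar> = l" for t
  proof -
    have t4: "\<bar>t\<bar> \<le> 1/4" using t l by simp
    have "(\<integral>\<^sup>+x. ennreal (exp (t * ((\<Sum>i<n. (x i)\<^sup>2) - real n))) \<partial>noise_law n)
      = (\<integral>\<^sup>+x. ennreal (exp (- t * real n)) * ennreal (exp ((\<Sum>i<n. 0 * x i) - (- t) * (\<Sum>i<n. (x i)\<^sup>2))) \<partial>noise_law n)"
      by (intro nn_integral_cong) (simp add: algebra_simps flip: ennreal_mult exp_add)
    also have "\<dots> = ennreal (exp (- t * real n)) * ennreal (1 / sqrt (1 - 2 * t) ^ n)"
      by (subst nn_integral_cmult, measurable, subst noise_law_nn_integral_exp_quadratic) (use t4 in auto)
    also have "\<dots> = ennreal ((exp (- t) * (1 / sqrt (1 - 2 * t))) ^ n)"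
    proof -
      have "exp (- t * real n) = exp (- t) ^ n" using exp_of_nat_mult[of n "-t"] by (simp add: mult.commute)
      then show ?thesis using t4
        by (subst ennreal_mult[symmetric]) (simp_all add: power_divide)
    qed
    also have "\<dots> \<le> ennreal ((exp (- t) * exp (t + (1 + 4 * (1/4)) * t\<^sup>2)) ^ n)"
    proof (intro ennreal_leI power_mono mult_left_mono)
      show "1 / sqrt (1 - 2 * t) \<le> exp (t + (1 + 4 * (1/4)) * t\<^sup>2)"
        by (rule inverse_sqrt_le_exp) (use t4 in auto)
    qed (use t4 in auto)
    also have "(exp (- t) * exp (t + (1 + 4 * (1/4)) * t\<^sup>2)) ^ n = exp (real n * (2 * t\<^sup>2))"
      by (simp add: exp_of_nat_mult flip: exp_add)
    also have "\<dots> \<le> exp 1"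
    proof -
      have "t\<^sup>2 = 1 / (16 * real n)" using t l(3) by (metis power2_abs)
      then show ?thesis using n by (simp add: field_simps)
    qed
    finally show ?thesis by (simp add: ennreal_leI)
  qed
  have m: "(\<lambda>x. exp (t * ((\<Sum>i<n. (x i)\<^sup>2) - real n))) \<in> borel_measurable (noise_law n)" for t
    by measurable
  note I = integrable_and_integral_le[OF m _ E]
  have I1: "integrable (noise_law n) (\<lambda>x. exp (l * ((\<Sum>i<n. (x i)\<^sup>2) - real n)))"
     "(\<integral>x. exp (l * ((\<Sum>i<n. (x i)\<^sup>2) - real n)) \<partial>noise_law n) \<le> exp 1"
    using I[of l] l by auto
  have I2: "integrable (noise_law n) (\<lambda>x. exp (- l * ((\<Sum>i<n. (x i)\<^sup>2) - real n)))"
     "(\<integral>x. exp (- l * ((\<Sum>i<n. (x i)\<^sup>2) - real n)) \<partial>noise_law n) \<le> exp 1"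
    using I[of "- l"] l by auto
  have cosh: "y\<^sup>2 \<le> 2 * (exp y + exp (- y))" for y :: real
  proof -
    have *: "y\<^sup>2 \<le> 2 * (exp y + exp (- y))" if "0 \<le> y" for y :: real
    proof -
      define q where "q = y\<^sup>2"
      have "exp y \<ge> 1 + y + q / 2" using exp_lower_Taylor_quadratic[OF that] by (simp add: q_def)
      moreover define E where "E = exp (- y)"
      moreover have "E \<ge> 1 - y" using exp_ge_add_one_self[of "- y"] by (simp add: E_def)
      ultimately have "q \<le> 2 * (exp y + E)" by argo
      then have "q \<le> 2 * (exp y + exp (- y))" by (simp only: E_def)
      then show ?thesis by (simp add: q_def)
    qed
    show ?thesis using *[of y] *[of "- y"] by (cases "0 \<le> y") auto
  qed
  let ?S = "\<lambda>x. (\<Sum>i<n. (x i)\<^sup>2) - real n"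
  have bnd: "(?S x)\<^sup>2 \<le> 32 * real n * (exp (l * ?S x) + exp (- l * ?S x))" for x
  proof -
    have "(l * ?S x)\<^sup>2 \<le> 2 * (exp (l * ?S x) + exp (- l * ?S x))" using cosh[of "l * ?S x"] by simp
    then have "(?S x)\<^sup>2 * (1 / (16 * real n)) \<le> 2 * (exp (l * ?S x) + exp (- l * ?S x))"
      by (simp add: power_mult_distrib l(3))
    then show ?thesis using n by (simp add: field_simps)
  qed
  have ib: "integrable (noise_law n) (\<lambda>x. 32 * real n * (exp (l * ?S x) + exp (- l * ?S x)))"
    using I1 I2 by auto
  show i: "integrable (noise_law n) (\<lambda>x. (?S x)\<^sup>2)"
    by (rule Bochner_Integration.integrable_bound[OF ib]) (use bnd in auto)
  have "(\<integral>x. (?S x)\<^sup>2 \<partial>noise_law n) \<le> (\<integral>x. 32 * real n * (exp (l * ?S x) + exp (- l * ?S x)) \<partial>noise_law n)"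
    by (rule integral_mono[OF i ib bnd])
  also have "\<dots> = 32 * real n * ((\<integral>x. exp (l * ?S x) \<partial>noise_law n) + (\<integral>x. exp (- l * ?S x) \<partial>noise_law n))"
    using I1 I2 by simp
  also have "\<dots> \<le> 32 * real n * (exp 1 + exp 1)"
    using I1 I2 by (intro mult_left_mono add_mono) auto
  finally show "(\<integral>x. (?S x)\<^sup>2 \<partial>noise_law n) \<le> 64 * exp 1 * real n" by (simp add: mult_ac)
qed

lemma dyadic_cell:
  fixes y :: real
  assumes "1 \<le> y" "y < 2 ^ J"
  shows "\<exists>j<J. 2 ^ j \<le> y \<and> y < 2 ^ Suc j"
  using assms
proof (induction J)
  case (Suc J)
  then show ?case by (cases "y < 2 ^ J") (auto intro: less_SucI)
qed simp

definition linear_sup_const :: real where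
  "linear_sup_const = 2 * (16384 * exp 9 + 1)"

text \<open>The process \<open>- 2 \<Sum> w v z\<close> has variance at most \<open>4 d\<close> with \<open>d = \<Sum> w v^2\<close>, and \<open>- d\<close> is
  its drift.  On the dyadic block around \<open>d = 2^j\<close> the drift beats the fluctuation by a factor
  exponential in \<open>2^j\<close>, so the blocks sum to an absolute constant.\<close>

lemma linear_process_sup_bound:
  assumes u: "orthonormal n p u"
    and w: "\<And>a k. a \<in> I \<Longrightarrow> k < p \<Longrightarrow> 0 \<le> w a k \<and> w a k \<le> 1"
    and ord: "\<And>a b. a \<in> I \<Longrightarrow> b \<in> I \<Longrightarrow> (\<forall>k<p. w a k \<le> w b k) \<or> (\<forall>k<p. w b k \<le> w a k)"
  shows "majorised (noise_law n) I
      (\<lambda>a x. - 2 * (\<Sum>k<p. w a k * v k * coord n u k x) - (\<Sum>k<p. w a k * (v k)\<^sup>2))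
      linear_sup_const"
proof -
  define d where "d a = (\<Sum>k<p. w a k * (v k)\<^sup>2)" for a
  define Z where "Z a x = (\<Sum>k<p. (- 2 * w a k * v k) * coord n u k x)" for a x
  define R where "R x = (\<Sum>k<p. 1 + (coord n u k x)\<^sup>2)" for x
  have d0: "0 \<le> d a" if "a \<in> I" for a using w[OF that] by (auto simp: d_def intro!: sum_nonneg)
  have dmax: "d a \<le> (\<Sum>k<p. (v k)\<^sup>2)" if "a \<in> I" for a
    unfolding d_def using w[OF that] by (intro sum_mono) (auto simp: mult_left_le_one_le)
  have incr: "(\<Sum>k<p. ((w a k - w b k) * v k)\<^sup>2) \<le> \<bar>d a - d b\<bar>" if ab: "a \<in> I" "b \<in> I" for a b
  proof -
    have "(\<Sum>k<p. ((w a k - w b k) * v k)\<^sup>2) \<le> (\<Sum>k<p. \<bar>w a k - w b k\<bar> * (v k)\<^sup>2)"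
    proof (rule sum_mono)
      fix k assume "k \<in> {..<p}"
      then have "\<bar>w a k - w b k\<bar> \<le> 1" using w[OF ab(1), of k] w[OF ab(2), of k] by auto
      then have "\<bar>w a k - w b k\<bar> * \<bar>w a k - w b k\<bar> \<le> 1 * \<bar>w a k - w b k\<bar>"
        by (intro mult_right_mono) auto
      then have "(w a k - w b k)\<^sup>2 \<le> \<bar>w a k - w b k\<bar>" by (simp add: power2_eq_square)
      then show "((w a k - w b k) * v k)\<^sup>2 \<le> \<bar>w a k - w b k\<bar> * (v k)\<^sup>2"
        by (simp add: power_mult_distrib mult_right_mono)
    qed
    also have "\<dots> = \<bar>\<Sum>k<p. (w a k - w b k) * (v k)\<^sup>2\<bar>"
      using ord[OF ab]
    proof
      assume "\<forall>k<p. w a k \<le> w b k"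
      then have "(\<Sum>k<p. \<bar>w a k - w b k\<bar> * (v k)\<^sup>2) = - (\<Sum>k<p. (w a k - w b k) * (v k)\<^sup>2)"
        unfolding sum_negf[symmetric] by (intro sum.cong) (auto simp: algebra_simps)
      moreover have "0 \<le> (\<Sum>k<p. \<bar>w a k - w b k\<bar> * (v k)\<^sup>2)" by (intro sum_nonneg) auto
      ultimately show ?thesis by linarith
    next
      assume "\<forall>k<p. w b k \<le> w a k"
      then have "(\<Sum>k<p. \<bar>w a k - w b k\<bar> * (v k)\<^sup>2) = (\<Sum>k<p. (w a k - w b k) * (v k)\<^sup>2)"
        by (intro sum.cong) auto
      moreover have "0 \<le> (\<Sum>k<p. \<bar>w a k - w b k\<bar> * (v k)\<^sup>2)" by (intro sum_nonneg) auto
      ultimately show ?thesis by linarith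
    qed
    also have "\<dots> = \<bar>d a - d b\<bar>" by (simp add: d_def left_diff_distrib sum_subtractf)
    finally show ?thesis .
  qed
  have sq: "(\<Sum>k<p. (w a k * v k)\<^sup>2) \<le> d a" if a: "a \<in> I" for a
    unfolding d_def
  proof (rule sum_mono)
    fix k assume "k \<in> {..<p}"
    then have "(w a k)\<^sup>2 \<le> w a k" using w[OF a, of k] by (auto simp: power2_eq_square mult_left_le_one_le)
    then show "(w a k * v k)\<^sup>2 \<le> w a k * (v k)\<^sup>2" by (simp add: power_mult_distrib mult_right_mono)
  qed
  have mgf: "(\<integral>\<^sup>+x. ennreal (exp (l * (\<Sum>k<p. c k * coord n u k x))) \<partial>noise_law n)
     = ennreal (exp (l\<^sup>2 * (\<Sum>k<p. (c k)\<^sup>2) / 2))" for l c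
    using nn_integral_exp_linear[OF u, of "\<lambda>k. l * c k"]
    by (simp add: power_mult_distrib mult.assoc flip: sum_distrib_left)
  have Zdiff: "Z a x - Z b x = (\<Sum>k<p. (- 2 * ((w a k - w b k) * v k)) * coord n u k x)" for a b x
    unfolding Z_def sum_subtractf[symmetric] by (intro sum.cong refl) (simp add: algebra_simps)
  have abs_m2: "\<bar>(- 2 * c) * z\<bar> = \<bar>c\<bar> * (2 * \<bar>z\<bar>)" for c z :: real by (simp add: abs_mult)
  have measZ: "Z a \<in> borel_measurable (noise_law n)" for a unfolding Z_def by measurable
  interpret prob_space "noise_law n" by (rule prob_space_noise_law)
  define cell where "cell j = {a\<in>I. 2^j - 1 \<le> d a \<and> d a < 2^j - 1 + 2^j}" for j :: nat
  have block: "majorised (noise_law n) (cell j) (\<lambda>a x. Z a x - d a) ((16384 * exp 9 + 1) * (1/2) ^ j)" for j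
  proof -
    let ?I = "{a\<in>I. 2^j - 1 \<le> d a \<and> d a < 2^j - 1 + 2^j}"
    have B: "majorised (noise_law n) ?I
      (\<lambda>a x. Z a x - (2^j - 1))
      (2 * exp 8 * exp (2^j / 128) / (1/64) * exp (- (1/64) * (2^j - 1)) + (1/2)^j)"
    proof (rule chaining_bound[where d=d and h="2^j" and lo="2^j - 1" and \<tau>="1/2" and R=R])
      show "prob_space (noise_law n)" by (rule prob_space_noise_law)
      show "Z a \<in> borel_measurable (noise_law n)" for a by (rule measZ)
      fix a assume a: "a \<in> ?I"
      have "(\<integral>\<^sup>+x. ennreal (exp ((1/64) / (1 - 1/2) * Z a x)) \<partial>noise_law n)
         = ennreal (exp ((1/64 / (1 - 1/2))\<^sup>2 * (\<Sum>k<p. (- 2 * w a k * v k)\<^sup>2) / 2))"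
        unfolding Z_def by (rule mgf)
      also have "(\<Sum>k<p. (- 2 * w a k * v k)\<^sup>2) = 4 * (\<Sum>k<p. (w a k * v k)\<^sup>2)"
        by (simp add: sum_distrib_left power_mult_distrib mult_ac)
      also have "(1/64 / (1 - 1/2))\<^sup>2 * (4 * (\<Sum>k<p. (w a k * v k)\<^sup>2)) / 2 \<le> 2^j / 128"
        using sq[of a] a by (simp add: power2_eq_square)
      finally show "(\<integral>\<^sup>+x. ennreal (exp ((1/64) / (1 - 1/2) * Z a x)) \<partial>noise_law n) \<le> ennreal (exp (2^j / 128))"
        by (simp add: ennreal_leI)
    next
      fix a b l assume a: "a \<in> ?I" and b: "b \<in> ?I" and energy: "d b \<le> d a" "d a - d b \<le> 2^j / 16 ^ l"
      have "(\<integral>\<^sup>+x. ennreal (exp (1/64 * 2 ^ Suc l / (1/2) * (Z a x - Z b x))) \<partial>noise_law n)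
         = (\<integral>\<^sup>+x. ennreal (exp ((1/64 * 2 ^ Suc l / (1/2)) * (\<Sum>k<p. (- 2 * ((w a k - w b k) * v k)) * coord n u k x))) \<partial>noise_law n)"
        by (simp only: Zdiff)
      also have "\<dots> = ennreal (exp ((1/64 * 2 ^ Suc l / (1/2))\<^sup>2 * (\<Sum>k<p. (- 2 * ((w a k - w b k) * v k))\<^sup>2) / 2))"
        by (rule mgf)
      also have "(\<Sum>k<p. (- 2 * ((w a k - w b k) * v k))\<^sup>2) = 4 * (\<Sum>k<p. ((w a k - w b k) * v k)\<^sup>2)"
        by (simp add: sum_distrib_left power_mult_distrib)
      also have "(1/64 * 2 ^ Suc l / (1/2))\<^sup>2 * (4 * (\<Sum>k<p. ((w a k - w b k) * v k)\<^sup>2)) / 2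
         \<le> (1/64 * 2 ^ Suc l / (1/2))\<^sup>2 * (4 * (2^j / 16^l)) / 2"
        using incr[of a b] a b energy by (intro divide_right_mono mult_left_mono) auto
      also have "(1/64 * 2 ^ Suc l / (1/2))\<^sup>2 = (1/256) * (4::real) ^ l"
        by (simp add: power2_eq_square field_simps flip: power_mult_distrib)
      also have "(1/256) * 4 ^ l * (4 * (2^j / 16^l)) / 2 = 2^j / 128 * ((4::real)^l / 16^l)"
        by simp
      also have "\<dots> \<le> 2^j / 128 * 1"
        by (intro mult_left_mono) (auto intro: power_mono)
      finally show "(\<integral>\<^sup>+x. ennreal (exp (1/64 * 2 ^ Suc l / (1/2) * (Z a x - Z b x))) \<partial>noise_law n) \<le> ennreal (exp (2^j / 128))"
        by (simp add: ennreal_leI)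
    next
      show "integrable (noise_law n) R" unfolding R_def
        by (intro Bochner_Integration.integrable_sum Bochner_Integration.integrable_add coord_moments[OF u]) auto
      show "0 \<le> R x" for x unfolding R_def by (intro sum_nonneg) auto
      fix a b x assume a: "a \<in> ?I" and b: "b \<in> ?I"
      have s: "\<bar>(w a k - w b k) * v k\<bar> \<le> sqrt \<bar>d a - d b\<bar>" if "k < p" for k
      proof (rule real_le_rsqrt)
        have "((w a k - w b k) * v k)\<^sup>2 \<le> (\<Sum>k<p. ((w a k - w b k) * v k)\<^sup>2)"
          using that by (intro member_le_sum) auto
        then show "\<bar>(w a k - w b k) * v k\<bar>\<^sup>2 \<le> \<bar>d a - d b\<bar>" using incr[of a b] a b by simp
      qed
      have "\<bar>Z a x - Z b x\<bar> = \<bar>\<Sum>k<p. (- 2 * ((w a k - w b k) * v k)) * coord n u k x\<bar>"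
        by (simp only: Zdiff)
      also have "\<dots> \<le> (\<Sum>k<p. \<bar>(- 2 * ((w a k - w b k) * v k)) * coord n u k x\<bar>)" by (rule sum_abs)
      also have "\<dots> \<le> (\<Sum>k<p. sqrt \<bar>d a - d b\<bar> * (1 + (coord n u k x)\<^sup>2))"
      proof (rule sum_mono)
        fix k assume k: "k \<in> {..<p}"
        have "2 * \<bar>coord n u k x\<bar> \<le> 1 + (coord n u k x)\<^sup>2"
          using zero_le_power2[of "\<bar>coord n u k x\<bar> - 1"] by (simp add: power2_diff)
        then have "\<bar>(w a k - w b k) * v k\<bar> * (2 * \<bar>coord n u k x\<bar>) \<le> sqrt \<bar>d a - d b\<bar> * (1 + (coord n u k x)\<^sup>2)"
          using s[of k] k by (intro mult_mono) auto
        then show "\<bar>(- 2 * ((w a k - w b k) * v k)) * coord n u k x\<bar> \<le> sqrt \<bar>d a - d b\<bar> * (1 + (coord n u k x)\<^sup>2)"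
          by (subst abs_m2)
      qed
      also have "\<dots> = sqrt \<bar>d a - d b\<bar> * R x" by (simp add: R_def sum_distrib_left)
      finally show "\<bar>Z a x - Z b x\<bar> \<le> sqrt \<bar>d a - d b\<bar> * R x" .
    qed auto
    have "2 * exp 8 * exp (2^j / 128) / (1/64) * exp (- (1/64) * (2^j - 1)) + (1/2)^j \<le> (16384 * exp 9 + 1) * (1/2 :: real) ^ j"
    proof -
      have "exp (2^j / 128) * exp (- (1/64) * (2^j - 1)) = exp (1/64) * exp (- (2^j / 128) :: real)"
        by (simp add: field_simps flip: exp_add)
      also have "\<dots> \<le> exp 1 * (128 * (1/2)^j)"
      proof (intro mult_mono)
        have "2^j / 128 \<le> exp (2^j / 128 :: real)" using exp_ge_add_one_self[of "2^j / 128 :: real"] by linarith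
        then have "inverse (exp (2^j / 128 :: real)) \<le> inverse (2^j / 128)" by (intro le_imp_inverse_le) auto
        then show "exp (- (2^j / 128) :: real) \<le> 128 * (1/2)^j" by (simp add: exp_minus field_simps)
      qed auto
      finally have "exp (2^j / 128) * exp (- (1/64) * (2^j - 1)) \<le> exp 1 * (128 * (1/2::real)^j)" .
      then have "128 * exp 8 * (exp (2^j / 128) * exp (- (1/64) * (2^j - 1))) \<le> 128 * exp 8 * (exp 1 * (128 * (1/2::real)^j))"
        by (intro mult_left_mono) auto
      also have "\<dots> = 16384 * exp 9 * (1/2)^j" using exp_add[of 8 "1::real"] by simp
      also have "128 * exp 8 * (exp (2^j / 128) * exp (- (1/64) * (2^j - 1 :: real)))
        = 2 * exp 8 * exp (2^j / 128) / (1/64) * exp (- (1/64) * (2^j - 1))" by simp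
      finally show ?thesis by (simp only: distrib_right mult_1 add_le_cancel_right)
    qed
    then show ?thesis by (intro majorised_mono[OF B]) (auto simp: cell_def)
  qed
  obtain J where J: "(\<Sum>k<p. (v k)\<^sup>2) + 1 < 2 ^ J" using real_arch_pow[of 2 "(\<Sum>k<p. (v k)\<^sup>2) + 1"] by auto
  have "majorised (noise_law n) (\<Union>j<J. cell j) (\<lambda>a x. Z a x - d a) (\<Sum>j<J. (16384 * exp 9 + 1) * (1/2) ^ j)"
    by (rule majorised_UN) (auto intro: block)
  then show ?thesis
  proof (rule majorised_mono)
    show "I \<subseteq> (\<Union>j<J. cell j)"
    proof
      fix a assume a: "a \<in> I"
      obtain j where "j < J" "2^j \<le> d a + 1" "d a + 1 < 2 ^ Suc j"
        using dyadic_cell[of "d a + 1" J] d0[OF a] dmax[OF a] J by auto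
      then show "a \<in> (\<Union>j<J. cell j)" using a by (intro UN_I[of j]) (auto simp: cell_def)
    qed
    show "- 2 * (\<Sum>k<p. w a k * v k * coord n u k x) - (\<Sum>k<p. w a k * (v k)\<^sup>2) \<le> Z a x - d a" for a x
      by (simp add: Z_def d_def sum_distrib_left mult.assoc sum_negf)
    have "(\<Sum>j<J. (16384 * exp 9 + 1) * (1/2) ^ j) = (16384 * exp 9 + 1) * (2 * (1 - (1/2 :: real)^J))"
      unfolding sum_distrib_left[symmetric] by (simp add: sum_gp_strict)
    also have "\<dots> \<le> (16384 * exp 9 + 1) * (2 * 1)" by (intro mult_left_mono) (auto intro: add_nonneg_nonneg)
    finally show "(\<Sum>j<J. (16384 * exp 9 + 1) * (1/2) ^ j) \<le> linear_sup_const" by (simp add: linear_sup_const_def)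
  qed
qed

section \<open>The quadratic process\<close>

text \<open>This fixes the threshold 24 above which the block levels are so high that the quadratic form is
  Gaussian up to a bounded factor.\<close>

lemma pow4_le_exp:
  assumes "j \<ge> 24" shows "32 * real j ^ 4 \<le> exp (real j)"
proof -
  have "32 * j ^ 4 \<le> 2 ^ j" using assms
  proof (induction j rule: dec_induct)
    case (step j)
    have "24 * (Suc j) \<le> 25 * j" using step by simp
    then have "(24 * Suc j) ^ 4 \<le> (25 * j) ^ 4" by (rule power_mono) simp
    moreover have "(24 * a) ^ 4 = 331776 * a ^ 4" "(25 * a) ^ 4 = 390625 * a ^ 4" for a :: nat
      by (simp_all add: power_mult_distrib)
    ultimately have "331776 * (Suc j) ^ 4 \<le> 390625 * j ^ 4" by (simp only:)
    then have "(Suc j) ^ 4 \<le> 2 * j ^ 4" by linarith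
    then show ?case using step by simp
  qed simp
  then have "real (32 * j ^ 4) \<le> real (2 ^ j)" by (simp only: of_nat_le_iff)
  then have "32 * real j ^ 4 \<le> 2 ^ j" by simp
  also have "\<dots> \<le> exp 1 ^ j" using exp_ge_add_one_self[of 1] by (intro power_mono) auto
  also have "\<dots> = exp (real j)" by (simp flip: exp_of_nat_mult)
  finally show ?thesis .
qed

text \<open>An ordered family of smoothers, seen through its weights in the singular basis.\<close>

locale weight_chain =
  fixes n p :: nat and u :: "nat \<Rightarrow> nat \<Rightarrow> real" and I :: "'i set" and g :: "'i \<Rightarrow> nat \<Rightarrow> real"
  assumes u: "orthonormal n p u" and pn: "p \<le> n"
    and g01: "\<And>a k. a \<in> I \<Longrightarrow> k < p \<Longrightarrow> 0 \<le> g a k \<and> g a k \<le> 1"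
    and ord: "\<And>a b. a \<in> I \<Longrightarrow> b \<in> I \<Longrightarrow> (\<forall>k<p. g a k \<le> g b k) \<or> (\<forall>k<p. g b k \<le> g a k)"
begin

definition energy :: "'i \<Rightarrow> real" where "energy a = (\<Sum>k<p. (g a k)\<^sup>2)"

definition noise_form :: "'i \<Rightarrow> (nat \<Rightarrow> real) \<Rightarrow> real" where "noise_form a = centred_form n p u (g a)"

lemma energy_nonneg: "0 \<le> energy a"
  by (simp add: energy_def sum_nonneg)

lemma energy_le: assumes "a \<in> I" shows "energy a \<le> real n"
proof -
  have "energy a \<le> (\<Sum>k<p. 1)" unfolding energy_def
    using g01[OF assms] by (intro sum_mono) (auto simp: power_le_one)
  then show ?thesis using pn by simp
qed

text \<open>For \<open>0 \<le> b \<le> a\<close> one has \<open>(a - b)^2 \<le> a^2 - b^2\<close>: ordered weights turn the energy into a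
  clock for the process.\<close>

lemma increment_le_if_ge:
  assumes ab: "a \<in> I" "b \<in> I" and ge: "\<And>k. k < p \<Longrightarrow> g b k \<le> g a k"
  shows "(\<Sum>k<p. (g a k - g b k)\<^sup>2) \<le> energy a - energy b"
  unfolding energy_def sum_subtractf[symmetric]
proof (rule sum_mono)
  fix k assume "k \<in> {..<p}"
  then have "0 \<le> g b k" "g b k \<le> g a k" using ge g01[OF ab(2)] by auto
  then have "0 \<le> g b k * (g a k - g b k)" by simp
  then show "(g a k - g b k)\<^sup>2 \<le> (g a k)\<^sup>2 - (g b k)\<^sup>2"
    by (simp add: power2_eq_square algebra_simps)
qed

lemma increment_le:
  assumes ab: "a \<in> I" "b \<in> I"
  shows "(\<Sum>k<p. (g a k - g b k)\<^sup>2) \<le> \<bar>energy a - energy b\<bar>"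
  using ord[OF ab]
proof
  assume "\<forall>k<p. g b k \<le> g a k"
  then show ?thesis using increment_le_if_ge[OF ab] by force
next
  assume "\<forall>k<p. g a k \<le> g b k"
  then have "(\<Sum>k<p. (g b k - g a k)\<^sup>2) \<le> energy b - energy a" using increment_le_if_ge[OF ab(2,1)] by force
  then show ?thesis by (simp add: power2_commute)
qed

lemma weights_ge_if_energy_ge:
  assumes ab: "a \<in> I" "b \<in> I" and d: "energy b \<le> energy a" and k: "k < p"
  shows "g b k \<le> g a k"
  using ord[OF ab]
proof
  assume "\<forall>k<p. g a k \<le> g b k"
  then have "(\<Sum>k<p. (g b k - g a k)\<^sup>2) \<le> energy b - energy a" using increment_le_if_ge[OF ab(2,1)] by force
  then have "(\<Sum>k<p. (g b k - g a k)\<^sup>2) \<le> 0" using d by simp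
  moreover have "(g b k - g a k)\<^sup>2 \<le> (\<Sum>k<p. (g b k - g a k)\<^sup>2)"
    using k by (intro member_le_sum) auto
  ultimately have "(g b k - g a k)\<^sup>2 \<le> 0" by linarith
  then show ?thesis by simp
qed (use k in auto)

lemma noise_form_diff: "noise_form a x - noise_form b x = centred_form n p u (\<lambda>k. g a k - g b k) x"
  by (simp add: noise_form_def centred_form_def left_diff_distrib sum_subtractf diff_divide_distrib)

lemma noise_form_measurable: "noise_form a \<in> borel_measurable (noise_law n)"
  unfolding noise_form_def by measurable

lemma noise_form_diff_le:
  assumes ab: "a \<in> I" "b \<in> I"
  shows "\<bar>noise_form a x - noise_form b x\<bar> \<le> sqrt \<bar>energy a - energy b\<bar> * ((\<Sum>k<p. (coord n u k x)\<^sup>2) + (\<Sum>i<n. (x i)\<^sup>2))"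
proof -
  let ?m = "sqrt \<bar>energy a - energy b\<bar>"
  have m: "\<bar>g a k - g b k\<bar> \<le> ?m" if "k < p" for k
  proof (rule real_le_rsqrt)
    have "(g a k - g b k)\<^sup>2 \<le> (\<Sum>k<p. (g a k - g b k)\<^sup>2)"
      using that by (intro member_le_sum) auto
    then show "\<bar>g a k - g b k\<bar>\<^sup>2 \<le> \<bar>energy a - energy b\<bar>" using increment_le[OF ab] by simp
  qed
  have 1: "\<bar>\<Sum>k<p. (g a k - g b k) * (coord n u k x)\<^sup>2\<bar> \<le> ?m * (\<Sum>k<p. (coord n u k x)\<^sup>2)"
  proof -
    have "\<bar>\<Sum>k<p. (g a k - g b k) * (coord n u k x)\<^sup>2\<bar> \<le> (\<Sum>k<p. \<bar>(g a k - g b k) * (coord n u k x)\<^sup>2\<bar>)"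
      by (rule sum_abs)
    also have "\<dots> \<le> (\<Sum>k<p. ?m * (coord n u k x)\<^sup>2)"
      using m by (intro sum_mono) (auto simp: abs_mult mult_right_mono)
    finally show ?thesis by (simp add: sum_distrib_left)
  qed
  have "\<bar>(\<Sum>k<p. g a k - g b k) / real n\<bar> \<le> ?m"
  proof (cases "n = 0")
    case False
    have "\<bar>\<Sum>k<p. g a k - g b k\<bar> \<le> (\<Sum>k<p. \<bar>g a k - g b k\<bar>)" by (rule sum_abs)
    also have "\<dots> \<le> (\<Sum>k<p. ?m)" using m by (intro sum_mono) auto
    also have "\<dots> \<le> real n * ?m" using pn by (simp add: mult_right_mono)
    finally show ?thesis using False by (simp add: field_simps)
  qed simp
  then have 2: "\<bar>(\<Sum>k<p. g a k - g b k) / real n * (\<Sum>i<n. (x i)\<^sup>2)\<bar> \<le> ?m * (\<Sum>i<n. (x i)\<^sup>2)"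
    by (simp only: abs_mult) (intro mult_mono, auto intro: sum_nonneg)
  show ?thesis unfolding noise_form_diff centred_form_def
    using 1 2 by (simp only: distrib_left)
qed

text \<open>The chaining inequality for the quadratic form.  A link at level \<open>l\<close> has coefficients bounded both by
  1 and by the root of its energy \<open>h / 16^l\<close>, hence by the geometric mean of the two; this keeps
  the links within the range of the exponential moment bound although their share of the exponent
  shrinks.\<close>

lemma block_bound:
  assumes I': "\<And>a. a \<in> I' \<Longrightarrow> a \<in> I \<and> lo \<le> energy a \<and> energy a < lo + h"
    and h: "0 < h" and tau: "0 < \<tau>" "\<tau> < 1" and mu: "0 < \<mu>" and B: "0 \<le> B"
    and top: "\<mu> / (1 - \<tau>) \<le> 1/4"
      "(\<mu> / (1 - \<tau>))\<^sup>2 * (1 + 4 * (\<mu> / (1 - \<tau>))) * (lo + h) \<le> B"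
    and inc: "2 * \<mu> / \<tau> * sqrt (sqrt h) \<le> 1/4" "8 * \<mu>\<^sup>2 * h / \<tau>\<^sup>2 \<le> B"
    and eta: "0 < \<eta>"
  shows "majorised (noise_law n) I'
      (\<lambda>a x. noise_form a x - c)
      (2 * exp 8 * exp B / \<mu> * exp (- \<mu> * c) + \<eta>)"
proof (rule chaining_bound[where d=energy and h=h and lo=lo and \<tau>=\<tau> and
      R="\<lambda>x. (\<Sum>k<p. (coord n u k x)\<^sup>2) + (\<Sum>i<n. (x i)\<^sup>2)"])
  show "prob_space (noise_law n)" by (rule prob_space_noise_law)
  show "noise_form a \<in> borel_measurable (noise_law n)" for a by (rule noise_form_measurable)
  fix a assume "a \<in> I'"
  then have a: "a \<in> I" "energy a \<le> lo + h" using I' by (auto simp: less_imp_le)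
  let ?l = "\<mu> / (1 - \<tau>)"
  have l0: "0 \<le> ?l" using mu tau by simp
  have "(\<integral>\<^sup>+x. ennreal (exp (?l * noise_form a x)) \<partial>noise_law n)
    \<le> ennreal (exp (?l\<^sup>2 * (1 + 4 * (?l * 1)) * (\<Sum>k<p. (g a k)\<^sup>2)))"
    unfolding noise_form_def
    by (rule nn_integral_exp_centred_form[OF u pn]) (use g01[OF a(1)] l0 top in auto)
  also have "?l\<^sup>2 * (1 + 4 * (?l * 1)) * (\<Sum>k<p. (g a k)\<^sup>2) \<le> ?l\<^sup>2 * (1 + 4 * ?l) * (lo + h)"
    using a(2) l0 by (simp only: mult_1_right energy_def[symmetric]) (intro mult_left_mono mult_nonneg_nonneg, auto)
  also have "\<dots> \<le> B" by (rule top)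
  finally show "(\<integral>\<^sup>+x. ennreal (exp (?l * noise_form a x)) \<partial>noise_law n) \<le> ennreal (exp B)"
    by (simp add: ennreal_leI)
next
  fix a b l assume a: "a \<in> I'" and b: "b \<in> I'" and d: "energy b \<le> energy a" "energy a - energy b \<le> h / 16 ^ l"
  then have ab: "a \<in> I" "b \<in> I" using I' by auto
  define m where "m = sqrt (sqrt (h / 16 ^ l))"
  have "(16::real) ^ l = ((2 ^ l)\<^sup>2)\<^sup>2" by (simp add: power2_eq_square flip: power_mult_distrib)
  then have "sqrt (sqrt (16 ^ l)) = 2 ^ l" by (simp only: real_sqrt_abs) simp
  then have m_eq: "m = sqrt (sqrt h) / 2 ^ l" by (simp add: m_def real_sqrt_divide)
  define t where "t = \<mu> * 2 ^ Suc l / \<tau>"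
  have t0: "0 \<le> t" using mu tau by (simp add: t_def)
  have tm: "t * m \<le> 1/4" using inc(1) by (simp add: t_def m_eq mult_ac)
  have c: "0 \<le> g a k - g b k \<and> g a k - g b k \<le> m" if k: "k < p" for k
  proof
    show c0: "0 \<le> g a k - g b k" using weights_ge_if_energy_ge[OF ab d(1) k] by simp
    define y where "y = g a k - g b k"
    have y: "0 \<le> y" "y \<le> 1" using c0 g01[OF ab(1) k] g01[OF ab(2) k] by (auto simp: y_def)
    \<comment> \<open>As \<open>y \<le> 1\<close>, the energy of the link bounds even \<open>y^4\<close>: the geometric mean of both bounds.\<close>
    have "y\<^sup>2 \<le> (\<Sum>k<p. (g a k - g b k)\<^sup>2)" unfolding y_def
      using k by (intro member_le_sum) auto
    also have "\<dots> \<le> h / 16 ^ l" using increment_le[OF ab] d by simp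
    finally have y2: "y\<^sup>2 \<le> h / 16 ^ l" .
    have "(y\<^sup>2)\<^sup>2 \<le> y\<^sup>2 * 1" using y unfolding power2_eq_square[of "y\<^sup>2"] by (intro mult_left_mono) (auto simp: power_le_one)
    then have "(y\<^sup>2)\<^sup>2 \<le> h / 16 ^ l" using y2 by simp
    then have "y\<^sup>2 \<le> sqrt (h / 16 ^ l)" by (rule real_le_rsqrt)
    then have "y \<le> m" unfolding m_def by (rule real_le_rsqrt)
    then show "g a k - g b k \<le> m" by (simp add: y_def)
  qed
  have m0: "0 \<le> m" using h by (simp add: m_def)
  have "(\<integral>\<^sup>+x. ennreal (exp (t * (noise_form a x - noise_form b x))) \<partial>noise_law n)
     \<le> ennreal (exp (t\<^sup>2 * (1 + 4 * (t * m)) * (\<Sum>k<p. (g a k - g b k)\<^sup>2)))"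
    unfolding noise_form_diff
    by (rule nn_integral_exp_centred_form[OF u pn]) (use c t0 tm m0 in auto)
  also have "t\<^sup>2 * (1 + 4 * (t * m)) * (\<Sum>k<p. (g a k - g b k)\<^sup>2) \<le> t\<^sup>2 * 2 * (h / 16 ^ l)"
    using increment_le[OF ab] d tm t0 m0 by (intro mult_mono mult_left_mono) (auto intro: sum_nonneg)
  also have "\<dots> = 8 * \<mu>\<^sup>2 * h / \<tau>\<^sup>2 * (4 ^ l / 16 ^ l)"
  proof -
    have "((2::real) ^ Suc l)\<^sup>2 = 4 * 4 ^ l" by (simp add: power2_eq_square flip: power_mult_distrib)
    then have "t\<^sup>2 = \<mu>\<^sup>2 * (4 * 4 ^ l) / \<tau>\<^sup>2" by (simp only: t_def power_divide power_mult_distrib)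
    then show ?thesis by simp
  qed
  also have "\<dots> \<le> 8 * \<mu>\<^sup>2 * h / \<tau>\<^sup>2 * 1"
    using h by (intro mult_left_mono) (auto intro: power_mono)
  also have "\<dots> \<le> B" using inc(2) by simp
  finally show "(\<integral>\<^sup>+x. ennreal (exp (\<mu> * 2 ^ Suc l / \<tau> * (noise_form a x - noise_form b x))) \<partial>noise_law n) \<le> ennreal (exp B)"
    by (simp add: ennreal_leI t_def)
next
  show "integrable (noise_law n) (\<lambda>x. (\<Sum>k<p. (coord n u k x)\<^sup>2) + (\<Sum>i<n. (x i)\<^sup>2))"
    by (intro Bochner_Integration.integrable_add Bochner_Integration.integrable_sum[where I="{..<p}"]
        coord_moments[OF u] noise_law_sum_squares) auto
  show "0 \<le> (\<Sum>k<p. (coord n u k x)\<^sup>2) + (\<Sum>i<n. (x i)\<^sup>2)" for x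
    by (intro add_nonneg_nonneg sum_nonneg) auto
  fix a b x assume "a \<in> I'" "b \<in> I'"
  then show "\<bar>noise_form a x - noise_form b x\<bar> \<le> sqrt \<bar>energy a - energy b\<bar> * ((\<Sum>k<p. (coord n u k x)\<^sup>2) + (\<Sum>i<n. (x i)\<^sup>2))"
    using I' by (intro noise_form_diff_le) auto
qed (use I' h tau mu B eta in auto)

text \<open>Without any penalty the supremum over energies below \<open>h\<close> is of the order of one standard deviation.\<close>

lemma low_bound:
  assumes h: "1 \<le> h"
  shows "majorised (noise_law n) {a\<in>I. energy a < h}
      noise_form
      (32 * exp 9 * sqrt h + 1)"
proof -
  have s1: "1 \<le> sqrt h" using h by simp
  have ss: "sqrt (sqrt h) \<le> sqrt h"
    using s1 by (simp add: real_le_lsqrt power2_eq_square)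
  let ?mu = "1 / (16 * sqrt h)"
  have mu2: "?mu\<^sup>2 * h = 1/256" using h by (simp add: power_divide power_mult_distrib)
  have mu16: "?mu \<le> 1/16" using s1 by (simp add: field_simps)
  have block: "majorised (noise_law n) {a\<in>I. energy a < h}
      (\<lambda>a x. noise_form a x - 0)
      (2 * exp 8 * exp 1 / ?mu * exp (- ?mu * 0) + 1)"
  proof (rule block_bound[where lo=0 and h=h and \<tau>="1/2"])
    show "?mu / (1 - 1/2) \<le> 1/4" using mu16 by simp
    have "(?mu / (1 - 1/2))\<^sup>2 * (1 + 4 * (?mu / (1 - 1/2))) * (0 + h) = (?mu\<^sup>2 * h) * (4 * (1 + 8 * ?mu))"
    proof -
      have "(m / (1 - 1/2))\<^sup>2 * (1 + 4 * (m / (1 - 1/2))) * (0 + h) = (m\<^sup>2 * h) * (4 * (1 + 8 * m))"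
        for m :: real by (simp add: power2_eq_square algebra_simps)
      then show ?thesis .
    qed
    also have "\<dots> \<le> 1/256 * (4 * (1 + 8 * (1/16)))"
      unfolding mu2 using mu16 by (intro mult_left_mono) auto
    finally show "(?mu / (1 - 1/2))\<^sup>2 * (1 + 4 * (?mu / (1 - 1/2))) * (0 + h) \<le> 1" by simp
    have "2 * ?mu / (1/2) * sqrt (sqrt h) \<le> 2 * ?mu / (1/2) * sqrt h"
      using ss h by (intro mult_left_mono) auto
    also have "\<dots> = 1/4" using h by simp
    finally show "2 * ?mu / (1/2) * sqrt (sqrt h) \<le> 1/4" .
    have "8 * ?mu\<^sup>2 * h / (1/2)\<^sup>2 = 32 * (?mu\<^sup>2 * h)" by (simp add: power2_eq_square)
    then show "8 * ?mu\<^sup>2 * h / (1/2)\<^sup>2 \<le> 1" unfolding mu2 by simp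
  qed (use h energy_nonneg in auto)
  have eq: "2 * exp 8 * exp 1 / ?mu * exp (- ?mu * 0) + 1 = 32 * exp 9 * sqrt h + (1::real)"
    using exp_add[of 8 "1::real"] by simp
  show ?thesis using block unfolding eq diff_0_right .
qed

text \<open>The multiplier \<open>\<mu> = sqrt (\<beta> / (2 D))\<close> is the optimal Chernoff exponent for the level
  \<open>sqrt (2 D \<beta>)\<close>, with value \<open>exp (- \<beta> / 2) = exp (- j / 2) \<epsilon>^2 / j\<close>; the factor
  \<open>exp (- gain j)\<close> is what the enlarged level gains on top.  Since \<open>\<beta>\<close> is of the order of \<open>j\<close>,
  a share \<open>\<tau> = 1 / j\<close> for the links changes the exponent \<open>\<beta> / 2\<close> by a bounded amount only, and with
  this share a relative block width of \<open>1 / (512 j^2)\<close> is small enough for the links not to exceed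
  \<open>exp (\<beta> / 2)\<close>.  The condition \<open>1 / \<epsilon>^2 \<le> exp j\<close> ensures \<open>\<beta> \<le> 5 j\<close>.\<close>

lemma high_block_bound:
  fixes d0 \<epsilon> gain \<eta> D :: real and j :: nat
  assumes d0: "5 \<le> d0" and j: "24 \<le> j" and eps: "0 < \<epsilon>" "\<epsilon> \<le> 1" "1 / \<epsilon>\<^sup>2 \<le> exp (real j)"
    and D: "d0 * exp (real j) \<le> D" "D \<le> d0 * exp (real j + 1)" and gain: "0 \<le> gain" and eta: "0 < \<eta>"
  defines "\<beta> \<equiv> real j + 2 * ln (real j / \<epsilon>\<^sup>2)"
  shows "majorised (noise_law n) {a\<in>I. D \<le> energy a \<and> energy a < D + 2 * D / (1024 * (real j)\<^sup>2)}
      (\<lambda>a x. noise_form a x - (1 + gain) * sqrt (2 * D * \<beta>))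
      (6 * exp 28 * sqrt d0 * (\<epsilon>\<^sup>2 / real j) * exp (- gain * real j) + \<eta>)"
proof -
  define r where "r = real j"
  have r: "24 \<le> r" using j by (simp add: r_def)
  have p4: "32 * r ^ 4 \<le> exp r" using pow4_le_exp[OF j] by (simp add: r_def)
  have D5: "5 * exp r \<le> D" using order_trans[OF mult_right_mono[OF d0, of "exp r"]] D(1) by (simp add: r_def)
  have D0: "0 < D" using D5 exp_gt_zero[of r] by linarith
  have D4: "160 * r ^ 4 \<le> D" using D5 p4 by linarith
  have e2: "0 < \<epsilon>\<^sup>2" "\<epsilon>\<^sup>2 \<le> 1" using eps by (auto simp: power_le_one)
  have \<beta>1: "r \<le> \<beta>"
  proof -
    have "1 \<le> r / \<epsilon>\<^sup>2" using e2 r by (simp add: field_simps)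
    then show ?thesis by (simp add: \<beta>_def r_def)
  qed
  have \<beta>5: "\<beta> \<le> 5 * r"
  proof -
    have "ln (r / \<epsilon>\<^sup>2) = ln r + ln (1 / \<epsilon>\<^sup>2)" using e2 r by (simp add: ln_div)
    also have "ln (1 / \<epsilon>\<^sup>2) \<le> ln (exp r)" using eps(3) e2 by (subst ln_le_cancel_iff) (auto simp: r_def)
    also have "ln r \<le> r" using ln_le_minus_one[of r] r by simp
    finally show ?thesis by (simp add: \<beta>_def r_def)
  qed
  have e\<beta>: "exp (- \<beta> / 2) = exp (- r / 2) * (\<epsilon>\<^sup>2 / r)"
  proof -
    have "exp (- \<beta> / 2) = exp (- r / 2 - ln (r / \<epsilon>\<^sup>2))" by (simp add: \<beta>_def r_def)
    also have "\<dots> = exp (- r / 2) / (r / \<epsilon>\<^sup>2)" using e2 r by (simp add: exp_diff)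
    finally show ?thesis by simp
  qed
  define \<mu> where "\<mu> = sqrt (\<beta> / (2 * D))"
  have \<mu>2: "\<mu>\<^sup>2 = \<beta> / (2 * D)" using \<beta>1 r D0 by (simp add: \<mu>_def)
  have \<mu>0: "0 < \<mu>" using \<beta>1 r D0 by (simp add: \<mu>_def)
  have \<mu>8: "8 * \<mu> \<le> 1 / r"
  proof (rule power2_le_imp_le)
    have "(8 * \<mu>)\<^sup>2 = 32 * \<beta> / D" by (simp add: power_mult_distrib \<mu>2)
    also have "\<dots> \<le> 32 * (5 * r) / (160 * r ^ 4)"
      using \<beta>5 D4 D0 r by (intro frac_le mult_left_mono) auto
    also have "\<dots> = 1 / r ^ 3" using r by (simp add: power_def eval_nat_numeral field_simps)
    also have "\<dots> \<le> 1 / r ^ 2" using r by (intro divide_left_mono power_increasing) auto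
    finally show "(8 * \<mu>)\<^sup>2 \<le> (1 / r)\<^sup>2" by (simp add: power_divide)
  qed (use r in auto)
  define h where "h = 2 * D / (1024 * r\<^sup>2)"
  have h0: "0 < h" using D0 r by (simp add: h_def)
  define y where "y = 1 / r"
  have y: "0 < y" "y \<le> 1/24" using r by (auto simp: y_def field_simps)
  define B where "B = \<beta> / 2 + 20"
  have q: "1 / (1 - y) \<le> 1 + y + 2 * y\<^sup>2"
  proof -
    have "y\<^sup>2 * (1 - 2 * y) \<ge> 0" using y by simp
    then have "1 \<le> (1 + y + 2 * y\<^sup>2) * (1 - y)" by (simp add: power2_eq_square algebra_simps)
    then show ?thesis using y by (simp add: field_simps)
  qed
  have y2: "y\<^sup>2 \<le> y / 24" using y by (simp add: power2_eq_square)
  have q': "1 / (1 - y) \<le> 1 + 13/12 * y" using q y2 by linarith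
  have block: "majorised (noise_law n) {a\<in>I. D \<le> energy a \<and> energy a < D + h}
      (\<lambda>a x. noise_form a x - (1 + gain) * sqrt (2 * D * \<beta>))
      (2 * exp 8 * exp B / \<mu> * exp (- \<mu> * ((1 + gain) * sqrt (2 * D * \<beta>))) + \<eta>)"
  proof (rule block_bound[where lo=D and h=h and \<tau>=y])
    show "0 < y" "y < 1" using y by auto
    show "0 \<le> B" using \<beta>1 r by (simp add: B_def)
    have l2: "\<mu> / (1 - y) \<le> 2 * \<mu>"
    proof -
      have "1 / (1 - y) \<le> 2" using q' y by linarith
      from mult_left_mono[OF this, of \<mu>] show ?thesis using \<mu>0 by simp
    qed
    have yr: "1 / r = y" by (simp add: y_def)
    show "\<mu> / (1 - y) \<le> 1/4" using l2 \<mu>8 y unfolding yr by linarith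
    have "(\<mu> / (1 - y))\<^sup>2 * (1 + 4 * (\<mu> / (1 - y))) * (D + h)
       \<le> (\<mu> * (1 + 13/12 * y))\<^sup>2 * (1 + y) * (D * (1 + y))"
    proof (intro mult_mono power_mono)
      show "\<mu> / (1 - y) \<le> \<mu> * (1 + 13/12 * y)" using mult_left_mono[OF q', of \<mu>] \<mu>0 by simp
      show "1 + 4 * (\<mu> / (1 - y)) \<le> 1 + y" using l2 \<mu>8 unfolding yr by linarith
      have "h = D * (1/512 * y\<^sup>2)" by (simp add: h_def y_def power_divide)
      also have "\<dots> \<le> D * y" using D0 y2 y by (intro mult_left_mono) auto
      finally show "D + h \<le> D * (1 + y)" by (simp add: algebra_simps)
    qed (use \<mu>0 y D0 h0 in auto)
    also have "\<dots> = \<beta> / 2 * ((1 + 13/12 * y)\<^sup>2 * (1 + y)\<^sup>2)"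
      using D0 by (simp add: power_mult_distrib \<mu>2) (simp add: power2_eq_square)
    also have "\<dots> \<le> \<beta> / 2 * (1 + 8 * y)"
    proof (intro mult_left_mono)
      have "(1 + 13/12 * y) * (1 + y) \<le> 1 + 3 * y" using y y2 by (simp add: algebra_simps power2_eq_square)
      then have "((1 + 13/12 * y) * (1 + y))\<^sup>2 \<le> (1 + 3 * y)\<^sup>2" using y by (intro power_mono) auto
      also have "\<dots> \<le> 1 + 8 * y" using y y2 by (simp add: power2_eq_square algebra_simps)
      finally show "(1 + 13/12 * y)\<^sup>2 * (1 + y)\<^sup>2 \<le> 1 + 8 * y" by (simp only: power_mult_distrib)
    qed (use \<beta>1 r in auto)
    also have "\<dots> \<le> B"
    proof -
      have "\<beta> * y \<le> 5" using \<beta>5 r by (simp add: y_def field_simps)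
      then show ?thesis by (simp add: B_def algebra_simps)
    qed
    finally show "(\<mu> / (1 - y))\<^sup>2 * (1 + 4 * (\<mu> / (1 - y))) * (D + h) \<le> B" .
    show "2 * \<mu> / y * sqrt (sqrt h) \<le> 1/4"
    proof (rule power2_le_imp_le, rule power2_le_imp_le)
      have "((2 * \<mu> / y * sqrt (sqrt h))\<^sup>2)\<^sup>2 = 16 * (\<mu>\<^sup>2)\<^sup>2 * r ^ 4 * h"
      proof -
        have "(sqrt (sqrt h) ^ 2)^2 = h" using h0 by simp
        moreover have "((2 * \<mu> / y * sqrt (sqrt h))\<^sup>2)\<^sup>2 = 16 * (\<mu>\<^sup>2)\<^sup>2 * r ^ 4 * (sqrt (sqrt h) ^ 2)^2"
          by (simp add: y_def power_mult_distrib flip: power_mult)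
        ultimately show ?thesis by simp
      qed
      also have "\<dots> = 1/128 * (\<beta> * \<beta> * r\<^sup>2 / D)"
        unfolding \<mu>2 h_def using D0 r by (simp add: power2_eq_square field_simps power4_eq_xxxx)
      also have "\<dots> \<le> 1/128 * ((5 * r) * (5 * r) * r\<^sup>2 / (160 * r ^ 4))"
        using \<beta>5 \<beta>1 D4 D0 r by (intro mult_left_mono frac_le mult_mono) auto
      also have "\<dots> \<le> 1/256" using r by (simp add: power2_eq_square power4_eq_xxxx)
      finally show "((2 * \<mu> / y * sqrt (sqrt h))\<^sup>2)\<^sup>2 \<le> ((1/4)\<^sup>2)\<^sup>2" by (simp add: power2_eq_square)
    qed auto
    have "8 * \<mu>\<^sup>2 * h / y\<^sup>2 = \<beta> / 128" using D0 r by (simp add: \<mu>2 h_def y_def field_simps)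
    also have "\<dots> \<le> B" using \<beta>1 r by (simp add: B_def)
    finally show "8 * \<mu>\<^sup>2 * h / y\<^sup>2 \<le> B" .
  qed (use h0 \<mu>0 eta in auto)
  have "\<mu> * ((1 + gain) * sqrt (2 * D * \<beta>)) = (1 + gain) * \<beta>"
  proof -
    have "sqrt (\<beta> / (2 * D)) * sqrt (2 * D * \<beta>) = sqrt (\<beta>\<^sup>2)"
      using D0 unfolding real_sqrt_mult[symmetric] by (simp add: power2_eq_square)
    then show ?thesis using \<beta>1 r by (simp add: \<mu>_def)
  qed
  then have "2 * exp 8 * exp B / \<mu> * exp (- \<mu> * ((1 + gain) * sqrt (2 * D * \<beta>)))
     = 2 * exp 8 * exp B * exp (- (1 + gain) * \<beta>) * (1 / \<mu>)" by (simp only: mult_minus_left) simp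
  also have "2 * exp 8 * exp B * exp (- (1 + gain) * \<beta>) = 2 * exp 28 * (exp (- \<beta> / 2) * exp (- gain * \<beta>))"
    by (simp add: B_def algebra_simps flip: exp_add)
  also have "2 * exp 28 * (exp (- \<beta> / 2) * exp (- gain * \<beta>)) * (1 / \<mu>)
     \<le> 2 * exp 28 * (exp (- \<beta> / 2) * exp (- gain * r)) * (3 * sqrt d0 * exp (r / 2))"
  proof (intro mult_mono)
    show "exp (- gain * \<beta>) \<le> exp (- gain * r)" using gain \<beta>1 by (simp add: mult_left_mono)
    have "1 / \<mu> = sqrt (2 * D / \<beta>)" by (simp add: \<mu>_def real_sqrt_divide)
    also have "\<dots> \<le> sqrt ((3 * sqrt d0 * exp (r / 2))\<^sup>2)"
    proof (rule real_sqrt_le_mono)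
      have "2 * D / \<beta> \<le> 2 * D / 1" using D0 \<beta>1 r by (intro divide_left_mono) auto
      also have "\<dots> \<le> 2 * (d0 * (exp r * 3))"
        using D(2) exp_le d0 by (simp add: r_def exp_add mult_left_mono order_trans[OF D(2)])
      also have "\<dots> \<le> 9 * d0 * exp r" using d0 by simp
      also have "\<dots> = (3 * sqrt d0 * exp (r / 2))\<^sup>2"
        using d0 by (simp add: power_mult_distrib flip: exp_double)
      finally show "2 * D / \<beta> \<le> (3 * sqrt d0 * exp (r / 2))\<^sup>2" .
    qed
    also have "\<dots> = 3 * sqrt d0 * exp (r / 2)" using d0 by simp
    finally show "1 / \<mu> \<le> 3 * sqrt d0 * exp (r / 2)" .
  qed (use \<mu>0 d0 in auto)
  also have "\<dots> = 6 * exp 28 * sqrt d0 * (\<epsilon>\<^sup>2 / r) * exp (- gain * r)"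
    unfolding e\<beta> by (simp add: exp_minus field_simps)
  finally have "2 * exp 8 * exp B / \<mu> * exp (- \<mu> * ((1 + gain) * sqrt (2 * D * \<beta>)))
     \<le> 6 * exp 28 * sqrt d0 * (\<epsilon>\<^sup>2 / r) * exp (- gain * r)" .
  then show ?thesis using block unfolding h_def r_def
    by (intro majorised_mono[OF block[unfolded h_def r_def]] add_mono) auto
qed

end

lemma sum_arith_geometric_le:
  assumes "0 < gain" "gain \<le> 1"
  shows "(\<Sum>j<N. real j * exp (- gain * real j)) \<le> 4 / gain\<^sup>2"
proof -
  define z where "z = exp (- gain)"
  have z: "0 < z" "z < 1" using assms by (auto simp: z_def)
  have zg: "gain / 2 \<le> 1 - z"
  proof -
    have "1 + gain \<le> exp gain" by (rule exp_ge_add_one_self)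
    then have "z \<le> 1 / (1 + gain)" using assms by (simp add: z_def exp_minus field_simps)
    moreover have "gain / 2 \<le> gain / (1 + gain)" using assms by (intro divide_left_mono) auto
    moreover have "1 - 1 / (1 + gain) = gain / (1 + gain)" using assms by (simp add: field_simps)
    ultimately show ?thesis by linarith
  qed
  have zj: "exp (- gain * real j) = z ^ j" for j by (simp add: z_def mult.commute flip: exp_of_nat_mult)
  have S: "(\<lambda>j. real (Suc j) * z ^ j) sums (1 / (1 - z)\<^sup>2)"
    using geometric_deriv_sums[of z] z by simp
  have "(\<Sum>j<N. real j * exp (- gain * real j)) \<le> (\<Sum>j<N. real (Suc j) * z ^ j)"
    unfolding zj using z by (intro sum_mono mult_right_mono) auto
  also have "\<dots> \<le> 1 / (1 - z)\<^sup>2"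
    using z sum_le_suminf[OF sums_summable[OF S], of "{..<N}"] sums_unique[OF S] by simp
  also have "\<dots> \<le> 1 / (gain / 2)\<^sup>2"
    using zg assms z by (intro divide_left_mono power_mono) auto
  finally show ?thesis by (simp add: power_divide)
qed

text \<open>The penalty without its factor \<open>1 + \<epsilon>\<close>, as a function of the energies.\<close>

definition base_penalty :: "real \<Rightarrow> real \<Rightarrow> real \<Rightarrow> real" where
  "base_penalty \<epsilon> d0 t = (if t \<le> d0 \<or> penalty_braces \<epsilon> (t / d0) < 0 then 0
     else sqrt (2 * t) * sqrt (penalty_braces \<epsilon> (t / d0)))"

lemma base_penalty_nonneg: "0 < d0 \<Longrightarrow> 0 \<le> base_penalty \<epsilon> d0 t"
  by (auto simp: base_penalty_def)

text \<open>Only the part \<open>j + 2 ln (j / \<epsilon>^2)\<close> of the braces is needed: the constant \<open>Q_const \<ge> 1\<close> and the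
  exponent \<open>1 + \<epsilon> \<ge> 1\<close> leave room.\<close>

lemma base_penalty_ge:
  fixes d0 D t \<epsilon> :: real and j :: nat
  assumes d0: "0 < d0" and j: "1 \<le> j" and eps: "0 < \<epsilon>" "\<epsilon> \<le> 1"
    and D: "d0 * exp (real j) \<le> D" "D \<le> t"
  shows "sqrt (2 * D * (real j + 2 * ln (real j / \<epsilon>\<^sup>2))) \<le> base_penalty \<epsilon> d0 t"
proof -
  have e2: "0 < \<epsilon>\<^sup>2" "\<epsilon>\<^sup>2 \<le> 1" using eps by (auto simp: power_le_one)
  have j1: "1 \<le> real j" using j by simp
  have D0: "0 < D" using D(1) d0 by (smt (verit) exp_gt_zero mult_pos_pos)
  have t: "d0 * exp (real j) \<le> t" using D by simp
  have l: "real j \<le> ln (t / d0)"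
  proof -
    have "exp (real j) \<le> t / d0" using t d0 by (simp add: field_simps)
    then have "ln (exp (real j)) \<le> ln (t / d0)" by (subst ln_le_cancel_iff) (auto intro: less_le_trans[OF exp_gt_zero])
    then show ?thesis by simp
  qed
  have Q: "1 \<le> Q_const"
  proof -
    have "sqrt 2 \<le> 2" by (rule real_le_lsqrt) auto
    moreover have "sqrt 2 > (1::real)" by simp
    ultimately have "(sqrt 2 - 1)\<^sup>2 \<le> 1" "0 < (sqrt 2 - 1 :: real)\<^sup>2" by (auto simp: power_le_one)
    then show ?thesis by (simp add: Q_const_def field_simps)
  qed
  have je: "1 \<le> real j / \<epsilon>\<^sup>2" using e2 j1 by (simp add: field_simps)
  have "real j / \<epsilon>\<^sup>2 = 1 / \<epsilon>\<^sup>2 * real j" by simp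
  also have "\<dots> \<le> Q_const / \<epsilon>\<^sup>2 * ln (t / d0)"
    using Q l j1 e2 by (intro mult_mono divide_right_mono) auto
  finally have "real j / \<epsilon>\<^sup>2 \<le> Q_const / \<epsilon>\<^sup>2 * ln (t / d0)" .
  then have ll: "ln (real j / \<epsilon>\<^sup>2) \<le> ln (Q_const / \<epsilon>\<^sup>2 * ln (t / d0))"
    using je by (subst ln_le_cancel_iff) auto
  have lj: "0 \<le> ln (real j / \<epsilon>\<^sup>2)" using je by simp
  have "2 * ln (real j / \<epsilon>\<^sup>2) \<le> 2 * (1 + \<epsilon>) * ln (Q_const / \<epsilon>\<^sup>2 * ln (t / d0))"
    using ll lj eps by (intro mult_mono) auto
  then have b: "real j + 2 * ln (real j / \<epsilon>\<^sup>2) \<le> penalty_braces \<epsilon> (t / d0)"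
    using l by (simp add: penalty_braces_def)
  have td: "\<not> t \<le> d0"
  proof -
    have "d0 * 1 < d0 * exp (real j)" using d0 j by (intro mult_strict_left_mono) auto
    then show ?thesis using t by simp
  qed
  have "sqrt (2 * D * (real j + 2 * ln (real j / \<epsilon>\<^sup>2))) \<le> sqrt (2 * t * penalty_braces \<epsilon> (t / d0))"
    using b D D0 lj j1 by (intro real_sqrt_le_mono mult_mono) auto
  also have "\<dots> = base_penalty \<epsilon> d0 t" using td b lj j1 by (simp add: base_penalty_def real_sqrt_mult)
  finally show ?thesis .
qed

definition quadratic_sup_const :: real where
  "quadratic_sup_const = 32 * exp 22 + 2 + 1572864 * exp 28"

context weight_chain
begin

text \<open>Levels below \<open>d0 exp J\<close>, with \<open>exp J\<close> of the order of \<open>1 / \<epsilon>^2\<close>, cost \<open>sqrt d0 / \<epsilon>\<close>.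
  Above, level \<open>j\<close> consists of \<open>1024 j^2\<close> blocks of equal logarithmic width, and the sum of their
  contributions is at most the order of \<open>\<epsilon>^2 / gain^2 \<le> 64 / \<delta>\<close> by
  \<open>4 \<epsilon>^2 \<delta> \<le> (\<epsilon>^2 + \<delta>)^2\<close>.\<close>

lemma quadratic_process_sup_bound:
  assumes d0: "5 \<le> d0" and eps: "0 < \<epsilon>" "\<epsilon> \<le> 1" and del: "0 < \<delta>" "\<delta> \<le> \<epsilon>"
    and gain: "gain = (\<epsilon>\<^sup>2 + \<delta>) / 16"
  shows "majorised (noise_law n) I
      (\<lambda>a x. noise_form a x - (1 + gain) * base_penalty \<epsilon> d0 (energy a))
      (quadratic_sup_const * (sqrt d0 / \<delta>))"
proof -
  have e2: "0 < \<epsilon>\<^sup>2" "\<epsilon>\<^sup>2 \<le> 1" using eps by (auto simp: power_le_one)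
  have "0 < \<epsilon>\<^sup>2 + \<delta>" "\<epsilon>\<^sup>2 + \<delta> \<le> 2" using e2 del eps by linarith+
  then have gain0: "0 < gain" "gain \<le> 1" by (simp_all add: gain)
  define J where "J = 24 + nat \<lceil>ln (1 / \<epsilon>\<^sup>2)\<rceil>"
  have lnpos: "0 \<le> ln (1 / \<epsilon>\<^sup>2)" using e2 by simp
  have J: "24 \<le> J" "ln (1 / \<epsilon>\<^sup>2) \<le> real J" "real J \<le> 25 + ln (1 / \<epsilon>\<^sup>2)"
    using lnpos unfolding J_def by linarith+
  have Je: "1 / \<epsilon>\<^sup>2 \<le> exp (real J)"
    using J(2) e2 by (metis exp_le_cancel_iff exp_ln zero_less_divide_1_iff)
  have eJ: "exp (real J) \<le> exp 25 * (1 / \<epsilon>\<^sup>2)"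
  proof -
    have "exp (real J) \<le> exp (25 + ln (1 / \<epsilon>\<^sup>2))" using J(3) by simp
    also have "\<dots> = exp 25 * (1 / \<epsilon>\<^sup>2)" using e2 by (simp only: exp_add exp_ln zero_less_divide_1_iff)
    finally show ?thesis .
  qed
  define h where "h = d0 * exp (real J)"
  have h1: "1 \<le> h"
  proof -
    have "1 * 1 \<le> d0 * exp (real J)" using d0 by (intro mult_mono) auto
    then show ?thesis by (simp add: h_def)
  qed
  let ?F = "\<lambda>a x. noise_form a x - (1 + gain) * base_penalty \<epsilon> d0 (energy a)"
  have pn: "0 \<le> (1 + gain) * base_penalty \<epsilon> d0 t" for t using gain0 base_penalty_nonneg[of d0 \<epsilon> t] d0 by simp
  have below: "majorised (noise_law n) {a\<in>I. energy a < h} ?F (32 * exp 9 * sqrt h + 1)"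
    by (rule majorised_mono[OF low_bound[OF h1]]) (use pn in auto)
  \<comment> \<open>Levels \<open>j > n\<close> are empty, because energies do not exceed \<open>n\<close>.\<close>
  define S where "S = (SIGMA j:{J..n}. {..<1024 * j\<^sup>2})"
  have finS: "finite S" by (simp add: S_def)
  define \<eta> where "\<eta> = 1 / (real (card S) + 1)"
  have \<eta>0: "0 < \<eta>" by (simp add: \<eta>_def)
  have \<eta>S: "real (card S) * \<eta> \<le> 1" by (simp add: \<eta>_def)
  define Dl where "Dl q = d0 * exp (real (fst q) + real (snd q) / (1024 * (real (fst q))\<^sup>2))" for q :: "nat \<times> nat"
  define \<beta> where "\<beta> j = real j + 2 * ln (real j / \<epsilon>\<^sup>2)" for j :: nat
  define cell where "cell q = {a\<in>I. Dl q \<le> energy a \<and> energy a < Dl q + 2 * Dl q / (1024 * (real (fst q))\<^sup>2)}" for q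
  define K where "K q = 6 * exp 28 * sqrt d0 * (\<epsilon>\<^sup>2 / real (fst q)) * exp (- gain * real (fst q))" for q :: "nat \<times> nat"
  have block: "majorised (noise_law n) (cell q) ?F (K q + \<eta>)" if q: "q \<in> S" for q
  proof -
    have j: "24 \<le> fst q" "J \<le> fst q" using q J by (auto simp: S_def)
    have "real (snd q) < real (1024 * (fst q)\<^sup>2)" using q unfolding S_def by (subst of_nat_less_iff) auto
    then have frac: "real (snd q) / (1024 * (real (fst q))\<^sup>2) \<le> 1" using j by simp
    have Dl0: "d0 * exp (real (fst q)) \<le> Dl q" using d0 by (simp add: Dl_def)
    have "majorised (noise_law n) (cell q) (\<lambda>a x. noise_form a x - (1 + gain) * sqrt (2 * Dl q * \<beta> (fst q))) (K q + \<eta>)"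
      unfolding \<beta>_def cell_def K_def
    proof (rule high_block_bound[OF d0 j(1) eps _ Dl0])
      show "1 / \<epsilon>\<^sup>2 \<le> exp (real (fst q))" using Je j(2) by (meson exp_le_cancel_iff of_nat_le_iff order_trans)
      show "Dl q \<le> d0 * exp (real (fst q) + 1)" using d0 frac by (simp add: Dl_def)
    qed (use gain0 \<eta>0 in auto)
    then show ?thesis
    proof (rule majorised_mono)
      fix a x assume a: "a \<in> cell q"
      have "(1 + gain) * sqrt (2 * Dl q * \<beta> (fst q)) \<le> (1 + gain) * base_penalty \<epsilon> d0 (energy a)"
        unfolding \<beta>_def
        by (intro mult_left_mono base_penalty_ge[OF _ _ eps Dl0]) (use d0 j a gain0 in \<open>auto simp: cell_def\<close>)
      then show "?F a x \<le> noise_form a x - (1 + gain) * sqrt (2 * Dl q * \<beta> (fst q))" by simp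
    qed auto
  qed
  have sd: "1 \<le> sqrt d0 / \<delta>"
  proof -
    have "\<delta> \<le> 1" "1 \<le> sqrt d0" using del eps d0 by auto
    then have "\<delta> \<le> sqrt d0" by linarith
    then show ?thesis using del by simp
  qed
  have low: "32 * exp 9 * sqrt h \<le> 32 * exp 22 * (sqrt d0 / \<delta>)"
  proof -
    have "h \<le> d0 * (exp 25 * (1 / \<epsilon>\<^sup>2))" unfolding h_def using eJ d0 by (intro mult_left_mono) auto
    also have "\<dots> \<le> d0 * (exp 26 * (1 / \<epsilon>\<^sup>2))" using d0 e2 by (intro mult_left_mono mult_right_mono) auto
    also have "\<dots> = (sqrt d0 * exp 13 / \<epsilon>)\<^sup>2"
      using d0 exp_double[of "13::real"] by (simp add: power_mult_distrib power_divide)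
    finally have "sqrt h \<le> sqrt ((sqrt d0 * exp 13 / \<epsilon>)\<^sup>2)" by (rule real_sqrt_le_mono)
    also have "\<dots> = exp 13 * (sqrt d0 / \<epsilon>)" using d0 eps by simp
    also have "\<dots> \<le> exp 13 * (sqrt d0 / \<delta>)" using d0 del by (intro mult_left_mono divide_left_mono) auto
    finally have "32 * exp 9 * sqrt h \<le> 32 * exp 9 * (exp 13 * (sqrt d0 / \<delta>))" by (intro mult_left_mono) auto
    also have "\<dots> = 32 * exp 22 * (sqrt d0 / \<delta>)" using exp_add[of 9 "13::real"] by simp
    finally show ?thesis .
  qed
  have high: "(\<Sum>q\<in>S. K q)
     \<le> 1572864 * exp 28 * (sqrt d0 / \<delta>)"
  proof -
    have "(\<Sum>q\<in>S. K q)
      = (\<Sum>j=J..n. \<Sum>i<1024 * j\<^sup>2. 6 * exp 28 * sqrt d0 * (\<epsilon>\<^sup>2 / real j) * exp (- gain * real j))"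
      unfolding S_def K_def by (subst sum.Sigma) (auto simp: case_prod_beta)
    also have "\<dots> = (\<Sum>j=J..n. 6144 * exp 28 * sqrt d0 * \<epsilon>\<^sup>2 * (real j * exp (- gain * real j)))"
      using J by (intro sum.cong refl) (simp add: power2_eq_square)
    also have "\<dots> \<le> (\<Sum>j<Suc n. 6144 * exp 28 * sqrt d0 * \<epsilon>\<^sup>2 * (real j * exp (- gain * real j)))"
      using d0 by (intro sum_mono2) auto
    also have "\<dots> = 6144 * exp 28 * sqrt d0 * \<epsilon>\<^sup>2 * (\<Sum>j<Suc n. real j * exp (- gain * real j))"
      by (simp only: sum_distrib_left)
    also have "\<dots> \<le> 6144 * exp 28 * sqrt d0 * \<epsilon>\<^sup>2 * (4 / gain\<^sup>2)"
      using sum_arith_geometric_le[OF gain0, of "Suc n"] d0 by (intro mult_left_mono) auto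
    also have "\<dots> = 6144 * exp 28 * sqrt d0 * (4 * (\<epsilon>\<^sup>2 / gain\<^sup>2))" by simp
    also have "\<dots> \<le> 6144 * exp 28 * sqrt d0 * (4 * (64 / \<delta>))"
    proof (intro mult_left_mono)
      have "0 \<le> (\<epsilon>\<^sup>2 - \<delta>)\<^sup>2" by simp
      then have "\<epsilon>\<^sup>2 * \<delta> \<le> 64 * gain\<^sup>2" unfolding gain
        by (simp add: power_divide power2_eq_square algebra_simps)
      then show "\<epsilon>\<^sup>2 / gain\<^sup>2 \<le> 64 / \<delta>" using gain0 del by (simp add: field_simps)
    qed (use d0 in auto)
    finally show ?thesis by simp
  qed
  have cover: "\<exists>q\<in>S. a \<in> cell q" if a: "a \<in> I" and "\<not> energy a < h" for a
  proof -
    have dh: "d0 * exp (real J) \<le> energy a" using that(2) by (simp add: h_def)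
    define s where "s = ln (energy a / d0)"
    have dpos: "0 < energy a" using that(2) h1 by linarith
    have s: "energy a = d0 * exp s" using d0 dpos by (simp add: s_def)
    have sJ: "real J \<le> s" using dh d0 unfolding s by simp
    define j where "j = nat \<lfloor>s\<rfloor>"
    have j: "real j \<le> s" "s < real j + 1" "J \<le> j"
      using sJ J unfolding j_def by (linarith, linarith, simp add: le_nat_floor)
    have j24: "24 \<le> j" using j(3) J by simp
    define M where "M = 1024 * (real j)\<^sup>2"
    have M: "1 \<le> M" using j24 unfolding M_def by (simp add: mult_ge1_I)
    define i where "i = nat \<lfloor>(s - real j) * M\<rfloor>"
    have sm0: "0 \<le> (s - real j) * M" using j M by simp
    have i: "real i \<le> (s - real j) * M" "(s - real j) * M < real i + 1"
      using sm0 unfolding i_def by linarith+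
    have "(s - real j) * M < 1 * M" using j M by (intro mult_strict_right_mono) auto
    then have "real i < M" using i by linarith
    also have "M = real (1024 * j\<^sup>2)" by (simp add: M_def)
    finally have iM: "i < 1024 * j\<^sup>2" by (simp only: of_nat_less_iff)
    have jn: "j \<le> n"
    proof -
      have "real j \<le> exp (real j)" using exp_ge_add_one_self[of "real j"] by linarith
      also have "\<dots> \<le> d0 * exp (real j)" using d0 by simp
      also have "\<dots> \<le> energy a" unfolding s using j d0 by simp
      also have "\<dots> \<le> real n" by (rule energy_le[OF a])
      finally show ?thesis by simp
    qed
    have q: "(j, i) \<in> S" using j(3) jn iM by (simp add: S_def)
    have Dl: "Dl (j, i) = d0 * exp (real j + real i / M)" by (simp add: Dl_def M_def)
    have iM1: "real i / M \<le> s - real j" "s - real j < real i / M + 1 / M"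
      using i M by (simp_all add: field_simps)
    have D1: "Dl (j, i) \<le> energy a" unfolding Dl s using d0 iM1 by simp
    have D2: "energy a < Dl (j, i) + 2 * Dl (j, i) / M"
    proof -
      have "energy a < d0 * exp (real j + real i / M + 1 / M)" unfolding s using d0 iM1 by simp
      also have "\<dots> = Dl (j, i) * exp (1 / M)" by (simp add: Dl exp_add)
      also have "\<dots> \<le> Dl (j, i) * (1 + 2 * (1 / M))"
      proof (rule mult_left_mono)
        have "exp (1 / M) \<le> 1 + 1 / M + (1 / M)\<^sup>2" using M by (intro exp_bound) auto
        also have "(1 / M)\<^sup>2 \<le> 1 / M" using M by (simp add: power2_eq_square field_simps)
        finally show "exp (1 / M) \<le> 1 + 2 * (1 / M)" by simp
      qed (use d0 in \<open>simp add: Dl\<close>)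
      finally show ?thesis by (simp add: algebra_simps)
    qed
    show ?thesis using q a D1 D2 by (intro bexI[of _ "(j, i)"]) (auto simp: cell_def M_def)
  qed
  let ?I = "\<lambda>t. case t of None \<Rightarrow> {a\<in>I. energy a < h} | Some q \<Rightarrow> cell q"
  let ?K = "\<lambda>t. case t of None \<Rightarrow> 32 * exp 9 * sqrt h + 1 | Some q \<Rightarrow> K q + \<eta>"
  have "majorised (noise_law n) (\<Union>t\<in>insert None (Some ` S). ?I t) ?F (\<Sum>t\<in>insert None (Some ` S). ?K t)"
    by (rule majorised_UN) (use finS below block in auto)
  then show ?thesis
  proof (rule majorised_mono)
    show "I \<subseteq> (\<Union>t\<in>insert None (Some ` S). ?I t)" using cover by auto
    have "(\<Sum>t\<in>insert None (Some ` S). ?K t) = (32 * exp 9 * sqrt h + 1) + (\<Sum>q\<in>S. K q + \<eta>)"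
      using finS by (subst sum.insert) (auto simp: sum.reindex)
    also have "\<dots> = (32 * exp 9 * sqrt h + 1) + (\<Sum>q\<in>S. K q) + real (card S) * \<eta>"
      by (simp add: sum.distrib)
    also have "\<dots> \<le> 32 * exp 22 * (sqrt d0 / \<delta>) + 1 + 1572864 * exp 28 * (sqrt d0 / \<delta>) + 1"
      by (intro add_mono low high \<eta>S order_refl)
    also have "\<dots> \<le> quadratic_sup_const * (sqrt d0 / \<delta>)"
      using sd by (simp only: quadratic_sup_const_def distrib_right)
    finally show "(\<Sum>t\<in>insert None (Some ` S). ?K t) \<le> quadratic_sup_const * (sqrt d0 / \<delta>)" .
  qed auto
qed

end

section \<open>The regression model in its singular basis\<close>

locale regression_model =
  fixes n p :: nat and X :: "real mat" and \<beta> :: "real vec" and \<sigma> :: real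
    and lam :: "nat \<Rightarrow> real" and e :: "nat \<Rightarrow> real vec" and H :: "real \<Rightarrow> real \<Rightarrow> real"
  assumes pn: "p \<le> n" and X: "X \<in> carrier_mat n p" and inv: "invertible_mat (gram X)"
    and \<beta>: "\<beta> \<in> carrier_vec p" and \<sigma>: "0 < \<sigma>"
    and eig: "pos_eigensystem (gram X) lam e" and H: "ordered_family H"
begin

definition u :: "nat \<Rightarrow> nat \<Rightarrow> real" where
  "u k i = vec_index (X *\<^sub>v e k) i / sqrt (lam k)"

definition b :: "nat \<Rightarrow> real" where
  "b k = sqrt (lam k) * scalar_prod \<beta> (e k)"

lemma gram_carrier: "gram X \<in> carrier_mat p p"
  using X by (auto simp: gram_def)

lemma e_carrier: "k < p \<Longrightarrow> e k \<in> carrier_vec p"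
  and lam_pos: "k < p \<Longrightarrow> 0 < lam k"
  and gram_e: "k < p \<Longrightarrow> gram X *\<^sub>v e k = lam k \<cdot>\<^sub>v e k"
  and e_orth: "j < p \<Longrightarrow> k < p \<Longrightarrow> scalar_prod (e j) (e k) = (if j = k then 1 else 0)"
  and lam_0: "p \<le> k \<Longrightarrow> lam k = 0"
  using eig gram_carrier by (auto simp: pos_eigensystem_def eigenvector_def)

lemma scalar_prod_gram:
  assumes v: "v \<in> carrier_vec p" and w: "w \<in> carrier_vec p"
  shows "scalar_prod (X *\<^sub>v v) (X *\<^sub>v w) = scalar_prod v (gram X *\<^sub>v w)"
proof -
  have "gram X *\<^sub>v w = transpose_mat X *\<^sub>v (X *\<^sub>v w)"
    unfolding gram_def using X w by (intro assoc_mult_mat_vec[of _ p n _ p]) auto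
  moreover have "scalar_prod (transpose_mat X *\<^sub>v (X *\<^sub>v w)) v = scalar_prod (X *\<^sub>v w) (X *\<^sub>v v)"
    using transpose_vec_mult_scalar[OF X v, of "X *\<^sub>v w"] X w by auto
  moreover have "scalar_prod (transpose_mat X *\<^sub>v (X *\<^sub>v w)) v = scalar_prod v (transpose_mat X *\<^sub>v (X *\<^sub>v w))"
    using X w v by (intro comm_scalar_prod[of _ p]) auto
  moreover have "scalar_prod (X *\<^sub>v w) (X *\<^sub>v v) = scalar_prod (X *\<^sub>v v) (X *\<^sub>v w)"
    using X w v by (intro comm_scalar_prod[of _ n]) auto
  ultimately show ?thesis by simp
qed

lemma scalar_prod_sum: "v \<in> carrier_vec m \<Longrightarrow> w \<in> carrier_vec m \<Longrightarrow>
    scalar_prod v w = (\<Sum>i<m. vec_index v i * vec_index w i)" for v w :: "real vec"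
  by (auto simp: scalar_prod_def atLeast0LessThan)

lemma Xv_index:
  assumes v: "v \<in> carrier_vec p" and i: "i < n"
  shows "vec_index (X *\<^sub>v v) i = (\<Sum>j<p. X $$ (i, j) * vec_index v j)"
  using X v i by (auto simp: mult_mat_vec_def scalar_prod_def atLeast0LessThan)

lemma Xe_scalar:
  assumes k: "k < p" and v: "v \<in> carrier_vec p"
  shows "(\<Sum>i<n. u k i * vec_index (X *\<^sub>v v) i) = sqrt (lam k) * scalar_prod v (e k)"
proof -
  have "(\<Sum>i<n. u k i * vec_index (X *\<^sub>v v) i) = scalar_prod (X *\<^sub>v v) (X *\<^sub>v e k) / sqrt (lam k)"
    using X v e_carrier[OF k] by (subst scalar_prod_sum[of _ n]) (auto simp: u_def sum_divide_distrib mult.commute)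
  also have "scalar_prod (X *\<^sub>v v) (X *\<^sub>v e k) = lam k * scalar_prod v (e k)"
    using v e_carrier[OF k] by (simp add: scalar_prod_gram gram_e[OF k])
  also have "\<dots> / sqrt (lam k) = sqrt (lam k) * scalar_prod v (e k)"
    using lam_pos[OF k] by (simp add: real_div_sqrt divide_simps)
  finally show ?thesis .
qed

lemma u_orthonormal: "orthonormal n p u"
  unfolding orthonormal_def
proof (intro allI impI)
  fix j k assume j: "j < p" and k: "k < p"
  have "(\<Sum>i<n. u j i * u k i) = (\<Sum>i<n. u j i * vec_index (X *\<^sub>v e k) i) / sqrt (lam k)"
    by (simp add: u_def[of k] sum_divide_distrib)
  also have "\<dots> = sqrt (lam j) * scalar_prod (e k) (e j) / sqrt (lam k)"
    by (simp add: Xe_scalar[OF j e_carrier[OF k]])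
  also have "\<dots> = (if j = k then 1 else 0)"
    using lam_pos[OF k] by (auto simp: e_orth[OF k j])
  finally show "(\<Sum>i<n. u j i * u k i) = (if j = k then 1 else 0)" .
qed

text \<open>A square matrix with orthonormal columns has orthonormal rows.\<close>

lemma e_complete:
  assumes i: "i < p" and j: "j < p"
  shows "(\<Sum>k<p. vec_index (e k) i * vec_index (e k) j) = (if i = j then 1 else 0)"
proof -
  define E where "E = Matrix.mat p p (\<lambda>(i, k). vec_index (e k) i)"
  have E: "E \<in> carrier_mat p p" by (simp add: E_def)
  have "transpose_mat E * E = 1\<^sub>m p"
  proof (rule eq_matI)
    fix a c assume "a < dim_row (1\<^sub>m p)" "c < dim_col (1\<^sub>m p)"
    then have a: "a < p" and c: "c < p" by auto
    have "(transpose_mat E * E) $$ (a, c) = (\<Sum>i<p. vec_index (e a) i * vec_index (e c) i)"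
      using a c by (simp add: E_def scalar_prod_def atLeast0LessThan)
    also have "\<dots> = scalar_prod (e a) (e c)"
      using e_carrier[OF a] e_carrier[OF c] by (simp add: scalar_prod_sum)
    finally show "(transpose_mat E * E) $$ (a, c) = 1\<^sub>m p $$ (a, c)" using a c by (simp add: e_orth)
  qed (use E in auto)
  then have "E * transpose_mat E = 1\<^sub>m p" using E mat_mult_left_right_inverse[of "transpose_mat E" p E] by simp
  then have "(E * transpose_mat E) $$ (i, j) = 1\<^sub>m p $$ (i, j)" by simp
  then show ?thesis using i j by (simp add: E_def scalar_prod_def atLeast0LessThan)
qed

lemma X\<beta>_index:
  assumes i: "i < n"
  shows "vec_index (X *\<^sub>v \<beta>) i = (\<Sum>k<p. b k * u k i)"
proof -
  have exp: "vec_index \<beta> j = (\<Sum>k<p. vec_index (e k) j * scalar_prod \<beta> (e k))" if j: "j < p" for j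
  proof -
    have "(\<Sum>k<p. vec_index (e k) j * scalar_prod \<beta> (e k))
        = (\<Sum>k<p. \<Sum>l<p. vec_index \<beta> l * (vec_index (e k) j * vec_index (e k) l))"
      using e_carrier \<beta> by (intro sum.cong refl) (simp add: scalar_prod_sum[of _ p] sum_distrib_left mult_ac)
    also have "\<dots> = (\<Sum>l<p. vec_index \<beta> l * (\<Sum>k<p. vec_index (e k) j * vec_index (e k) l))"
      unfolding sum_distrib_left by (rule sum.swap)
    also have "\<dots> = (\<Sum>l<p. vec_index \<beta> l * (if j = l then 1 else 0))"
      using j by (intro sum.cong refl) (simp add: e_complete)
    also have "\<dots> = vec_index \<beta> j" using j by (simp add: if_distrib cong: if_cong)
    finally show ?thesis by simp
  qed
  have "vec_index (X *\<^sub>v \<beta>) i = (\<Sum>j<p. \<Sum>k<p. X $$ (i, j) * (vec_index (e k) j * scalar_prod \<beta> (e k)))"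
    unfolding Xv_index[OF \<beta> i] sum_distrib_left[symmetric] by (intro sum.cong refl) (simp add: exp)
  also have "\<dots> = (\<Sum>k<p. \<Sum>j<p. X $$ (i, j) * (vec_index (e k) j * scalar_prod \<beta> (e k)))"
    by (rule sum.swap)
  also have "\<dots> = (\<Sum>k<p. vec_index (X *\<^sub>v e k) i * scalar_prod \<beta> (e k))"
    using e_carrier i by (intro sum.cong refl) (simp add: Xv_index sum_distrib_left sum_distrib_right mult_ac)
  also have "\<dots> = (\<Sum>k<p. b k * u k i)"
    using lam_pos by (intro sum.cong refl) (force simp: b_def u_def)
  finally show ?thesis .
qed

text \<open>In the singular basis the estimator shrinks the k-th coordinate of the data by \<open>H \<alpha> (lam k)\<close>; the
  inverse of the Gram matrix is evaluated through the symmetry of \<open>X\<^sup>T X\<close> alone.\<close>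

lemma X\<beta>_hat_index:
  assumes Y: "Y \<in> carrier_vec n" and i: "i < n"
  shows "vec_index (X *\<^sub>v beta_hat H X lam e \<alpha> Y) i = (\<Sum>k<p. H \<alpha> (lam k) * coord n u k (vec_index Y) * u k i)"
proof -
  obtain A' where A': "mat_inverse (gram X) = Some A'"
  proof (cases "mat_inverse (gram X)")
    case None
    obtain C where C: "inverts_mat (gram X) C" "inverts_mat C (gram X)"
      using inv by (auto simp: invertible_mat_def)
    have CC: "gram X * C = 1\<^sub>m p" "C * gram X = 1\<^sub>m (dim_row C)"
      using C gram_carrier by (auto simp: inverts_mat_def)
    have "dim_col C = p" using arg_cong[OF CC(1), of dim_col] by simp
    moreover have "dim_row C = p" using arg_cong[OF CC(2), of dim_col] gram_carrier by simp
    ultimately have "C \<in> carrier_mat p p" "C * gram X = 1\<^sub>m p" using CC(2) by auto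
    then have "gram X \<in> Units (ring_mat TYPE(real) p (undefined :: unit))"
      using CC(1) gram_carrier unfolding Units_def ring_mat_def by auto
    then show ?thesis using mat_inverse(1)[OF gram_carrier None, of "undefined :: unit"] by blast
  qed auto
  have A'p: "gram X * A' = 1\<^sub>m p" "A' \<in> carrier_mat p p"
    using mat_inverse(2)[OF gram_carrier A'] by auto
  define w where "w = transpose_mat X *\<^sub>v Y"
  define y where "y = A' *\<^sub>v w"
  have w: "w \<in> carrier_vec p" using X Y by (auto simp: w_def)
  have y: "y \<in> carrier_vec p" using A'p w by (auto simp: y_def)
  have Ay: "gram X *\<^sub>v y = w"
    unfolding y_def using assoc_mult_mat_vec[OF gram_carrier A'p(2) w] A'p(1) w by simp
  have ey: "scalar_prod (e k) y * sqrt (lam k) = coord n u k (vec_index Y)" if k: "k < p" for k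
  proof -
    have ek: "e k \<in> carrier_vec p" by (rule e_carrier[OF k])
    have "scalar_prod (e k) w = scalar_prod (X *\<^sub>v e k) (X *\<^sub>v y)"
      using scalar_prod_gram[OF ek y] Ay by simp
    also have "\<dots> = scalar_prod (X *\<^sub>v y) (X *\<^sub>v e k)"
      using X ek y by (intro comm_scalar_prod[of _ n]) auto
    also have "\<dots> = lam k * scalar_prod y (e k)"
      using scalar_prod_gram[OF y ek] gram_e[OF k] y ek by simp
    also have "scalar_prod y (e k) = scalar_prod (e k) y" by (rule comm_scalar_prod[OF y ek])
    finally have 1: "scalar_prod (e k) w = lam k * scalar_prod (e k) y" .
    have "scalar_prod (e k) w = scalar_prod w (e k)" by (rule comm_scalar_prod[OF ek w])
    also have "\<dots> = scalar_prod Y (X *\<^sub>v e k)" unfolding w_def by (rule transpose_vec_mult_scalar[OF X ek Y])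
    also have "\<dots> = (\<Sum>i<n. vec_index Y i * vec_index (X *\<^sub>v e k) i)"
      using X Y ek by (subst scalar_prod_sum[of _ n]) auto
    also have "\<dots> = sqrt (lam k) * coord n u k (vec_index Y)"
      using lam_pos[OF k] by (simp add: coord_def u_def sum_distrib_left mult_ac)
    finally have "lam k * scalar_prod (e k) y = sqrt (lam k) * coord n u k (vec_index Y)" using 1 by simp
    moreover have "sqrt (lam k) * (scalar_prod (e k) y * sqrt (lam k)) = (sqrt (lam k) * sqrt (lam k)) * scalar_prod (e k) y"
      by (simp only: mult_ac)
    moreover have "sqrt (lam k) * sqrt (lam k) = lam k" using lam_pos[OF k] by simp
    ultimately have "sqrt (lam k) * (scalar_prod (e k) y * sqrt (lam k)) = sqrt (lam k) * coord n u k (vec_index Y)"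
      by metis
    then show ?thesis using lam_pos[OF k] by simp
  qed
  have bh: "beta_hat H X lam e \<alpha> Y = H_mat H p lam e \<alpha> *\<^sub>v y"
    using X by (simp add: beta_hat_def A' y_def w_def)
  have bhc: "beta_hat H X lam e \<alpha> Y \<in> carrier_vec p" unfolding bh by (intro carrier_vecI) (simp add: H_mat_def)
  have bhj: "vec_index (beta_hat H X lam e \<alpha> Y) j = (\<Sum>k<p. H \<alpha> (lam k) * scalar_prod (e k) y * vec_index (e k) j)"
    if j: "j < p" for j
  proof -
    have "vec_index (beta_hat H X lam e \<alpha> Y) j
       = (\<Sum>l<p. (\<Sum>k<p. H \<alpha> (lam k) * vec_index (e k) j * vec_index (e k) l) * vec_index y l)"
      unfolding bh using j y by (auto simp: H_mat_def mult_mat_vec_def scalar_prod_def atLeast0LessThan)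
    also have "\<dots> = (\<Sum>k<p. \<Sum>l<p. H \<alpha> (lam k) * vec_index (e k) j * (vec_index (e k) l * vec_index y l))"
      unfolding sum_distrib_right by (subst sum.swap) (simp add: mult_ac)
    also have "\<dots> = (\<Sum>k<p. H \<alpha> (lam k) * scalar_prod (e k) y * vec_index (e k) j)"
      using e_carrier y by (intro sum.cong refl) (simp add: scalar_prod_sum[of _ p] sum_distrib_left sum_distrib_right mult_ac)
    finally show ?thesis .
  qed
  have "vec_index (X *\<^sub>v beta_hat H X lam e \<alpha> Y) i
     = (\<Sum>j<p. \<Sum>k<p. X $$ (i, j) * (H \<alpha> (lam k) * scalar_prod (e k) y * vec_index (e k) j))"
    unfolding Xv_index[OF bhc i] sum_distrib_left[symmetric] by (intro sum.cong refl) (simp add: bhj)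
  also have "\<dots> = (\<Sum>k<p. \<Sum>j<p. X $$ (i, j) * (H \<alpha> (lam k) * scalar_prod (e k) y * vec_index (e k) j))"
    by (rule sum.swap)
  also have "\<dots> = (\<Sum>k<p. H \<alpha> (lam k) * scalar_prod (e k) y * vec_index (X *\<^sub>v e k) i)"
    using e_carrier i by (intro sum.cong refl) (simp add: Xv_index sum_distrib_left mult_ac)
  also have "\<dots> = (\<Sum>k<p. H \<alpha> (lam k) * coord n u k (vec_index Y) * u k i)"
  proof (rule sum.cong[OF refl])
    fix k assume "k \<in> {..<p}"
    then have k: "k < p" by simp
    have "vec_index (X *\<^sub>v e k) i = sqrt (lam k) * u k i" using lam_pos[OF k] by (simp add: u_def)
    then show "H \<alpha> (lam k) * scalar_prod (e k) y * vec_index (X *\<^sub>v e k) i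
       = H \<alpha> (lam k) * coord n u k (vec_index Y) * u k i" by (simp add: ey[OF k, symmetric] mult_ac)
  qed
  finally show ?thesis .
qed

definition w :: "real \<Rightarrow> nat \<Rightarrow> real" where "w \<alpha> k = G H \<alpha> (lam k)"

definition bias :: "real \<Rightarrow> real" where "bias \<alpha> = (\<Sum>k<p. (1 - w \<alpha> k) * (b k)\<^sup>2)"

text \<open>The residual sum of squares as a function of the noise.\<close>

definition rss :: "real \<Rightarrow> (nat \<Rightarrow> real) \<Rightarrow> real" where
  "rss \<alpha> x = bias \<alpha> + 2 * \<sigma> * (\<Sum>k<p. (1 - w \<alpha> k) * b k * coord n u k x)
     + \<sigma>\<^sup>2 * ((\<Sum>i<n. (x i)\<^sup>2) - (\<Sum>k<p. w \<alpha> k * (coord n u k x)\<^sup>2))"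

text \<open>Shrinking a coordinate by \<open>h\<close> leaves the fraction \<open>(1 - h)^2 = 1 - G\<close> of its square.\<close>

lemma sqnorm_residual:
  "sqnorm (observation X \<beta> \<sigma> (Matrix.vec n x) - X *\<^sub>v beta_hat H X lam e \<alpha> (observation X \<beta> \<sigma> (Matrix.vec n x)))
     = rss \<alpha> x"
proof -
  let ?Y = "observation X \<beta> \<sigma> (Matrix.vec n x)"
  let ?h = "\<lambda>k. H \<alpha> (lam k)"
  have Y: "?Y \<in> carrier_vec n" using X by (intro carrier_vecI) (simp add: observation_def)
  define y where "y = vec_index ?Y"
  define c where "c k = coord n u k y" for k
  define z where "z k = coord n u k x" for k
  have Yi: "y i = (\<Sum>k<p. b k * u k i) + \<sigma> * x i" if "i < n" for i
    using that X by (simp add: y_def observation_def X\<beta>_index[OF that, symmetric])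
  have ck: "c k = b k + \<sigma> * z k" if k: "k < p" for k
  proof -
    have "c k = (\<Sum>i<n. u k i * vec_index (X *\<^sub>v \<beta>) i + u k i * (\<sigma> * x i))"
      unfolding c_def coord_def by (intro sum.cong refl) (simp add: Yi X\<beta>_index algebra_simps)
    also have "\<dots> = b k + \<sigma> * z k"
      unfolding sum.distrib Xe_scalar[OF k \<beta>]
      by (simp add: b_def z_def coord_def sum_distrib_left mult_ac)
    finally show ?thesis .
  qed
  have cross: "(\<Sum>i<n. f i * (\<Sum>k<p. a k * u k i)) = (\<Sum>k<p. a k * coord n u k f)" for f a
    unfolding sum_coord_swap by (simp add: mult.commute)
  have "sqnorm (?Y - X *\<^sub>v beta_hat H X lam e \<alpha> ?Y)
     = (\<Sum>i<n. (vec_index (?Y - X *\<^sub>v beta_hat H X lam e \<alpha> ?Y) i)\<^sup>2)"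
    using X unfolding sqnorm_def by (auto simp: scalar_prod_def atLeast0LessThan power2_eq_square)
  also have "\<dots> = (\<Sum>i<n. (y i - (\<Sum>k<p. (?h k * c k) * u k i))\<^sup>2)"
  proof (rule sum.cong[OF refl])
    fix i assume "i \<in> {..<n}"
    then have i: "i < n" by simp
    have "vec_index (?Y - X *\<^sub>v beta_hat H X lam e \<alpha> ?Y) i
        = vec_index ?Y i - vec_index (X *\<^sub>v beta_hat H X lam e \<alpha> ?Y) i"
      using X i by (intro index_minus_vec) simp
    then show "(vec_index (?Y - X *\<^sub>v beta_hat H X lam e \<alpha> ?Y) i)\<^sup>2 = (y i - (\<Sum>k<p. (?h k * c k) * u k i))\<^sup>2"
      by (simp only: X\<beta>_hat_index[OF Y i] y_def c_def)
  qed
  also have "\<dots> = (\<Sum>i<n. (y i)\<^sup>2) + (\<Sum>i<n. (\<Sum>k<p. (?h k * c k) * u k i)\<^sup>2)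
      - 2 * (\<Sum>i<n. y i * (\<Sum>k<p. (?h k * c k) * u k i))"
    by (simp only: power2_diff sum_subtractf sum.distrib) (simp add: sum_distrib_left mult.assoc)
  also have "\<dots> = (\<Sum>i<n. (y i)\<^sup>2) + (\<Sum>k<p. (?h k * c k)\<^sup>2) - 2 * (\<Sum>k<p. ?h k * c k * c k)"
    by (simp only: orthonormal_sum_squares[OF u_orthonormal] cross c_def)
  also have "\<dots> = (\<Sum>i<n. (y i)\<^sup>2) - (\<Sum>k<p. w \<alpha> k * (c k)\<^sup>2)"
  proof -
    have "(\<Sum>k<p. w \<alpha> k * (c k)\<^sup>2) = 2 * (\<Sum>k<p. ?h k * c k * c k) - (\<Sum>k<p. (?h k * c k)\<^sup>2)"
      unfolding sum_distrib_left sum_subtractf[symmetric]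
      by (intro sum.cong refl) (simp add: w_def G_def power2_eq_square algebra_simps)
    then show ?thesis by simp
  qed
  also have "(\<Sum>i<n. (y i)\<^sup>2) = (\<Sum>i<n. (\<Sum>k<p. b k * u k i)\<^sup>2) + \<sigma>\<^sup>2 * (\<Sum>i<n. (x i)\<^sup>2)
      + 2 * \<sigma> * (\<Sum>i<n. x i * (\<Sum>k<p. b k * u k i))"
    by (simp add: Yi power2_sum sum.distrib sum_distrib_left power_mult_distrib mult_ac)
  also have "\<dots> = (\<Sum>k<p. (b k)\<^sup>2) + \<sigma>\<^sup>2 * (\<Sum>i<n. (x i)\<^sup>2) + 2 * \<sigma> * (\<Sum>k<p. b k * z k)"
    by (simp only: orthonormal_sum_squares[OF u_orthonormal] cross z_def)
  also have "(\<Sum>k<p. w \<alpha> k * (c k)\<^sup>2)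
     = (\<Sum>k<p. w \<alpha> k * (b k)\<^sup>2) + 2 * \<sigma> * (\<Sum>k<p. w \<alpha> k * b k * z k) + \<sigma>\<^sup>2 * (\<Sum>k<p. w \<alpha> k * (z k)\<^sup>2)"
    unfolding sum_distrib_left sum.distrib[symmetric]
    by (intro sum.cong refl) (simp add: ck power2_sum power_mult_distrib algebra_simps)
  finally show ?thesis
    by (simp add: rss_def bias_def z_def left_diff_distrib sum_subtractf right_diff_distrib)
qed

lemma H01: "0 < \<alpha> \<Longrightarrow> 0 \<le> x \<Longrightarrow> 0 \<le> H \<alpha> x \<and> H \<alpha> x \<le> 1"
  using H by (auto simp: ordered_family_def)

lemma lam_nonneg: "0 \<le> lam k"
  using lam_pos[of k] lam_0[of k] by (cases "k < p") auto

lemma w_eq: "1 - w \<alpha> k = (1 - H \<alpha> (lam k))\<^sup>2"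
  by (simp add: w_def G_def power2_diff)

lemma w01: assumes "0 < \<alpha>" shows "0 \<le> w \<alpha> k \<and> w \<alpha> k \<le> 1"
proof -
  have h: "0 \<le> H \<alpha> (lam k)" "H \<alpha> (lam k) \<le> 1" using H01[OF assms lam_nonneg] by auto
  then have "(1 - H \<alpha> (lam k))\<^sup>2 \<le> 1" by (intro power_le_one) auto
  then show ?thesis using w_eq[of \<alpha> k] zero_le_power2[of "1 - H \<alpha> (lam k)"] by linarith
qed

lemma w_ord:
  assumes "0 < \<alpha>" "0 < \<alpha>'"
  shows "(\<forall>k<p. w \<alpha> k \<le> w \<alpha>' k) \<or> (\<forall>k<p. w \<alpha>' k \<le> w \<alpha> k)"
proof -
  have mono: "w \<alpha> k \<le> w \<alpha>' k" if "0 < \<alpha>'" "H \<alpha> (lam k) \<le> H \<alpha>' (lam k)" for \<alpha> \<alpha>' k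
  proof -
    have "(1 - H \<alpha>' (lam k))\<^sup>2 \<le> (1 - H \<alpha> (lam k))\<^sup>2"
      using that H01[OF that(1) lam_nonneg[of k]] by (intro power_mono) auto
    then show ?thesis using w_eq[of \<alpha> k] w_eq[of \<alpha>' k] by linarith
  qed
  have "(\<forall>x\<ge>0. H \<alpha> x \<le> H \<alpha>' x) \<or> (\<forall>x\<ge>0. H \<alpha>' x \<le> H \<alpha> x)"
    using H assms by (auto simp: ordered_family_def)
  then show ?thesis using mono assms lam_nonneg by metis
qed

lemma D_eq: assumes "0 < \<alpha>" shows "D H n lam \<alpha> = (\<Sum>k<p. (w \<alpha> k)\<^sup>2)"
  unfolding D_def w_def
proof (rule sum.mono_neutral_right)
  show "\<forall>i\<in>{..<n} - {..<p}. (G H \<alpha> (lam i))\<^sup>2 = 0"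
    using lam_0 H assms by (auto simp: G_def ordered_family_def)
qed (use pn in auto)

lemma mean_G_eq: "mean_G H n p lam \<alpha> = (\<Sum>k<p. w \<alpha> k) / real n"
  by (simp add: mean_G_def w_def)

lemma sum_risk_eq: "(\<Sum>i<n. (1 - H \<alpha> (lam i))\<^sup>2 * lam i * (beta_bar \<beta> e i)\<^sup>2) = bias \<alpha>"
proof -
  have "(\<Sum>i<n. (1 - H \<alpha> (lam i))\<^sup>2 * lam i * (beta_bar \<beta> e i)\<^sup>2)
      = (\<Sum>i<p. (1 - H \<alpha> (lam i))\<^sup>2 * lam i * (beta_bar \<beta> e i)\<^sup>2)"
    using pn lam_0 by (intro sum.mono_neutral_right) auto
  also have "\<dots> = bias \<alpha>"
    unfolding bias_def w_eq using \<beta> lam_nonneg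
    by (intro sum.cong refl) (auto simp: b_def beta_bar_def power_mult_distrib)
  finally show ?thesis .
qed

lemma weight_chain_w: "I \<subseteq> {0<..} \<Longrightarrow> weight_chain n p u I w"
  using w01 w_ord u_orthonormal pn by (auto simp: weight_chain_def subset_eq)

end

section \<open>A random majorant of the loss\<close>

context regression_model
begin

text \<open>This is \<open>1 + q\<close>; it makes \<open>scale \<alpha> * (n - \<Sum> w \<alpha> k) = n\<close>, so the noise part of the estimator is
  unbiased.\<close>

definition scale :: "real \<Rightarrow> real" where
  "scale \<alpha> = inverse (1 - (\<Sum>k<p. w \<alpha> k) / real n)"

lemma rss_moment:
  "integrable (noise_law n) (rss \<alpha>)"
  "(\<integral>x. rss \<alpha> x \<partial>noise_law n) = bias \<alpha> + \<sigma>\<^sup>2 * (real n - (\<Sum>k<p. w \<alpha> k))"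
proof -
  interpret prob_space "noise_law n" by (rule prob_space_noise_law)
  note cm = coord_moments[OF u_orthonormal]
  have i1: "integrable (noise_law n) (\<lambda>x. \<Sum>k<p. (1 - w \<alpha> k) * b k * coord n u k x)"
    using cm by (intro Bochner_Integration.integrable_sum integrable_mult_right) auto
  have i2: "integrable (noise_law n) (\<lambda>x. \<Sum>k<p. w \<alpha> k * (coord n u k x)\<^sup>2)"
    using cm by (intro Bochner_Integration.integrable_sum integrable_mult_right) auto
  have e1: "(\<integral>x. (\<Sum>k<p. (1 - w \<alpha> k) * b k * coord n u k x) \<partial>noise_law n) = 0"
    using cm by (subst Bochner_Integration.integral_sum) auto
  have e2: "(\<integral>x. (\<Sum>k<p. w \<alpha> k * (coord n u k x)\<^sup>2) \<partial>noise_law n) = (\<Sum>k<p. w \<alpha> k)"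
    using cm by (subst Bochner_Integration.integral_sum) auto
  have rss_fun: "rss \<alpha> = (\<lambda>x. bias \<alpha> + 2 * \<sigma> * (\<Sum>k<p. (1 - w \<alpha> k) * b k * coord n u k x)
     + \<sigma>\<^sup>2 * ((\<Sum>i<n. (x i)\<^sup>2) - (\<Sum>k<p. w \<alpha> k * (coord n u k x)\<^sup>2)))"
    by (auto simp: rss_def)
  show "integrable (noise_law n) (rss \<alpha>)" unfolding rss_fun
    using i1 i2 noise_law_sum_squares(1)
    by (intro Bochner_Integration.integrable_add integrable_mult_right Bochner_Integration.integrable_diff) auto
  have "(\<integral>x. rss \<alpha> x \<partial>noise_law n) = bias \<alpha> + 2 * \<sigma> * 0 + \<sigma>\<^sup>2 * (real n - (\<Sum>k<p. w \<alpha> k))"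
    unfolding rss_fun using i1 i2 noise_law_sum_squares[of n]
    by (simp add: e1 e2 prob_space)
  then show "(\<integral>x. rss \<alpha> x \<partial>noise_law n) = bias \<alpha> + \<sigma>\<^sup>2 * (real n - (\<Sum>k<p. w \<alpha> k))" by simp
qed

text \<open>Let \<open>t\<close> be the error at the selected parameter and \<open>v = V / n\<close> there.  Minimality gives
  \<open>t (1 + v) + \<sigma>^2 V ||\<xi>||^2 / n \<le> W\<close>, and the two suprema give \<open>- t \<le> \<omega> c2 \<sigma>^2 V + St\<close>.
  If \<open>t \<ge> 0\<close> the first inequality suffices.  Otherwise \<open>V\<close> is eliminated between the two; the
  event that \<open>||\<xi>||^2 / n\<close> falls below \<open>1 - \<theta>\<close> costs the term \<open>E\<close>, which is quadratic in the
  deviation and hence of expectation \<open>O(vmax / \<theta>)\<close>.\<close>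

lemma loss_majorant:
  fixes I :: "real set" and V :: "real \<Rightarrow> real" and ah :: "(nat \<Rightarrow> real) \<Rightarrow> real"
  assumes n: "1 \<le> n" and I: "I \<subseteq> {0<..}" and s: "s \<in> I"
    and d0: "5 \<le> d0" and eps: "0 < \<epsilon>" "\<epsilon> \<le> 1" and del: "0 < \<delta>" "\<delta> \<le> \<epsilon>"
    and V: "\<And>\<alpha>. \<alpha> \<in> I \<Longrightarrow> V \<alpha> = (1 + \<epsilon>) * base_penalty \<epsilon> d0 (\<Sum>k<p. (w \<alpha> k)\<^sup>2)"
    and Vmax: "\<And>\<alpha>. \<alpha> \<in> I \<Longrightarrow> V \<alpha> \<le> vmax * real n"
    and m: "\<And>\<alpha>. \<alpha> \<in> I \<Longrightarrow> (\<Sum>k<p. w \<alpha> k) / real n \<le> m" "m < 1"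
    and c2: "1 + (\<epsilon>\<^sup>2 + \<delta>) / 16 \<le> c2 * (1 + \<epsilon>)" "0 < c2"
    and \<theta>: "0 < \<theta>" "\<theta> < 1"
    and om: "\<omega> = 1 / (1 - m)" and c1: "c1 = c2 * \<omega> / (1 - \<theta>)" "1/2 \<le> c1"
    and c': "c' = c1 * (1 + vmax)" "c' < 1"
    and ah: "\<And>x. ah x \<in> I"
      "\<And>x \<alpha>. \<alpha> \<in> I \<Longrightarrow> scale (ah x) * rss (ah x) x * (1 + V (ah x) / real n)
          \<le> scale \<alpha> * rss \<alpha> x * (1 + V \<alpha> / real n)"
  shows "\<exists>U. integrable (noise_law n) U \<and>
     (\<forall>x\<in>space (noise_law n). \<bar>scale (ah x) * rss (ah x) x - \<sigma>\<^sup>2 * (\<Sum>i<n. (x i)\<^sup>2)\<bar> \<le> U x) \<and>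
     (\<integral>x. U x \<partial>noise_law n) \<le>
       (c1 * ((1 + V s / real n) * (scale s * bias s + \<sigma>\<^sup>2 * V s) + 16 * exp 1 * \<sigma>\<^sup>2 * vmax / \<theta>)
         + \<omega> * \<sigma>\<^sup>2 * (linear_sup_const + quadratic_sup_const * (sqrt d0 / \<delta>))) / (1 - c')"
proof -
  interpret prob_space "noise_law n" by (rule prob_space_noise_law)
  interpret C: weight_chain n p u I w by (rule weight_chain_w[OF I])
  let ?M = "noise_law n"
  let ?N = "\<lambda>x. \<Sum>i<n. (x i)\<^sup>2"
  have nn: "0 < real n" using n by simp
  have w0: "0 \<le> w \<alpha> k" "w \<alpha> k \<le> 1" if "\<alpha> \<in> I" for \<alpha> k using w01[of \<alpha> k] I that by auto
  obtain \<Psi>1 where \<Psi>1: "integrable ?M \<Psi>1" "\<And>x. x \<in> space ?M \<Longrightarrow> 0 \<le> \<Psi>1 x"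
      "(\<integral>x. \<Psi>1 x \<partial>?M) \<le> linear_sup_const"
      "\<And>\<alpha> x. \<alpha> \<in> I \<Longrightarrow> x \<in> space ?M \<Longrightarrow> - 2 * (\<Sum>k<p. (1 - w \<alpha> k) * (b k / \<sigma>) * coord n u k x)
          - (\<Sum>k<p. (1 - w \<alpha> k) * (b k / \<sigma>)\<^sup>2) \<le> \<Psi>1 x"
  proof -
    have "majorised ?M I
      (\<lambda>a x. - 2 * (\<Sum>k<p. (1 - w a k) * (b k / \<sigma>) * coord n u k x) - (\<Sum>k<p. (1 - w a k) * (b k / \<sigma>)\<^sup>2))
      linear_sup_const"
    proof (rule linear_process_sup_bound[OF u_orthonormal])
      fix a k assume "a \<in> I" then show "0 \<le> 1 - w a k \<and> 1 - w a k \<le> 1" using w0 by auto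
    next
      fix a a' assume "a \<in> I" "a' \<in> I"
      then show "(\<forall>k<p. 1 - w a k \<le> 1 - w a' k) \<or> (\<forall>k<p. 1 - w a' k \<le> 1 - w a k)"
        using C.ord[of a a'] by auto
    qed
    then show ?thesis using that unfolding majorised_def by auto
  qed
  define gain where "gain = (\<epsilon>\<^sup>2 + \<delta>) / 16"
  obtain \<Psi>2 where \<Psi>2: "integrable ?M \<Psi>2" "\<And>x. x \<in> space ?M \<Longrightarrow> 0 \<le> \<Psi>2 x"
      "(\<integral>x. \<Psi>2 x \<partial>?M) \<le> quadratic_sup_const * (sqrt d0 / \<delta>)"
      "\<And>\<alpha> x. \<alpha> \<in> I \<Longrightarrow> x \<in> space ?M \<Longrightarrow> C.noise_form \<alpha> x - (1 + gain) * base_penalty \<epsilon> d0 (C.energy \<alpha>) \<le> \<Psi>2 x"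
    using C.quadratic_process_sup_bound[OF d0 eps del gain_def] unfolding majorised_def by auto
  have om1: "1 \<le> \<omega>"
  proof -
    have "0 \<le> (\<Sum>k<p. w s k) / real n" using w0[OF s] by (intro divide_nonneg_nonneg sum_nonneg) auto
    then have "0 \<le> m" using m(1)[OF s] by linarith
    then show ?thesis using m(2) by (simp add: om)
  qed
  have sc: "0 < scale \<alpha>" "scale \<alpha> \<le> \<omega>" "scale \<alpha> * (1 - (\<Sum>k<p. w \<alpha> k) / real n) = 1" if "\<alpha> \<in> I" for \<alpha>
  proof -
    have pos: "0 < 1 - m" "1 - m \<le> 1 - (\<Sum>k<p. w \<alpha> k) / real n" using m(1)[OF that] m(2) by auto
    then have ne: "1 - (\<Sum>k<p. w \<alpha> k) / real n \<noteq> 0" by linarith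
    show "scale \<alpha> * (1 - (\<Sum>k<p. w \<alpha> k) / real n) = 1" unfolding scale_def by (rule left_inverse[OF ne])
    show "0 < scale \<alpha>" unfolding scale_def using pos by (intro positive_imp_inverse_positive) linarith
    show "scale \<alpha> \<le> \<omega>" unfolding scale_def om inverse_eq_divide using pos by (intro divide_left_mono) auto
  qed
  have V0: "0 \<le> V \<alpha>" if "\<alpha> \<in> I" for \<alpha>
    unfolding V[OF that] using eps base_penalty_nonneg[of d0] d0 by (intro mult_nonneg_nonneg) auto
  have vm0: "0 \<le> vmax"
    using V0[OF s] Vmax[OF s] nn by (metis order_trans zero_le_mult_iff not_less)
  define lin where "lin \<alpha> x = bias \<alpha> + 2 * \<sigma> * (\<Sum>k<p. (1 - w \<alpha> k) * b k * coord n u k x)" for \<alpha> x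
  have lin_ge: "- lin \<alpha> x \<le> \<sigma>\<^sup>2 * \<Psi>1 x" if a: "\<alpha> \<in> I" and x: "x \<in> space ?M" for \<alpha> x
  proof -
    have "- lin \<alpha> x = \<sigma>\<^sup>2 * (- 2 * (\<Sum>k<p. (1 - w \<alpha> k) * (b k / \<sigma>) * coord n u k x)
          - (\<Sum>k<p. (1 - w \<alpha> k) * (b k / \<sigma>)\<^sup>2))"
    proof -
      have "\<sigma>\<^sup>2 * (\<Sum>k<p. (1 - w \<alpha> k) * (b k / \<sigma>) * coord n u k x) = \<sigma> * (\<Sum>k<p. (1 - w \<alpha> k) * b k * coord n u k x)"
        unfolding sum_distrib_left using \<sigma> by (intro sum.cong refl) (simp add: power2_eq_square)
      moreover have "\<sigma>\<^sup>2 * (\<Sum>k<p. (1 - w \<alpha> k) * (b k / \<sigma>)\<^sup>2) = bias \<alpha>"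
        unfolding sum_distrib_left bias_def using \<sigma> by (intro sum.cong refl) (simp add: power_divide)
      ultimately show ?thesis by (simp add: lin_def algebra_simps)
    qed
    also have "\<dots> \<le> \<sigma>\<^sup>2 * \<Psi>1 x" by (intro mult_left_mono \<Psi>1 a x) auto
    finally show ?thesis .
  qed
  define T where "T \<alpha> x = scale \<alpha> * rss \<alpha> x - \<sigma>\<^sup>2 * ?N x" for \<alpha> x
  have T_eq: "T \<alpha> x = scale \<alpha> * lin \<alpha> x - \<sigma>\<^sup>2 * (scale \<alpha> * C.noise_form \<alpha> x)" if a: "\<alpha> \<in> I" for \<alpha> x
  proof -
    have "?N x = scale \<alpha> * (1 - (\<Sum>k<p. w \<alpha> k) / real n) * ?N x" by (simp only: sc(3)[OF a] mult_1)
    then have "T \<alpha> x = scale \<alpha> * rss \<alpha> x - \<sigma>\<^sup>2 * (scale \<alpha> * (1 - (\<Sum>k<p. w \<alpha> k) / real n) * ?N x)"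
      by (simp add: T_def)
    then show ?thesis by (simp add: rss_def lin_def C.noise_form_def centred_form_def algebra_simps)
  qed
  define St where "St x = \<omega> * \<sigma>\<^sup>2 * (\<Psi>1 x + \<Psi>2 x)" for x
  have T_ge: "- T \<alpha> x \<le> \<omega> * c2 * (\<sigma>\<^sup>2 * V \<alpha>) + St x" if a: "\<alpha> \<in> I" and x: "x \<in> space ?M" for \<alpha> x
  proof -
    have pd: "(1 + gain) * base_penalty \<epsilon> d0 (C.energy \<alpha>) \<le> c2 * V \<alpha>"
    proof -
      have "(1 + gain) * base_penalty \<epsilon> d0 (C.energy \<alpha>) \<le> (c2 * (1 + \<epsilon>)) * base_penalty \<epsilon> d0 (C.energy \<alpha>)"
        using c2(1) base_penalty_nonneg[of d0] d0 by (intro mult_right_mono) (auto simp: gain_def)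
      then show ?thesis by (simp add: V[OF a] C.energy_def)
    qed
    have "- T \<alpha> x = scale \<alpha> * (- lin \<alpha> x + \<sigma>\<^sup>2 * C.noise_form \<alpha> x)" by (simp add: T_eq[OF a] algebra_simps)
    also have "\<dots> \<le> scale \<alpha> * (\<sigma>\<^sup>2 * \<Psi>1 x + \<sigma>\<^sup>2 * (c2 * V \<alpha> + \<Psi>2 x))"
      using lin_ge[OF a x] \<Psi>2(4)[OF a x] pd sc[OF a] by (intro mult_left_mono add_mono) auto
    also have "\<dots> \<le> \<omega> * (\<sigma>\<^sup>2 * \<Psi>1 x + \<sigma>\<^sup>2 * (c2 * V \<alpha> + \<Psi>2 x))"
      using sc[OF a] \<Psi>1(2)[OF x] \<Psi>2(2)[OF x] V0[OF a] c2(2) by (intro mult_right_mono) auto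
    also have "\<dots> = \<omega> * c2 * (\<sigma>\<^sup>2 * V \<alpha>) + St x" by (simp add: St_def algebra_simps)
    finally show ?thesis .
  qed
  define W where "W x = scale s * rss s x * (1 + V s / real n) - \<sigma>\<^sup>2 * ?N x" for x
  define E where "E x = \<sigma>\<^sup>2 * (vmax * real n * (?N x / real n - 1)\<^sup>2 / (4 * \<theta>))" for x
  have E0: "0 \<le> E x" for x using vm0 \<theta> by (simp add: E_def)
  have St0: "0 \<le> St x" if "x \<in> space ?M" for x
    using \<Psi>1(2)[OF that] \<Psi>2(2)[OF that] om1 by (simp add: St_def)
  have c'1: "0 < 1 - c'" using c' by simp
  define U where "U x = (c1 * (W x + E x) + St x) / (1 - c')" for x
  have bound: "\<bar>T (ah x) x\<bar> \<le> U x" if x: "x \<in> space ?M" for x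
  proof -
    define t where "t = T (ah x) x"
    define v where "v = V (ah x) / real n"
    have v: "0 \<le> v" "v \<le> vmax" using V0[OF ah(1)] Vmax[OF ah(1)] nn by (auto simp: v_def field_simps)
    have N0: "0 \<le> ?N x" by (intro sum_nonneg) auto
    have "(t + \<sigma>\<^sup>2 * ?N x) * (1 + v) \<le> W x + \<sigma>\<^sup>2 * ?N x"
      using ah(2)[OF s, of x] by (simp add: t_def T_def W_def v_def)
    then have main: "t * (1 + v) + \<sigma>\<^sup>2 * ?N x * v \<le> W x" by (simp add: algebra_simps)
    have "\<bar>t\<bar> * (1 - c') \<le> c1 * (W x + E x) + St x"
    proof (cases "0 \<le> t")
      case True
      have "t \<le> t * (1 + v)" using True v by (simp add: algebra_simps)
      also have "\<dots> \<le> W x" using main N0 v by (smt (verit) mult_nonneg_nonneg zero_le_power2)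
      finally have tW: "t \<le> W x" .
      have "c1 \<le> c'" unfolding c'(1) using c1(2) vm0 by (simp add: algebra_simps)
      then have "\<bar>t\<bar> * (1 - c') \<le> t * c1" using True c1(2) c'(2) by (intro mult_mono) auto
      also have "\<dots> \<le> c1 * (W x + E x)" using tW E0[of x] c1(2) by (subst mult.commute) (intro mult_left_mono, auto)
      finally show ?thesis using St0[OF x] by simp
    next
      case False
      define y where "y = 1 - ?N x / real n"
      have yy: "y - \<theta> \<le> y\<^sup>2 / (4 * \<theta>)"
      proof -
        have "0 \<le> (y - 2 * \<theta>)\<^sup>2" by simp
        then have "4 * \<theta> * (y - \<theta>) \<le> y\<^sup>2" by (simp add: power2_eq_square algebra_simps)
        then show ?thesis using \<theta> by (simp add: field_simps)
      qed
      have "V (ah x) * (y - \<theta>) \<le> V (ah x) * (y\<^sup>2 / (4 * \<theta>))" using V0[OF ah(1)] yy by (intro mult_left_mono) auto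
      also have "\<dots> \<le> vmax * real n * (y\<^sup>2 / (4 * \<theta>))" using Vmax[OF ah(1)] \<theta> by (intro mult_right_mono) auto
      finally have "\<sigma>\<^sup>2 * (V (ah x) * (y - \<theta>)) \<le> \<sigma>\<^sup>2 * (vmax * real n * (y\<^sup>2 / (4 * \<theta>)))" by (intro mult_left_mono) auto
      also have "\<dots> = E x" by (simp add: E_def y_def power2_commute)
      finally have "\<sigma>\<^sup>2 * (V (ah x) * (y - \<theta>)) \<le> E x" .
      moreover have "\<sigma>\<^sup>2 * (V (ah x) * (y - \<theta>)) = (1 - \<theta>) * (\<sigma>\<^sup>2 * V (ah x)) - \<sigma>\<^sup>2 * ?N x * v"
        using nn by (simp add: y_def v_def algebra_simps)
      ultimately have "(1 - \<theta>) * (\<sigma>\<^sup>2 * V (ah x)) \<le> W x + E x - t * (1 + v)" using main by linarith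
      then have "c1 * ((1 - \<theta>) * (\<sigma>\<^sup>2 * V (ah x))) \<le> c1 * (W x + E x - t * (1 + v))"
        using c1(2) by (intro mult_left_mono) auto
      moreover have "c1 * ((1 - \<theta>) * (\<sigma>\<^sup>2 * V (ah x))) = \<omega> * c2 * (\<sigma>\<^sup>2 * V (ah x))"
        using \<theta> by (simp add: c1(1))
      moreover have "c1 * (- t * (1 + v)) \<le> c' * (- t)"
      proof -
        have "c1 * (1 + v) * (- t) \<le> c' * (- t)"
          unfolding c'(1) using False c1(2) v by (intro mult_right_mono mult_left_mono) auto
        then show ?thesis by (simp add: algebra_simps)
      qed
      moreover have "- t \<le> \<omega> * c2 * (\<sigma>\<^sup>2 * V (ah x)) + St x" unfolding t_def by (rule T_ge[OF ah(1) x])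
      moreover have "c1 * (W x + E x - t * (1 + v)) = c1 * (W x + E x) + c1 * (- t * (1 + v))"
        by (simp add: algebra_simps)
      ultimately have "- t \<le> c1 * (W x + E x) + c' * (- t) + St x" by linarith
      moreover have "\<bar>t\<bar> * (1 - c') = - t - c' * (- t)" using False by (simp add: algebra_simps)
      ultimately show ?thesis by linarith
    qed
    then show ?thesis unfolding U_def t_def using c'1 by (simp add: pos_le_divide_eq)
  qed
  have iW: "integrable ?M W" unfolding W_def
    using rss_moment(1) noise_law_sum_squares(1) by auto
  have chi: "(?N x / real n - 1)\<^sup>2 = (?N x - real n)\<^sup>2 / (real n)\<^sup>2" for x
    using nn by (simp add: power_divide[symmetric] diff_divide_distrib)
  have E_eq: "E = (\<lambda>x. \<sigma>\<^sup>2 * vmax / (4 * \<theta> * real n) * (?N x - real n)\<^sup>2)"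
    using nn \<theta> by (auto simp: E_def chi power2_eq_square field_simps)
  have iE: "integrable ?M E" unfolding E_eq using noise_law_chi_square_deviation(1)[OF n] by auto
  have iSt: "integrable ?M St" unfolding St_def using \<Psi>1(1) \<Psi>2(1) by auto
  have eW: "(\<integral>x. W x \<partial>?M) \<le> (1 + V s / real n) * (scale s * bias s + \<sigma>\<^sup>2 * V s)"
  proof -
    have "(\<integral>x. W x \<partial>?M) = scale s * (bias s + \<sigma>\<^sup>2 * (real n - (\<Sum>k<p. w s k))) * (1 + V s / real n) - \<sigma>\<^sup>2 * real n"
      unfolding W_def using rss_moment[of s] noise_law_sum_squares[of n] by simp
    also have "scale s * (bias s + \<sigma>\<^sup>2 * (real n - (\<Sum>k<p. w s k)))
       = scale s * bias s + \<sigma>\<^sup>2 * (real n * (scale s * (1 - (\<Sum>k<p. w s k) / real n)))"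
      using nn by (simp add: field_simps)
    also have "\<dots> = scale s * bias s + \<sigma>\<^sup>2 * real n" by (simp only: sc(3)[OF s] mult_1_right)
    also have "(scale s * bias s + \<sigma>\<^sup>2 * real n) * (1 + V s / real n) - \<sigma>\<^sup>2 * real n
       = (1 + V s / real n) * (scale s * bias s) + \<sigma>\<^sup>2 * V s"
      using nn by (simp add: field_simps)
    also have "\<dots> \<le> (1 + V s / real n) * (scale s * bias s) + (1 + V s / real n) * (\<sigma>\<^sup>2 * V s)"
    proof -
      have "1 * (\<sigma>\<^sup>2 * V s) \<le> (1 + V s / real n) * (\<sigma>\<^sup>2 * V s)"
        using V0[OF s] nn by (intro mult_right_mono) auto
      then show ?thesis by simp
    qed
    finally show ?thesis by (simp add: distrib_left)
  qed
  have eE: "(\<integral>x. E x \<partial>?M) \<le> 16 * exp 1 * \<sigma>\<^sup>2 * vmax / \<theta>"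
  proof -
    have "(\<integral>x. E x \<partial>?M) = \<sigma>\<^sup>2 * vmax / (4 * \<theta> * real n) * (\<integral>x. (?N x - real n)\<^sup>2 \<partial>?M)"
      unfolding E_eq by simp
    also have "\<dots> \<le> \<sigma>\<^sup>2 * vmax / (4 * \<theta> * real n) * (64 * exp 1 * real n)"
      using noise_law_chi_square_deviation(2)[OF n] vm0 \<theta> nn by (intro mult_left_mono) auto
    also have "\<dots> = 16 * exp 1 * \<sigma>\<^sup>2 * vmax / \<theta>" using nn \<theta> by (simp add: field_simps)
    finally show ?thesis .
  qed
  have eSt: "(\<integral>x. St x \<partial>?M) \<le> \<omega> * \<sigma>\<^sup>2 * (linear_sup_const + quadratic_sup_const * (sqrt d0 / \<delta>))"
  proof -
    have "(\<integral>x. St x \<partial>?M) = \<omega> * \<sigma>\<^sup>2 * ((\<integral>x. \<Psi>1 x \<partial>?M) + (\<integral>x. \<Psi>2 x \<partial>?M))"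
      unfolding St_def using \<Psi>1(1) \<Psi>2(1) by simp
    also have "\<dots> \<le> \<omega> * \<sigma>\<^sup>2 * (linear_sup_const + quadratic_sup_const * (sqrt d0 / \<delta>))"
      using om1 \<Psi>1(3) \<Psi>2(3) by (intro mult_left_mono add_mono) auto
    finally show ?thesis .
  qed
  show ?thesis
  proof (intro exI[of _ U] conjI ballI)
    show "integrable ?M U" unfolding U_def using iW iE iSt by auto
    show "\<bar>scale (ah x) * rss (ah x) x - \<sigma>\<^sup>2 * (\<Sum>i<n. (x i)\<^sup>2)\<bar> \<le> U x" if "x \<in> space ?M" for x
      using bound[OF that] by (simp add: T_def)
    have "(\<integral>x. U x \<partial>?M) = (c1 * ((\<integral>x. W x \<partial>?M) + (\<integral>x. E x \<partial>?M)) + (\<integral>x. St x \<partial>?M)) / (1 - c')"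
      unfolding U_def using iW iE iSt by simp
    also have "\<dots> \<le> (c1 * ((1 + V s / real n) * (scale s * bias s + \<sigma>\<^sup>2 * V s) + 16 * exp 1 * \<sigma>\<^sup>2 * vmax / \<theta>)
         + \<omega> * \<sigma>\<^sup>2 * (linear_sup_const + quadratic_sup_const * (sqrt d0 / \<delta>))) / (1 - c')"
      using eW eE eSt c1(2) c'1 by (intro divide_right_mono add_mono mult_left_mono) auto
    finally show "(\<integral>x. U x \<partial>?M) \<le> (c1 * ((1 + V s / real n) * (scale s * bias s + \<sigma>\<^sup>2 * V s) + 16 * exp 1 * \<sigma>\<^sup>2 * vmax / \<theta>)
         + \<omega> * \<sigma>\<^sup>2 * (linear_sup_const + quadratic_sup_const * (sqrt d0 / \<delta>))) / (1 - c')" .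
  qed
qed

end

section \<open>The oracle inequality\<close>

definition penalty_const :: "real \<Rightarrow> real" where
  "penalty_const \<epsilon> = 2 * sqrt (2 * (1 + 4 * (Q_const / \<epsilon>\<^sup>2)))"

text \<open>The penalty is at most proportional to the energy, which makes it uniformly \<open>o(n)\<close>.\<close>

lemma base_penalty_le:
  fixes \<epsilon> d0 t :: real
  assumes eps: "0 < \<epsilon>" "\<epsilon> \<le> 1" and d0: "1 \<le> d0" and t: "0 \<le> t"
  shows "(1 + \<epsilon>) * base_penalty \<epsilon> d0 t \<le> penalty_const \<epsilon> * t"
proof -
  define a where "a = Q_const / \<epsilon>\<^sup>2"
  have a0: "0 < a" using eps by (simp add: a_def Q_const_def)
  have c0: "0 \<le> penalty_const \<epsilon>" using a0 by (simp add: penalty_const_def a_def)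
  show ?thesis
  proof (cases "t \<le> d0 \<or> penalty_braces \<epsilon> (t / d0) < 0")
    case True
    then show ?thesis using c0 t by (auto simp: base_penalty_def)
  next
    case False
    then have td: "d0 < t" by simp
    define y where "y = t / d0"
    have y: "1 < y" "y \<le> t" using td d0 by (auto simp: y_def field_simps mult_le_cancel_left1)
    have ly: "0 < ln y" "ln y \<le> y" using y ln_le_minus_one[of y] by auto
    have "ln (a * ln y) \<le> a * ln y" using ln_le_minus_one[of "a * ln y"] a0 ly by simp
    also have "\<dots> \<le> a * y" using a0 ly by (intro mult_left_mono) auto
    finally have l: "ln (a * ln y) \<le> a * y" .
    have ay: "0 \<le> a * y" using a0 y by simp
    have "2 * (1 + \<epsilon>) * ln (a * ln y) \<le> 2 * (1 + \<epsilon>) * (a * y)" using l eps by (intro mult_left_mono) auto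
    also have "\<dots> \<le> 4 * (a * y)" using eps ay by (intro mult_right_mono) auto
    finally have "penalty_braces \<epsilon> y \<le> (1 + 4 * a) * y" using ly(2) by (simp add: penalty_braces_def a_def algebra_simps)
    also have "\<dots> \<le> (1 + 4 * a) * t" using y a0 by (intro mult_left_mono) auto
    finally have b: "penalty_braces \<epsilon> y \<le> (1 + 4 * a) * t" .
    have "base_penalty \<epsilon> d0 t = sqrt (2 * t) * sqrt (penalty_braces \<epsilon> y)" using False by (simp add: base_penalty_def y_def)
    also have "\<dots> \<le> sqrt (2 * t) * sqrt ((1 + 4 * a) * t)" using b t by (intro mult_left_mono) auto
    also have "\<dots> = sqrt (2 * (1 + 4 * a)) * t"
      using t a0 by (simp add: real_sqrt_mult mult_ac flip: real_sqrt_mult) (simp add: real_sqrt_mult)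
    finally have "(1 + \<epsilon>) * base_penalty \<epsilon> d0 t \<le> 2 * (sqrt (2 * (1 + 4 * a)) * t)"
      using eps base_penalty_nonneg[of d0 \<epsilon> t] d0 by (intro mult_mono) auto
    then show ?thesis by (simp add: penalty_const_def a_def)
  qed
qed

definition sup_const :: real where
  "sup_const = linear_sup_const + quadratic_sup_const"

context regression_model
begin

lemma penalty_eq:
  assumes "0 < \<alpha>"
  shows "penalty H \<epsilon> n lam \<alpha>max \<alpha> = (1 + \<epsilon>) * base_penalty \<epsilon> (D H n lam \<alpha>max) (\<Sum>k<p. (w \<alpha> k)\<^sup>2)"
  unfolding penalty_def base_penalty_def Let_def D_eq[OF assms, symmetric] by auto

lemma dims: "dim_row X = n" "dim_col X = p"
  using X by auto

lemma sigma2_hat_eq: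
  "sigma2_hat H X lam e \<alpha> (observation X \<beta> \<sigma> (Matrix.vec n x)) = scale \<alpha> * rss \<alpha> x / real n"
  by (simp add: sigma2_hat_def dims sqnorm_residual q_corr_def mean_G_eq scale_def)

lemma risk_eq:
  assumes "0 < \<alpha>"
  shows "risk H \<epsilon> n p lam e \<alpha>max \<sigma> \<beta> \<alpha> = (1 + penalty H \<epsilon> n lam \<alpha>max \<alpha> / real n)
      * (scale \<alpha> * bias \<alpha> + \<sigma>\<^sup>2 * penalty H \<epsilon> n lam \<alpha>max \<alpha>)"
  unfolding risk_def sum_risk_eq by (simp add: q_corr_def mean_G_eq scale_def)

lemma mean_G_le_Sup:
  assumes "0 < \<alpha>min" "\<alpha> \<in> {\<alpha>min..\<alpha>max}"
  shows "mean_G H n p lam \<alpha> \<le> (SUP \<alpha>\<in>{\<alpha>min..\<alpha>max}. mean_G H n p lam \<alpha>)"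
proof (rule cSUP_upper[OF assms(2)])
  show "bdd_above ((\<lambda>\<alpha>. mean_G H n p lam \<alpha>) ` {\<alpha>min..\<alpha>max})"
  proof (rule bdd_aboveI2)
    fix \<alpha> assume "\<alpha> \<in> {\<alpha>min..\<alpha>max}"
    then have "0 < \<alpha>" using assms(1) by auto
    then have "(\<Sum>k<p. w \<alpha> k) \<le> (\<Sum>k<p. 1)" using w01 by (intro sum_mono) auto
    then have "(\<Sum>k<p. w \<alpha> k) \<le> real n" using pn by simp
    then show "mean_G H n p lam \<alpha> \<le> 1" unfolding mean_G_eq by (cases "n = 0") auto
  qed
qed

text \<open>The non-asymptotic form of the theorem: \<open>m\<close> bounds the mean degrees of freedom, and \<open>\<eta>\<close> collects
  everything that tends to zero with \<open>m\<close>.\<close>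

lemma expected_loss_le:
  fixes \<alpha>min \<alpha>max \<epsilon> :: real
  defines "I \<equiv> {\<alpha>min..\<alpha>max}"
  defines "d0 \<equiv> D H n lam \<alpha>max"
  defines "r \<equiv> oracle_risk H \<epsilon> n p lam e \<alpha>min \<alpha>max \<sigma> \<beta>"
  assumes n: "1 \<le> n" and \<alpha>min: "0 < \<alpha>min"
    and d0: "5 \<le> d0" and eps: "0 < \<epsilon>" "\<epsilon> \<le> 1" and del: "0 < \<delta>" "\<delta> \<le> \<epsilon>"
    and m: "\<And>\<alpha>. \<alpha> \<in> I \<Longrightarrow> mean_G H n p lam \<alpha> \<le> m"
    and \<eta>: "0 < \<eta>" "\<eta> < 1" "m * (1 + \<eta>) \<le> \<eta>" "penalty_const \<epsilon> * m \<le> \<eta>"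
    and c2: "1 + (\<epsilon>\<^sup>2 + \<delta>) / 16 \<le> c2 * (1 + \<epsilon>)" "1/2 \<le> c2"
    and \<gamma>: "0 < \<gamma>" "\<gamma> \<le> 1" "c2 * (1 + \<eta>)\<^sup>2 / (1 - \<eta>) \<le> 1 / (1 + \<gamma>)"
    and ahat: "measurable_minimizer H \<epsilon> X lam e \<alpha>min \<alpha>max ahat"
    and star: "\<exists>s. is_arg_min (risk H \<epsilon> n p lam e \<alpha>max \<sigma> \<beta>) (\<lambda>\<alpha>. \<alpha> \<in> I) s"
  shows "0 \<le> r"
    "expected_loss X \<beta> \<sigma> (\<lambda>Y. sigma2_hat H X lam e (ahat Y) Y)
       \<le> ennreal (1 / \<gamma> * (r + (16 * exp 1 + 4 * sup_const) * (\<sigma>\<^sup>2 * sqrt d0 / \<delta>)))"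
proof -
  have I: "I \<subseteq> {0<..}" using \<alpha>min by (auto simp: I_def)
  obtain s where s: "s \<in> I" "\<And>\<alpha>. \<alpha> \<in> I \<Longrightarrow> risk H \<epsilon> n p lam e \<alpha>max \<sigma> \<beta> s \<le> risk H \<epsilon> n p lam e \<alpha>max \<sigma> \<beta> \<alpha>"
    using star by (auto simp: is_arg_min_def not_less)
  have s0: "0 < s" using s(1) I by auto
  have r: "r = risk H \<epsilon> n p lam e \<alpha>max \<sigma> \<beta> s"
    unfolding r_def oracle_risk_def I_def[symmetric]
    by (rule cInf_eq_minimum) (use s in auto)
  have nn: "0 < real n" using n by simp
  let ?V = "penalty H \<epsilon> n lam \<alpha>max"
  have pos: "0 < \<alpha>" if "\<alpha> \<in> I" for \<alpha> using that I by auto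
  have V: "?V \<alpha> = (1 + \<epsilon>) * base_penalty \<epsilon> d0 (\<Sum>k<p. (w \<alpha> k)\<^sup>2)" if "\<alpha> \<in> I" for \<alpha>
    using penalty_eq[OF pos[OF that]] by (simp add: d0_def)
  have mean: "(\<Sum>k<p. w \<alpha> k) / real n \<le> m" if "\<alpha> \<in> I" for \<alpha> using m[OF that] by (simp add: mean_G_eq)
  have m0: "0 \<le> m"
  proof -
    have "0 \<le> (\<Sum>k<p. w s k) / real n" using w01[OF s0] by (intro divide_nonneg_nonneg sum_nonneg) auto
    then show ?thesis using mean[OF s(1)] by linarith
  qed
  have m1: "m < 1"
  proof (rule ccontr)
    assume "\<not> m < 1"
    then have "1 * (1 + \<eta>) \<le> m * (1 + \<eta>)" using \<eta> by (intro mult_right_mono) auto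
    then have "1 * (1 + \<eta>) \<le> \<eta>" using \<eta>(3) by (rule order_trans)
    then show False by simp
  qed
  define vmax where "vmax = penalty_const \<epsilon> * m"
  have pc0: "0 \<le> penalty_const \<epsilon>" using eps by (simp add: penalty_const_def Q_const_def)
  have vm: "0 \<le> vmax" "vmax \<le> \<eta>" using pc0 m0 \<eta> by (auto simp: vmax_def)
  have Vmax: "?V \<alpha> \<le> vmax * real n" if a: "\<alpha> \<in> I" for \<alpha>
  proof -
    have "?V \<alpha> \<le> penalty_const \<epsilon> * (\<Sum>k<p. (w \<alpha> k)\<^sup>2)"
      unfolding V[OF a] using eps d0 by (intro base_penalty_le) (auto intro: sum_nonneg)
    also have "(\<Sum>k<p. (w \<alpha> k)\<^sup>2) \<le> (\<Sum>k<p. w \<alpha> k)"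
      using w01[OF pos[OF a]] by (intro sum_mono) (simp add: power2_eq_square mult_left_le_one_le)
    also have "(\<Sum>k<p. w \<alpha> k) \<le> m * real n" using mean[OF a] nn by (simp add: field_simps)
    finally show ?thesis using pc0 by (simp add: vmax_def mult_left_mono mult.assoc)
  qed
  define \<omega> where "\<omega> = 1 / (1 - m)"
  have om: "1 \<le> \<omega>" "\<omega> \<le> 1 + \<eta>" using m0 m1 \<eta>(3) by (auto simp: \<omega>_def field_simps)
  define c1 where "c1 = c2 * \<omega> / (1 - \<eta>)"
  have c1: "1/2 \<le> c1"
  proof -
    have "1/2 * 1 \<le> c2 * \<omega>" using c2 om by (intro mult_mono) auto
    also have "\<dots> \<le> c1" unfolding c1_def using c2 om \<eta> by (simp add: pos_le_divide_eq mult_left_le)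
    finally show ?thesis by simp
  qed
  define c' where "c' = c1 * (1 + vmax)"
  have c'\<gamma>: "c' \<le> 1 / (1 + \<gamma>)"
  proof -
    have "c' = c2 * (\<omega> * (1 + vmax)) / (1 - \<eta>)" by (simp add: c'_def c1_def)
    also have "\<dots> \<le> c2 * ((1 + \<eta>) * (1 + \<eta>)) / (1 - \<eta>)"
      using c2 om vm \<eta> by (intro divide_right_mono mult_left_mono mult_mono) auto
    also have "\<dots> \<le> 1 / (1 + \<gamma>)" using \<gamma>(3) by (simp add: power2_eq_square)
    finally show ?thesis .
  qed
  have "1 / (1 + \<gamma>) < 1" using \<gamma> by simp
  then have c'1: "c' < 1" using c'\<gamma> by linarith
  have c1c': "c1 \<le> c'" using c1 vm by (simp add: c'_def algebra_simps)
  have gap: "\<gamma> / (1 + \<gamma>) \<le> 1 - c'"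
  proof -
    have "1 - 1 / (1 + \<gamma>) = \<gamma> / (1 + \<gamma>)" using \<gamma> by (simp add: field_simps)
    then show ?thesis using c'\<gamma> by linarith
  qed
  have inv_gap: "1 / (1 - c') \<le> 2 / \<gamma>"
  proof -
    have "1 / (1 - c') \<le> 1 / (\<gamma> / (1 + \<gamma>))" using gap \<gamma> c'1 by (intro divide_left_mono) auto
    also have "\<dots> = (1 + \<gamma>) / \<gamma>" by simp
    also have "\<dots> \<le> 2 / \<gamma>" using \<gamma> by (intro divide_right_mono) auto
    finally show ?thesis .
  qed
  have c1_gap: "c1 / (1 - c') \<le> 1 / \<gamma>"
  proof -
    have "c1 / (1 - c') \<le> (1 / (1 + \<gamma>)) / (\<gamma> / (1 + \<gamma>))"
      using gap \<gamma> c1 c1c' c'\<gamma> by (intro frac_le) auto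
    also have "\<dots> = 1 / \<gamma>" using \<gamma> by simp
    finally show ?thesis .
  qed
  define ah where "ah x = ahat (observation X \<beta> \<sigma> (Matrix.vec n x))" for x
  have Y: "observation X \<beta> \<sigma> (Matrix.vec n x) \<in> carrier_vec n" for x
    by (intro carrier_vecI) (simp add: observation_def)
  have crit: "criterion H \<epsilon> X lam e \<alpha>max (observation X \<beta> \<sigma> (Matrix.vec n x)) \<alpha>
      = scale \<alpha> * rss \<alpha> x * (1 + ?V \<alpha> / real n) / real n" for x \<alpha>
    by (simp add: criterion_def sigma2_hat_eq dims)
  have ahI: "ah x \<in> I" and ah_min: "\<And>\<alpha>. \<alpha> \<in> I \<Longrightarrow> scale (ah x) * rss (ah x) x * (1 + ?V (ah x) / real n)
          \<le> scale \<alpha> * rss \<alpha> x * (1 + ?V \<alpha> / real n)" for x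
  proof -
    have A: "is_arg_min (criterion H \<epsilon> X lam e \<alpha>max (observation X \<beta> \<sigma> (Matrix.vec n x))) (\<lambda>\<alpha>. \<alpha> \<in> I) (ah x)"
      using ahat Y[of x] by (auto simp: measurable_minimizer_def dims I_def ah_def)
    then show "ah x \<in> I" by (simp add: is_arg_min_def)
    fix \<alpha> assume "\<alpha> \<in> I"
    then have "\<not> criterion H \<epsilon> X lam e \<alpha>max (observation X \<beta> \<sigma> (Matrix.vec n x)) \<alpha>
        < criterion H \<epsilon> X lam e \<alpha>max (observation X \<beta> \<sigma> (Matrix.vec n x)) (ah x)"
      using A by (simp add: is_arg_min_def)
    then show "scale (ah x) * rss (ah x) x * (1 + ?V (ah x) / real n) \<le> scale \<alpha> * rss \<alpha> x * (1 + ?V \<alpha> / real n)"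
      unfolding crit using nn by (simp add: not_less divide_le_cancel)
  qed
  let ?C1 = linear_sup_const and ?C2 = quadratic_sup_const
  let ?M = "noise_law n"
  have "\<exists>U. integrable ?M U \<and>
     (\<forall>x\<in>space ?M. \<bar>scale (ah x) * rss (ah x) x - \<sigma>\<^sup>2 * (\<Sum>i<n. (x i)\<^sup>2)\<bar> \<le> U x) \<and>
     (\<integral>x. U x \<partial>?M) \<le>
       (c1 * ((1 + ?V s / real n) * (scale s * bias s + \<sigma>\<^sup>2 * ?V s) + 16 * exp 1 * \<sigma>\<^sup>2 * vmax / \<eta>)
         + \<omega> * \<sigma>\<^sup>2 * (?C1 + ?C2 * (sqrt d0 / \<delta>))) / (1 - c')"
    by (rule loss_majorant[where I=I and m=m and ?c2.0=c2 and \<theta>=\<eta> and \<epsilon>=\<epsilon>])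
       (use n I s(1) d0 eps del V Vmax mean m1 c2 \<eta> \<omega>_def c1_def c1 c'_def c'1 ahI ah_min in auto)
  then obtain U where U: "integrable ?M U"
     "\<And>x. x \<in> space ?M \<Longrightarrow> \<bar>scale (ah x) * rss (ah x) x - \<sigma>\<^sup>2 * (\<Sum>i<n. (x i)\<^sup>2)\<bar> \<le> U x"
     "(\<integral>x. U x \<partial>?M) \<le> (c1 * (r + 16 * exp 1 * \<sigma>\<^sup>2 * vmax / \<eta>)
         + \<omega> * \<sigma>\<^sup>2 * (?C1 + ?C2 * (sqrt d0 / \<delta>))) / (1 - c')"
    unfolding r risk_eq[OF s0] by blast
  have V0: "0 \<le> ?V s" unfolding V[OF s(1)] using eps base_penalty_nonneg[of d0] d0 by (intro mult_nonneg_nonneg) auto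
  have "0 \<le> bias s" unfolding bias_def using w01[OF s0] by (intro sum_nonneg mult_nonneg_nonneg) auto
  moreover have "0 \<le> scale s" unfolding scale_def using mean[OF s(1)] m1 by simp
  ultimately show r0: "0 \<le> r" unfolding r risk_eq[OF s0] using V0 nn by simp
  have sd: "1 \<le> sqrt d0 / \<delta>"
  proof -
    have "\<delta> \<le> 1" "1 \<le> sqrt d0" using del eps d0 by auto
    then have "\<delta> \<le> sqrt d0" by linarith
    then show ?thesis using del by simp
  qed
  define P where "P = \<sigma>\<^sup>2 * (sqrt d0 / \<delta>)"
  have \<sigma>P: "\<sigma>\<^sup>2 \<le> P" unfolding P_def using mult_left_mono[OF sd, of "\<sigma>\<^sup>2"] by simp
  have P0: "0 \<le> P" using \<sigma>P zero_le_power2[of \<sigma>] by linarith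
  have bound: "(\<integral>x. U x \<partial>?M) \<le> 1 / \<gamma> * (r + (16 * exp 1 + 4 * sup_const) * P)"
  proof -
    have C1: "0 \<le> ?C1" and C2: "0 \<le> ?C2" by (auto simp: linear_sup_const_def quadratic_sup_const_def intro!: add_nonneg_nonneg)
    have "(\<integral>x. U x \<partial>?M) \<le> (c1 / (1 - c')) * (r + 16 * exp 1 * \<sigma>\<^sup>2 * vmax / \<eta>)
         + (1 / (1 - c')) * (\<omega> * \<sigma>\<^sup>2 * (?C1 + ?C2 * (sqrt d0 / \<delta>)))"
      using U(3) by (simp add: add_divide_distrib)
    also have "\<dots> \<le> (1 / \<gamma>) * (r + 16 * exp 1 * P) + (2 / \<gamma>) * (2 * ((?C1 + ?C2) * P))"
    proof (intro add_mono mult_mono[OF c1_gap] mult_mono[OF inv_gap] order_refl)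
      have "16 * exp 1 * \<sigma>\<^sup>2 * vmax / \<eta> = 16 * exp 1 * (\<sigma>\<^sup>2 * (vmax / \<eta>))" by simp
      also have "\<dots> \<le> 16 * exp 1 * (P * 1)"
        using \<sigma>P P0 vm \<eta> by (intro mult_left_mono mult_mono) auto
      finally show "16 * exp 1 * \<sigma>\<^sup>2 * vmax / \<eta> \<le> 16 * exp 1 * P" by simp
      have "a + c * y \<le> (a + c) * y" if "0 \<le> a" "1 \<le> y" for a c y :: real
        using mult_left_mono[OF that(2,1)] by (simp add: distrib_right)
      then have "\<sigma>\<^sup>2 * (?C1 + ?C2 * (sqrt d0 / \<delta>)) \<le> \<sigma>\<^sup>2 * ((?C1 + ?C2) * (sqrt d0 / \<delta>))"
        using C1 sd by (intro mult_left_mono zero_le_power2) blast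
      also have "\<dots> = (?C1 + ?C2) * P" by (simp only: P_def mult_ac)
      finally have B: "\<sigma>\<^sup>2 * (?C1 + ?C2 * (sqrt d0 / \<delta>)) \<le> (?C1 + ?C2) * P" .
      have "\<omega> * (\<sigma>\<^sup>2 * (?C1 + ?C2 * (sqrt d0 / \<delta>))) \<le> 2 * ((?C1 + ?C2) * P)"
      proof (rule mult_mono[OF _ B])
        have "0 \<le> ?C2 * (sqrt d0 / \<delta>)" using C2 sd by (intro mult_nonneg_nonneg) auto
        then show "0 \<le> \<sigma>\<^sup>2 * (?C1 + ?C2 * (sqrt d0 / \<delta>))" using C1 by (intro mult_nonneg_nonneg) auto
      qed (use om \<eta> in auto)
      then show "\<omega> * \<sigma>\<^sup>2 * (?C1 + ?C2 * (sqrt d0 / \<delta>)) \<le> 2 * ((?C1 + ?C2) * P)" by (simp only: mult.assoc)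
      show "0 \<le> r + 16 * exp 1 * \<sigma>\<^sup>2 * vmax / \<eta>" using r0 vm \<eta> by simp
      show "0 \<le> \<omega> * \<sigma>\<^sup>2 * (?C1 + ?C2 * (sqrt d0 / \<delta>))"
      proof -
        have "0 \<le> ?C2 * (sqrt d0 / \<delta>)" using C2 sd by (intro mult_nonneg_nonneg) auto
        then show ?thesis using om C1 by (intro mult_nonneg_nonneg) auto
      qed
    qed (use \<gamma> in auto)
    also have "\<dots> \<le> 1 / \<gamma> * (r + (16 * exp 1 + 4 * sup_const) * P)"
    proof -
      have "2 * (2 * ((?C1 + ?C2) * P)) \<le> 4 * sup_const * P" by (simp add: sup_const_def algebra_simps)
      then have "1 / \<gamma> * ((r + 16 * exp 1 * P) + 2 * (2 * ((?C1 + ?C2) * P))) \<le> 1 / \<gamma> * ((r + 16 * exp 1 * P) + 4 * sup_const * P)"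
        using \<gamma> by (intro mult_left_mono add_left_mono) auto
      moreover have "1 / \<gamma> * ((r + 16 * exp 1 * P) + 4 * sup_const * P) = 1 / \<gamma> * (r + (16 * exp 1 + 4 * sup_const) * P)"
        by (simp only: distrib_right add.assoc)
      moreover have "1 / \<gamma> * ((r + 16 * exp 1 * P) + 2 * (2 * ((?C1 + ?C2) * P)))
          = (1 / \<gamma>) * (r + 16 * exp 1 * P) + (2 / \<gamma>) * (2 * ((?C1 + ?C2) * P))"
        by (simp add: distrib_left)
      ultimately show ?thesis by linarith
    qed
    finally show ?thesis .
  qed
  have loss_eq: "loss X \<beta> \<sigma> (\<lambda>Y. sigma2_hat H X lam e (ahat Y) Y) (Matrix.vec n x)
      = \<bar>scale (ah x) * rss (ah x) x - \<sigma>\<^sup>2 * (\<Sum>i<n. (x i)\<^sup>2)\<bar>" for x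
  proof -
    have sq: "sqnorm (\<sigma> \<cdot>\<^sub>v Matrix.vec n x) = \<sigma>\<^sup>2 * (\<Sum>i<n. (x i)\<^sup>2)"
      by (simp add: sqnorm_def scalar_prod_def atLeast0LessThan sum_distrib_left power2_eq_square mult_ac)
    have "loss X \<beta> \<sigma> (\<lambda>Y. sigma2_hat H X lam e (ahat Y) Y) (Matrix.vec n x)
        = real n * \<bar>(scale (ah x) * rss (ah x) x - \<sigma>\<^sup>2 * (\<Sum>i<n. (x i)\<^sup>2)) / real n\<bar>"
      by (simp add: loss_def dims sigma2_hat_eq ah_def[symmetric] sq diff_divide_distrib)
    then show ?thesis using nn by (simp only: abs_divide) simp
  qed
  have "expected_loss X \<beta> \<sigma> (\<lambda>Y. sigma2_hat H X lam e (ahat Y) Y) \<le> (\<integral>\<^sup>+x. ennreal (U x) \<partial>?M)"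
    unfolding expected_loss_def dims loss_eq
    by (intro nn_integral_mono ennreal_leI U(2))
  also have "\<dots> = ennreal (\<integral>x. U x \<partial>?M)"
    using U(1,2) by (intro nn_integral_eq_integral) (auto intro!: AE_I2 order_trans[OF abs_ge_zero])
  also have "\<dots> \<le> ennreal (1 / \<gamma> * (r + (16 * exp 1 + 4 * sup_const) * P))"
    by (rule ennreal_leI[OF bound])
  finally show "expected_loss X \<beta> \<sigma> (\<lambda>Y. sigma2_hat H X lam e (ahat Y) Y)
       \<le> ennreal (1 / \<gamma> * (r + (16 * exp 1 + 4 * sup_const) * (\<sigma>\<^sup>2 * sqrt d0 / \<delta>)))" by (simp add: P_def)
qed

end

theorem mainTheorem2:
  shows "\<exists>C::real. C > 0 \<and>
    (\<forall>(\<epsilon>::real) (H :: real \<Rightarrow> real \<Rightarrow> real)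
      (p :: nat \<Rightarrow> nat) (X :: nat \<Rightarrow> real mat) (\<beta> :: nat \<Rightarrow> real vec) (\<sigma> :: nat \<Rightarrow> real)
      (lam :: nat \<Rightarrow> nat \<Rightarrow> real) (e :: nat \<Rightarrow> nat \<Rightarrow> real vec)
      (\<alpha>min :: nat \<Rightarrow> real) (\<alpha>max :: real) (ahat :: nat \<Rightarrow> real vec \<Rightarrow> real).
      0 < \<epsilon> \<longrightarrow> \<epsilon> \<le> 1 \<longrightarrow>
      ordered_family H \<longrightarrow>
      (\<forall>n. p n \<le> n \<and> X n \<in> carrier_mat n (p n) \<and> invertible_mat (gram (X n))
           \<and> \<beta> n \<in> carrier_vec (p n) \<and> \<sigma> n > 0
           \<and> pos_eigensystem (gram (X n)) (lam n) (e n)) \<longrightarrow>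
      (\<forall>n. 0 < \<alpha>min n \<and> \<alpha>min n \<le> \<alpha>max) \<longrightarrow>
      \<alpha>min \<longlonglongrightarrow> 0 \<longrightarrow>
      (\<lambda>n. SUP \<alpha>\<in>{\<alpha>min n..\<alpha>max}. mean_G H n (p n) (lam n) \<alpha>) \<longlonglongrightarrow> 0 \<longrightarrow>
      (\<forall>n. measurable_minimizer H \<epsilon> (X n) (lam n) (e n) (\<alpha>min n) \<alpha>max (ahat n)) \<longrightarrow>
      (\<forall>n. \<exists>\<alpha>. is_arg_min (risk H \<epsilon> n (p n) (lam n) (e n) \<alpha>max (\<sigma> n) (\<beta> n))
                 (\<lambda>\<alpha>. \<alpha> \<in> {\<alpha>min n..\<alpha>max}) \<alpha>) \<longrightarrow>
      (\<exists>K. \<forall>n. \<forall>\<alpha>>0. (\<Sum>i<n. G H \<alpha> (lam n i)) \<le> K * (\<Sum>i<n. (G H \<alpha> (lam n i))\<^sup>2)) \<longrightarrow>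
      (\<lambda>n. D H n (lam n) (\<alpha>min n) / real n) \<longlonglongrightarrow> 0 \<longrightarrow>
      (\<forall>\<^sub>F n in sequentially. D H n (lam n) \<alpha>max \<ge> 5) \<longrightarrow>
      (\<forall>\<gamma>. 0 < \<gamma> \<and> \<gamma> < \<epsilon> / (1 + \<epsilon>) \<longrightarrow>
        (\<exists>N. \<forall>n\<ge>N.
          let r = oracle_risk H \<epsilon> n (p n) (lam n) (e n) (\<alpha>min n) \<alpha>max (\<sigma> n) (\<beta> n);
              \<rho> = rho H \<epsilon> n (p n) (lam n) (e n) (\<alpha>min n) \<alpha>max (\<sigma> n) (\<beta> n);
              d0 = D H n (lam n) \<alpha>max
          in \<rho> < 1 \<longrightarrow>
            expected_loss (X n) (\<beta> n) (\<sigma> n)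
              (\<lambda>Y. sigma2_hat H (X n) (lam n) (e n) (ahat n Y) Y)
            \<le> ennreal (r / \<gamma> *
                 (1 + 1 / root 4 d0 * ln (1 / real_of_ereal \<rho>) powr (- 1 / 8)
                    + sqrt (C * real_of_ereal \<rho> / (\<epsilon> - \<gamma> - \<gamma> * \<epsilon>)))\<^sup>2))))"
proof -
  define C where "C = 2 * (16 * exp 1 + 4 * sup_const)"
  have sup_const_pos: "0 < sup_const" unfolding sup_const_def linear_sup_const_def quadratic_sup_const_def
    by (intro add_pos_pos mult_pos_pos) auto
  have C0: "0 < C" unfolding C_def using sup_const_pos by (intro mult_pos_pos add_pos_pos) auto
  show ?thesis
  proof (intro exI[of _ C] conjI allI impI C0)
    fix \<epsilon> :: real and H :: "real \<Rightarrow> real \<Rightarrow> real"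
      and p :: "nat \<Rightarrow> nat" and X :: "nat \<Rightarrow> real mat" and \<beta> :: "nat \<Rightarrow> real vec" and \<sigma> :: "nat \<Rightarrow> real"
      and lam :: "nat \<Rightarrow> nat \<Rightarrow> real" and e :: "nat \<Rightarrow> nat \<Rightarrow> real vec"
      and \<alpha>min :: "nat \<Rightarrow> real" and \<alpha>max :: real and ahat :: "nat \<Rightarrow> real vec \<Rightarrow> real" and \<gamma> :: real
    assume eps: "0 < \<epsilon>" "\<epsilon> \<le> 1" and H: "ordered_family H"
      and model: "\<forall>n. p n \<le> n \<and> X n \<in> carrier_mat n (p n) \<and> invertible_mat (gram (X n))
           \<and> \<beta> n \<in> carrier_vec (p n) \<and> \<sigma> n > 0
           \<and> pos_eigensystem (gram (X n)) (lam n) (e n)"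
      and \<alpha>min: "\<forall>n. 0 < \<alpha>min n \<and> \<alpha>min n \<le> \<alpha>max"
      and mean: "(\<lambda>n. SUP \<alpha>\<in>{\<alpha>min n..\<alpha>max}. mean_G H n (p n) (lam n) \<alpha>) \<longlonglongrightarrow> 0"
      and ahat: "\<forall>n. measurable_minimizer H \<epsilon> (X n) (lam n) (e n) (\<alpha>min n) \<alpha>max (ahat n)"
      and star: "\<forall>n. \<exists>\<alpha>. is_arg_min (risk H \<epsilon> n (p n) (lam n) (e n) \<alpha>max (\<sigma> n) (\<beta> n))
                 (\<lambda>\<alpha>. \<alpha> \<in> {\<alpha>min n..\<alpha>max}) \<alpha>"
      and D5: "\<forall>\<^sub>F n in sequentially. D H n (lam n) \<alpha>max \<ge> 5"
      and \<gamma>: "0 < \<gamma> \<and> \<gamma> < \<epsilon> / (1 + \<epsilon>)"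
    define \<delta> where "\<delta> = \<epsilon> - \<gamma> - \<gamma> * \<epsilon>"
    have "\<gamma> * (1 + \<epsilon>) < \<epsilon>" using \<gamma> eps by (simp add: pos_less_divide_eq)
    then have \<delta>0: "0 < \<delta>" by (simp add: \<delta>_def algebra_simps)
    have \<gamma>\<epsilon>: "0 \<le> \<gamma> * \<epsilon>" using \<gamma> eps by simp
    have \<delta>\<epsilon>: "\<delta> \<le> \<epsilon>" using \<gamma> \<gamma>\<epsilon> by (simp add: \<delta>_def)
    have \<gamma>1: "\<gamma> \<le> 1" using \<delta>0 \<gamma>\<epsilon> eps by (simp add: \<delta>_def)
    \<comment> \<open>\<open>c2 = 1 / (1 + \<gamma>')\<close> for \<open>\<gamma>' = (\<epsilon> - \<delta> / 2) / (1 + \<epsilon>)\<close>, which lies strictly between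
      \<open>\<gamma>\<close> and \<open>\<epsilon> / (1 + \<epsilon>)\<close>: half of the slack feeds the gain, half the terms tending to zero.\<close>
    define c2 where "c2 = (1 + \<epsilon>) / (1 + 2 * \<epsilon> - \<delta> / 2)"
    have den: "1 \<le> 1 + 2 * \<epsilon> - \<delta> / 2" "1 + 2 * \<epsilon> - \<delta> / 2 \<le> 3" using \<delta>0 \<delta>\<epsilon> eps by auto
    have c2_half: "1/2 \<le> c2" using den eps \<delta>0 by (simp add: c2_def field_simps)
    have c2_gain: "1 + (\<epsilon>\<^sup>2 + \<delta> / 2) / 16 \<le> c2 * (1 + \<epsilon>)"
    proof -
      have "c2 * (1 + \<epsilon>) = 1 + (\<epsilon>\<^sup>2 + \<delta> / 2) / (1 + 2 * \<epsilon> - \<delta> / 2)"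
        using den by (simp add: c2_def field_simps power2_eq_square)
      moreover have "(\<epsilon>\<^sup>2 + \<delta> / 2) / 16 \<le> (\<epsilon>\<^sup>2 + \<delta> / 2) / (1 + 2 * \<epsilon> - \<delta> / 2)"
        using den \<delta>0 by (intro divide_left_mono) auto
      ultimately show ?thesis by simp
    qed
    have c2_\<gamma>: "c2 < 1 / (1 + \<gamma>)"
    proof -
      have "(1 + \<epsilon>) * (1 + \<gamma>) = 1 + 2 * \<epsilon> - \<delta>" by (simp add: \<delta>_def algebra_simps)
      then have "(1 + \<epsilon>) * (1 + \<gamma>) < 1 + 2 * \<epsilon> - \<delta> / 2" using \<delta>0 by simp
      then show ?thesis using den \<gamma> by (simp add: c2_def field_simps)
    qed
    obtain \<eta> where \<eta>: "0 < \<eta>" "\<eta> < 1" "c2 * (1 + \<eta>)\<^sup>2 / (1 - \<eta>) \<le> 1 / (1 + \<gamma>)"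
    proof -
      have "((\<lambda>\<eta>. c2 * (1 + \<eta>)\<^sup>2 / (1 - \<eta>)) \<longlongrightarrow> c2 * (1 + 0)\<^sup>2 / (1 - 0)) (at_right 0)"
        by (intro tendsto_intros) auto
      then have "\<forall>\<^sub>F \<eta> in at_right 0. c2 * (1 + \<eta>)\<^sup>2 / (1 - \<eta>) < 1 / (1 + \<gamma>)"
        using c2_\<gamma> by (intro order_tendstoD(2)) auto
      moreover have "\<forall>\<^sub>F \<eta> in at_right (0::real). 0 < \<eta>" by (rule eventually_at_right_less)
      moreover have "\<forall>\<^sub>F \<eta> in at_right (0::real). \<eta> < 1"
        by (rule order_tendstoD(2)[OF tendsto_ident_at]) simp
      ultimately have "\<forall>\<^sub>F \<eta> in at_right 0. 0 < \<eta> \<and> \<eta> < 1 \<and> c2 * (1 + \<eta>)\<^sup>2 / (1 - \<eta>) < 1 / (1 + \<gamma>)"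
        by eventually_elim auto
      from eventually_happens'[OF trivial_limit_at_right_real this] show ?thesis
        using that less_imp_le by blast
    qed
    define \<mu> where "\<mu> n = (SUP \<alpha>\<in>{\<alpha>min n..\<alpha>max}. mean_G H n (p n) (lam n) \<alpha>)" for n
    have \<mu>: "\<mu> \<longlonglongrightarrow> 0" using mean by (simp add: \<mu>_def[abs_def])
    have "\<forall>\<^sub>F n in sequentially. \<mu> n * (1 + \<eta>) < \<eta>"
      by (rule order_tendstoD(2)[OF tendsto_mult_left_zero[OF \<mu>]]) (rule \<eta>)
    moreover have "\<forall>\<^sub>F n in sequentially. penalty_const \<epsilon> * \<mu> n < \<eta>"
      by (rule order_tendstoD(2)[OF tendsto_mult_right_zero[OF \<mu>]]) (rule \<eta>)
    ultimately have "\<forall>\<^sub>F n in sequentially. 1 \<le> n \<and> \<mu> n * (1 + \<eta>) \<le> \<eta> \<and> penalty_const \<epsilon> * \<mu> n \<le> \<eta> \<and> D H n (lam n) \<alpha>max \<ge> 5"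
      using D5 eventually_ge_at_top[of 1] by eventually_elim auto
    then obtain N where N: "\<And>n. n \<ge> N \<Longrightarrow> 1 \<le> n \<and> \<mu> n * (1 + \<eta>) \<le> \<eta> \<and> penalty_const \<epsilon> * \<mu> n \<le> \<eta> \<and> D H n (lam n) \<alpha>max \<ge> 5"
      by (auto simp: eventually_sequentially)
    show "\<exists>N. \<forall>n\<ge>N.
          let r = oracle_risk H \<epsilon> n (p n) (lam n) (e n) (\<alpha>min n) \<alpha>max (\<sigma> n) (\<beta> n);
              \<rho> = rho H \<epsilon> n (p n) (lam n) (e n) (\<alpha>min n) \<alpha>max (\<sigma> n) (\<beta> n);
              d0 = D H n (lam n) \<alpha>max
          in \<rho> < 1 \<longrightarrow>
            expected_loss (X n) (\<beta> n) (\<sigma> n)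
              (\<lambda>Y. sigma2_hat H (X n) (lam n) (e n) (ahat n Y) Y)
            \<le> ennreal (r / \<gamma> *
                 (1 + 1 / root 4 d0 * ln (1 / real_of_ereal \<rho>) powr (- 1 / 8)
                    + sqrt (C * real_of_ereal \<rho> / (\<epsilon> - \<gamma> - \<gamma> * \<epsilon>)))\<^sup>2)"
      unfolding Let_def
    proof (intro exI[of _ N] allI impI)
      fix n assume n: "N \<le> n"
      let ?r = "oracle_risk H \<epsilon> n (p n) (lam n) (e n) (\<alpha>min n) \<alpha>max (\<sigma> n) (\<beta> n)"
      let ?\<rho> = "rho H \<epsilon> n (p n) (lam n) (e n) (\<alpha>min n) \<alpha>max (\<sigma> n) (\<beta> n)"
      let ?d0 = "D H n (lam n) \<alpha>max"
      assume \<rho>1: "?\<rho> < 1"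
      interpret regression_model n "p n" "X n" "\<beta> n" "\<sigma> n" "lam n" "e n" H
        using model H by unfold_locales auto
      note E = expected_loss_le[where \<delta>="\<delta> / 2" and m="\<mu> n" and \<eta>=\<eta> and ?c2.0=c2 and \<gamma>=\<gamma> and \<epsilon>=\<epsilon>
          and \<alpha>min="\<alpha>min n" and \<alpha>max=\<alpha>max and ahat="ahat n"]
      have m: "mean_G H n (p n) (lam n) \<alpha> \<le> \<mu> n" if "\<alpha> \<in> {\<alpha>min n..\<alpha>max}" for \<alpha>
        unfolding \<mu>_def using mean_G_le_Sup that \<alpha>min by blast
      have r0: "0 \<le> ?r"
        by (rule E(1)) (use N[OF n] \<alpha>min eps \<delta>0 \<delta>\<epsilon> m \<eta> c2_gain c2_half \<gamma> \<gamma>1 ahat star in auto)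
      have le: "expected_loss (X n) (\<beta> n) (\<sigma> n) (\<lambda>Y. sigma2_hat H (X n) (lam n) (e n) (ahat n Y) Y)
         \<le> ennreal (1 / \<gamma> * (?r + (16 * exp 1 + 4 * sup_const) * ((\<sigma> n)\<^sup>2 * sqrt ?d0 / (\<delta> / 2))))"
        by (rule E(2)) (use N[OF n] \<alpha>min eps \<delta>0 \<delta>\<epsilon> m \<eta> c2_gain c2_half \<gamma> \<gamma>1 ahat star in auto)
      \<comment> \<open>A vanishing oracle risk would make \<open>\<rho>\<close> infinite.\<close>
      have "?r \<noteq> 0" using \<rho>1 by (auto simp: rho_def Let_def)
      then have rpos: "0 < ?r" using r0 by simp
      define \<rho> where "\<rho> = (\<sigma> n)\<^sup>2 * sqrt ?d0 / ?r"
      have \<rho>: "real_of_ereal ?\<rho> = \<rho>" using rpos by (simp add: rho_def Let_def \<rho>_def)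
      have \<rho>0: "0 \<le> \<rho>" using rpos N[OF n] by (simp add: \<rho>_def)
      define q where "q = C * \<rho> / \<delta>"
      have q0: "0 \<le> q" using C0 \<rho>0 \<delta>0 by (simp add: q_def)
      have mid: "0 \<le> 1 / root 4 ?d0 * ln (1 / \<rho>) powr (- 1 / 8)" using N[OF n] by simp
      define t where "t = 1 / root 4 ?d0 * ln (1 / \<rho>) powr (- 1 / 8)"
      have "1 + q \<le> (1 + t + sqrt q)\<^sup>2"
      proof -
        have "1 + q \<le> (1 + sqrt q)\<^sup>2" using q0 by (simp add: power2_sum)
        also have "\<dots> \<le> (1 + t + sqrt q)\<^sup>2" using mid q0 by (intro power_mono) (auto simp: t_def)
        finally show ?thesis .
      qed
      then have "?r / \<gamma> * (1 + q) \<le> ?r / \<gamma> * (1 + t + sqrt q)\<^sup>2"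
        using r0 \<gamma> by (intro mult_left_mono) auto
      moreover have "1 / \<gamma> * (?r + (16 * exp 1 + 4 * sup_const) * ((\<sigma> n)\<^sup>2 * sqrt ?d0 / (\<delta> / 2))) = ?r / \<gamma> * (1 + q)"
      proof -
        have "?r * q = C * ((\<sigma> n)\<^sup>2 * sqrt ?d0) / \<delta>" using rpos by (simp add: q_def \<rho>_def)
        also have "\<dots> = (16 * exp 1 + 4 * sup_const) * ((\<sigma> n)\<^sup>2 * sqrt ?d0 / (\<delta> / 2))" by (simp add: C_def)
        finally show ?thesis by (simp add: distrib_left add_divide_distrib)
      qed
      ultimately have "1 / \<gamma> * (?r + (16 * exp 1 + 4 * sup_const) * ((\<sigma> n)\<^sup>2 * sqrt ?d0 / (\<delta> / 2)))
          \<le> ?r / \<gamma> * (1 + t + sqrt q)\<^sup>2" by (simp only:)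
      then show "expected_loss (X n) (\<beta> n) (\<sigma> n) (\<lambda>Y. sigma2_hat H (X n) (lam n) (e n) (ahat n Y) Y)
            \<le> ennreal (?r / \<gamma> *
                 (1 + 1 / root 4 ?d0 * ln (1 / real_of_ereal ?\<rho>) powr (- 1 / 8)
                    + sqrt (C * real_of_ereal ?\<rho> / (\<epsilon> - \<gamma> - \<gamma> * \<epsilon>)))\<^sup>2)"
        unfolding \<rho> \<delta>_def[symmetric] q_def[symmetric] t_def[symmetric]
        by (intro order_trans[OF le] ennreal_leI)
    qed
  qed
qed

end
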